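(* Let $q$ be an odd prime power, $A=\mathbb F_q[T]$, $F=\mathbb F_q(T)$, and let $\psi:A\to F\{\tau\}$ be a Drinfeld $A$-module over $F$ of rank $2$. Let $\mathfrak p=pA\in\mathcal P_\psi$ be a prime of good reduction of $\psi$, with $p\in A$ monic irreducible. Let $a_{\mathfrak p}(\psi),b_{\mathfrak p}(\psi),\delta_{\mathfrak p}(\psi)\in A$ be the following uniquely determined elements: (a) $a_{\mathfrak p}(\psi)$ is the coefficient of $x$ in the $\mathfrak p$-Weil polynomial, which has the form $P_{\psi,\mathfrak p}(x)=x^2+a_{\mathfrak p}(\psi)x+u_{\mathfrak p}(\psi)p\in A[x]$ with $u_{\mathfrak p}(\psi)\in\mathbb F_q^\times$; (b) $b_{\mathfrak p}(\psi)$ is the unique monic polynomial such that, for any root $\pi_{\mathfrak p}(\psi)$ of $P_{\psi,\mathfrak p}$, $\operatorname{End}_{\mathbb F_{\mathfrak p}}(\psi\otimes\mathbb F_{\mathfrak p})/A[\pi_{\mathfrak p}(\psi)]\cong_A A/b_{\mathfrak p}(\psi)A$; (c) $\delta_{\mathfrak p}(\psi)$ is the unique generator of the discriminant ideal of $\operatorname{End}_{\mathbb F_{\mathfrak p}}(\psi\otimes\mathbb F_{\mathfrak p})$ satisfying $a_{\mathfrak p}(\psi)^2-4u_{\mathfrak p}(\psi)p=b_{\mathfrak p}(\psi)^2\delta_{\mathfrak p}(\psi)$. Then for any $m\in A$ coprime to $p$, the reduction modulo $m$ of the matrix $$\begin{pmatrix}-\frac{a_{\mathfrak p}(\psi)}{2}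 & \frac{\delta_{\mathfrak p}(\psi)b_{\mathfrak p}(\psi)}{2}\\ \frac{b_{\mathfrak p}(\psi)}{2} & -\frac{a_{\mathfrak p}(\psi)}{2}\end{pmatrix}\in M_2(A)$$ represents the conjugacy class in $\operatorname{GL}_2(A/mA)$ of $\bar\rho_{\psi,m}(\operatorname{Frob}_{\mathfrak p})$, the image of the Frobenius at $\mathfrak p$ in the $m$-th division field $F(\psi[m])$.
   Context: $K\{\tau\}$ denotes the twisted polynomial ring over a field $K\supseteq\mathbb F_q$ with $\tau c=c^q\tau$. A Drinfeld $A$-module of rank $r$ over $F$ (with $A\subset F$ the canonical inclusion) is a ring homomorphism $\psi:A\to F\{\tau\}$ determined by $\psi_T=T+g_1\tau+\dots+g_r\tau^r$, $g_i\in F$, $g_r\neq0$. For $0\ne a\in A$, $\psi_a(x)$ is the associated additive polynomial (replace $\tau^i$ by $x^{q^i}$), $\psi[a]\subset F^{\mathrm{sep}}$ its set of roots, an $A$-module via $\psi$ isomorphic to $(A/aA)^{r}$; $F(\psi[a])$ is the $a$-th division field, and $\bar\rho_{\psi,a}:\operatorname{Gal}(F^{\mathrm{sep}}/F)\to\operatorname{GL}_r(A/aA)$ is the representation given by the Galois action on $\psi[a]$. A prime $\mathfrak p=pA$ ($p$ monic irreducible) is a prime of good reduction if $\psi$ is isomorphic over $F$ (i.e. $\psi'_a=c^{-1}\psi_a c$ for some $c\in F^\times$) to a Drinfeld module whose coefficients $g_i$ are integral at $\mathfrak p$ with $g_r$ a $\mathfrak p$-unit; then reducing coefficients gives a rank-$r$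 Drinfeld module $\psi\otimes\mathbb F_{\mathfrak p}:A\to\mathbb F_{\mathfrak p}\{\tau\}$, $\mathbb F_{\mathfrak p}=A/\mathfrak p$. $\mathcal P_\psi$ is the set of such primes. For $\mathfrak p\in\mathcal P_\psi$ and a prime $\ell\ne\mathfrak p$, Frobenius at $\mathfrak p$ acts (unramified) on the $\ell$-adic Tate module of $\psi$, and its characteristic polynomial $P_{\psi,\mathfrak p}(x)\in A[x]$ (the $\mathfrak p$-Weil polynomial) is independent of $\ell$ and equals the characteristic polynomial of the Frobenius endomorphism $\tau^{\deg\mathfrak p}$ of $\psi\otimes\mathbb F_{\mathfrak p}$; a root $\pi_{\mathfrak p}(\psi)$ is identified with this endomorphism, so $A[\pi_{\mathfrak p}(\psi)]\subseteq\operatorname{End}_{\mathbb F_{\mathfrak p}}(\psi\otimes\mathbb F_{\mathfrak p})$, the latter being the centralizer of the image of $A$ in $\mathbb F_{\mathfrak p}\{\tau\}$; both are $A$-orders in the quadratic field $F(\pi_{\mathfrak p}(\psi))$. *)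

theory Defs
  imports
    "Jordan_Normal_Form.Char_Poly"
    "HOL-Algebra.QuotRing"
    "HOL-Algebra.Algebraic_Closure_Type"
    "HOL-Computational_Algebra.Polynomial_Factorial"
    "HOL-Library.Cardinality"
begin

hide_const (open) up_ring.coeff up_ring.monom Module.module.smult Divisibility.irreducible
  Polynomials.degree Polynomials.lead_coeff


text \<open>
  For a finite field \<open>'q\<close> with \<open>q = CARD('q)\<close> elements, \<open>'q poly\<close> is \<open>A\<close> (with \<open>T = [:0, 1:]\<close>),
  \<open>'q poly fract\<close> is \<open>F\<close>, and \<open>'q poly fract alg_closure\<close> is an algebraic closure of \<open>F\<close>.
\<close>

type_synonym 'q ratfun = "'q poly fract"
type_synonym 'q closure = "'q poly fract alg_closure"

definition emb :: "'q::field poly \<Rightarrow> 'q closure" where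
  "emb a = to_ac (to_fract a)"


subsection \<open>Twisted polynomials\<close>

text \<open>
  A twisted polynomial with coefficients \<open>c\<^sub>i\<close> at \<open>\<tau>\<^sup>i\<close> is stored as the ordinary polynomial with
  the same coefficients; only the product changes, by \<open>\<tau> c = c\<^sup>q \<tau>\<close>.
\<close>

definition tw_mult :: "nat \<Rightarrow> 'a::comm_ring_1 poly \<Rightarrow> 'a poly \<Rightarrow> 'a poly" where
  "tw_mult q f g =
    (\<Sum>i\<le>degree f. \<Sum>j\<le>degree g. monom (coeff f i * coeff g j ^ (q ^ i)) (i + j))"

definition twisted_ring :: "nat \<Rightarrow> 'a::comm_ring_1 poly ring" where
  "twisted_ring q =
    \<lparr>carrier = UNIV, monoid.mult = tw_mult q, one = 1, ring.zero = 0, add = (+)\<rparr>"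

text \<open>The value at \<open>x\<close> of the additive polynomial \<open>\<Sum> c\<^sub>i x^(q^i)\<close> attached to \<open>\<Sum> c\<^sub>i \<tau>\<^sup>i\<close>.\<close>

definition tw_eval :: "'q::{finite,field} ratfun poly \<Rightarrow> 'q closure \<Rightarrow> 'q closure" where
  "tw_eval f x = (\<Sum>i\<le>degree f. to_ac (coeff f i) * x ^ (CARD('q) ^ i))"


subsection \<open>Drinfeld modules over \<open>F\<close> and their torsion\<close>

definition drinfeld_module :: "nat \<Rightarrow> ('q::{finite,field} poly \<Rightarrow> 'q ratfun poly) \<Rightarrow> bool" where
  "drinfeld_module r \<psi> \<longleftrightarrow>
    r \<ge> 1 \<and>
    \<psi> \<in> ring_hom ring_of_type_algebra (twisted_ring CARD('q)) \<and>
    (\<forall>c. \<psi> [:c:] = [:to_fract [:c:]:]) \<and>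
    coeff (\<psi> [:0, 1:]) 0 = to_fract [:0, 1:] \<and>
    degree (\<psi> [:0, 1:]) = r"

text \<open>
  For \<open>a \<noteq> 0\<close> the additive polynomial of \<open>\<psi>\<^sub>a\<close> has the nonzero constant derivative \<open>a\<close>, so all its
  roots in the algebraic closure lie in \<open>sep_closure\<close> below.
\<close>

definition torsion :: "('q::{finite,field} poly \<Rightarrow> 'q ratfun poly) \<Rightarrow> 'q poly \<Rightarrow> 'q closure set" where
  "torsion \<psi> a = {x. tw_eval (\<psi> a) x = 0}"

definition torsion_basis ::
  "nat \<Rightarrow> ('q::{finite,field} poly \<Rightarrow> 'q ratfun poly) \<Rightarrow> 'q poly \<Rightarrow> (nat \<Rightarrow> 'q closure) \<Rightarrow> bool" where
  "torsion_basis r \<psi> m w \<longleftrightarrow>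
    (\<forall>i<r. w i \<in> torsion \<psi> m) \<and>
    (\<forall>x\<in>torsion \<psi> m. \<exists>c. x = (\<Sum>i<r. tw_eval (\<psi> (c i)) (w i))) \<and>
    (\<forall>c. (\<Sum>i<r. tw_eval (\<psi> (c i)) (w i)) = 0 \<longrightarrow> (\<forall>i<r. m dvd c i))"


subsection \<open>The Galois group of \<open>F\<close> and Frobenius elements\<close>

definition sep_closure :: "'q::{finite,field} closure set" where
  "sep_closure =
    {x. \<exists>f :: 'q ratfun poly. coprime f (pderiv f) \<and> poly (map_poly to_ac f) x = 0}"

definition abs_galois :: "('q::{finite,field} closure \<Rightarrow> 'q closure) set" where
  "abs_galois =
    {\<sigma>. \<sigma> \<in> ring_iso (ring_of_type_algebra\<lparr>carrier := sep_closure\<rparr>)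
                    (ring_of_type_algebra\<lparr>carrier := sep_closure\<rparr>) \<and>
        (\<forall>x. \<sigma> (to_ac x) = to_ac x)}"

definition integral_closure :: "'q::{finite,field} closure set" where
  "integral_closure =
    {x \<in> sep_closure. \<exists>f :: 'q poly poly. lead_coeff f = 1 \<and> poly (map_poly emb f) x = 0}"

text \<open>
  The congruence below forces \<open>\<sigma>\<close> to preserve \<open>Q\<close>, so it lies in the decomposition group of \<open>Q\<close>.
\<close>

definition frobenius_elements ::
  "'q::{finite,field} poly \<Rightarrow> ('q closure \<Rightarrow> 'q closure) set" where
  "frobenius_elements p =
    {\<sigma> \<in> abs_galois. \<exists>Q.
      primeideal Q (ring_of_type_algebra\<lparr>carrier := integral_closure\<rparr>) \<and>
      {a. emb a \<in> Q} = {a. p dvd a} \<and>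
      (\<forall>x\<in>integral_closure. \<sigma> x - x ^ (CARD('q) ^ degree p) \<in> Q)}"


subsection \<open>Tate modules and the Weil polynomial\<close>

text \<open>
  An element of the completion \<open>A\<^sub>\<ell> = lim A/\<ell>\<^sup>n\<close> is the sequence of its reduced representatives
  modulo \<open>\<ell>\<^sup>n\<close>.
\<close>

definition adic_ints :: "'q::field poly \<Rightarrow> (nat \<Rightarrow> 'q poly) set" where
  "adic_ints l = {\<alpha>. \<forall>n. \<alpha> n = \<alpha> (Suc n) mod l ^ n}"

definition tate_module ::
  "('q::{finite,field} poly \<Rightarrow> 'q ratfun poly) \<Rightarrow> 'q poly \<Rightarrow> (nat \<Rightarrow> 'q closure) set" where
  "tate_module \<psi> l = {x. x 0 = 0 \<and> (\<forall>n. tw_eval (\<psi> l) (x (Suc n)) = x n)}"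

definition tate_comb ::
  "nat \<Rightarrow> ('q::{finite,field} poly \<Rightarrow> 'q ratfun poly) \<Rightarrow> (nat \<Rightarrow> nat \<Rightarrow> 'q poly) \<Rightarrow>
   (nat \<Rightarrow> nat \<Rightarrow> 'q closure) \<Rightarrow> nat \<Rightarrow> 'q closure" where
  "tate_comb r \<psi> \<alpha> e = (\<lambda>n. \<Sum>i<r. tw_eval (\<psi> (\<alpha> i n)) (e i n))"

definition tate_basis ::
  "nat \<Rightarrow> ('q::{finite,field} poly \<Rightarrow> 'q ratfun poly) \<Rightarrow> 'q poly \<Rightarrow>
   (nat \<Rightarrow> nat \<Rightarrow> 'q closure) \<Rightarrow> bool" where
  "tate_basis r \<psi> l e \<longleftrightarrow>
    (\<forall>i<r. e i \<in> tate_module \<psi> l) \<and>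
    (\<forall>x\<in>tate_module \<psi> l. \<exists>!\<alpha>. (\<forall>i<r. \<alpha> i \<in> adic_ints l) \<and> (\<forall>i\<ge>r. \<alpha> i = (\<lambda>_. 0)) \<and>
       x = tate_comb r \<psi> \<alpha> e)"

text \<open>
  \<open>M i j\<close> is the \<open>(i, j)\<close> entry, in \<open>A\<^sub>\<ell>\<close>, of the matrix of \<open>\<sigma>\<close> on the Tate module. Two polynomials
  over \<open>A\<^sub>\<ell>\<close> are equal iff they agree modulo every \<open>\<ell>\<^sup>n\<close>.
\<close>

definition tate_char_poly ::
  "nat \<Rightarrow> ('q::{finite,field} poly \<Rightarrow> 'q ratfun poly) \<Rightarrow> 'q poly \<Rightarrow>
   ('q closure \<Rightarrow> 'q closure) \<Rightarrow> 'q poly poly \<Rightarrow> bool" where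
  "tate_char_poly r \<psi> l \<sigma> P \<longleftrightarrow>
    (\<exists>e M. tate_basis r \<psi> l e \<and>
      (\<forall>i<r. \<forall>j<r. M i j \<in> adic_ints l) \<and>
      (\<forall>j<r. (\<lambda>n. \<sigma> (e j n)) = tate_comb r \<psi> (\<lambda>i. M i j) e) \<and>
      (\<forall>n. map_poly (\<lambda>c. c mod l ^ n) (char_poly (mat r r (\<lambda>(i, j). M i j n))) =
           map_poly (\<lambda>c. c mod l ^ n) P))"

definition weil_poly ::
  "nat \<Rightarrow> ('q::{finite,field} poly \<Rightarrow> 'q ratfun poly) \<Rightarrow> 'q poly \<Rightarrow> 'q poly poly \<Rightarrow> bool" where
  "weil_poly r \<psi> p P \<longleftrightarrow>
    (\<forall>l. lead_coeff l = 1 \<and> irreducible l \<and> l \<noteq> p \<longrightarrow>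
      (\<forall>\<sigma>\<in>frobenius_elements p. tate_char_poly r \<psi> l \<sigma> P))"


subsection \<open>Good reduction\<close>

definition integral_at :: "'q::field poly \<Rightarrow> 'q ratfun \<Rightarrow> bool" where
  "integral_at p x \<longleftrightarrow> (\<exists>a s. \<not> p dvd s \<and> x = Fract a s)"

definition unit_at :: "'q::field poly \<Rightarrow> 'q ratfun \<Rightarrow> bool" where
  "unit_at p x \<longleftrightarrow> (\<exists>a s. \<not> p dvd a \<and> \<not> p dvd s \<and> x = Fract a s)"

text \<open>The residue field \<open>A/pA\<close> is represented by the polynomials that are reduced modulo \<open>p\<close>.\<close>

definition residue :: "'q::field poly \<Rightarrow> 'q ratfun \<Rightarrow> 'q poly" where
  "residue p x = (THE c. c mod p = c \<and> (\<exists>a s. \<not> p dvd s \<and> x = Fract a s \<and> p dvd s * c - a))"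

definition drinfeld_twist ::
  "'q::{finite,field} ratfun \<Rightarrow> ('q poly \<Rightarrow> 'q ratfun poly) \<Rightarrow> 'q poly \<Rightarrow> 'q ratfun poly" where
  "drinfeld_twist c \<psi> a = tw_mult CARD('q) [:inverse c:] (tw_mult CARD('q) (\<psi> a) [:c:])"

definition good_model ::
  "nat \<Rightarrow> 'q::{finite,field} poly \<Rightarrow> ('q poly \<Rightarrow> 'q ratfun poly) \<Rightarrow> bool" where
  "good_model r p \<psi> \<longleftrightarrow>
    (\<forall>i\<le>r. integral_at p (coeff (\<psi> [:0, 1:]) i)) \<and> unit_at p (coeff (\<psi> [:0, 1:]) r)"

definition good_primes ::
  "nat \<Rightarrow> ('q::{finite,field} poly \<Rightarrow> 'q ratfun poly) \<Rightarrow> 'q poly set" where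
  "good_primes r \<psi> =
    {p. lead_coeff p = 1 \<and> irreducible p \<and> (\<exists>c. c \<noteq> 0 \<and> good_model r p (drinfeld_twist c \<psi>))}"

text \<open>
  The reduction depends on the chosen good model, up to isomorphism; \<open>is_reduction\<close> allows every
  such choice.
\<close>

definition is_reduction ::
  "nat \<Rightarrow> ('q::{finite,field} poly \<Rightarrow> 'q ratfun poly) \<Rightarrow> 'q poly \<Rightarrow> ('q poly \<Rightarrow> 'q poly poly) \<Rightarrow> bool" where
  "is_reduction r \<psi> p \<phi> \<longleftrightarrow>
    (\<exists>c. c \<noteq> 0 \<and> good_model r p (drinfeld_twist c \<psi>) \<and>
      \<phi> = (\<lambda>a. map_poly (residue p) (drinfeld_twist c \<psi> a)))"

definition reduce_coeffs :: "'q::field poly \<Rightarrow> 'q poly poly \<Rightarrow> 'q poly poly" where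
  "reduce_coeffs p f = map_poly (\<lambda>c. c mod p) f"

definition residue_twisted_ring :: "'q::{finite,field} poly \<Rightarrow> 'q poly poly ring" where
  "residue_twisted_ring p =
    \<lparr>carrier = {f. reduce_coeffs p f = f},
     monoid.mult = (\<lambda>f g. reduce_coeffs p (tw_mult CARD('q) f g)),
     one = 1, ring.zero = 0, add = (+)\<rparr>"


subsection \<open>The endomorphism ring of the reduction\<close>

definition endo_ring ::
  "'q::{finite,field} poly \<Rightarrow> ('q poly \<Rightarrow> 'q poly poly) \<Rightarrow> 'q poly poly set" where
  "endo_ring p \<phi> =
    {u \<in> carrier (residue_twisted_ring p).
      \<forall>a. u \<otimes>\<^bsub>residue_twisted_ring p\<^esub> \<phi> a = \<phi> a \<otimes>\<^bsub>residue_twisted_ring p\<^esub> u}"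

definition endo_smult ::
  "'q::{finite,field} poly \<Rightarrow> ('q poly \<Rightarrow> 'q poly poly) \<Rightarrow> 'q poly \<Rightarrow> 'q poly poly \<Rightarrow> 'q poly poly" where
  "endo_smult p \<phi> a u = \<phi> a \<otimes>\<^bsub>residue_twisted_ring p\<^esub> u"

text \<open>
  \<open>A[\<pi>]\<close>: all values of polynomials over \<open>A\<close> at the Frobenius endomorphism \<open>\<pi> = \<tau>\<^bsup>deg p\<^esup>\<close>, whose
  \<open>i\<close>-th power is \<open>monom 1 (degree p * i)\<close>.
\<close>

definition frob_order ::
  "'q::{finite,field} poly \<Rightarrow> ('q poly \<Rightarrow> 'q poly poly) \<Rightarrow> 'q poly poly set" where
  "frob_order p \<phi> =
    range (\<lambda>f :: 'q poly poly. \<Sum>i\<le>degree f. endo_smult p \<phi> (coeff f i) (monom 1 (degree p * i)))"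

definition additive_group :: "'a::ab_group_add set \<Rightarrow> 'a monoid" where
  "additive_group M = \<lparr>carrier = M, monoid.mult = (+), one = 0\<rparr>"

text \<open>
  \<open>M/N\<close> and \<open>M'/N'\<close> are isomorphic as modules over the ring of scalars, for the scalar
  multiplications \<open>s\<close> and \<open>s'\<close>.
\<close>

definition quot_modules_iso ::
  "('r \<Rightarrow> 'a \<Rightarrow> 'a) \<Rightarrow> 'a::ab_group_add set \<Rightarrow> 'a set \<Rightarrow>
   ('r \<Rightarrow> 'b \<Rightarrow> 'b) \<Rightarrow> 'b::ab_group_add set \<Rightarrow> 'b set \<Rightarrow> bool" where
  "quot_modules_iso s M N s' M' N' \<longleftrightarrow>
    (\<exists>h \<in> iso (additive_group M Mod N) (additive_group M' Mod N').
      \<forall>a. \<forall>x\<in>M. \<forall>y\<in>M'.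
        h (N #>\<^bsub>additive_group M\<^esub> x) = N' #>\<^bsub>additive_group M'\<^esub> y \<longrightarrow>
        h (N #>\<^bsub>additive_group M\<^esub> s a x) = N' #>\<^bsub>additive_group M'\<^esub> s' a y)"

definition endo_comb ::
  "'q::{finite,field} poly \<Rightarrow> ('q poly \<Rightarrow> 'q poly poly) \<Rightarrow> nat \<Rightarrow> (nat \<Rightarrow> 'q poly) \<Rightarrow>
   (nat \<Rightarrow> 'q poly poly) \<Rightarrow> 'q poly poly" where
  "endo_comb p \<phi> n c e = (\<Sum>i<n. endo_smult p \<phi> (c i) (e i))"

definition endo_basis ::
  "'q::{finite,field} poly \<Rightarrow> ('q poly \<Rightarrow> 'q poly poly) \<Rightarrow> nat \<Rightarrow> (nat \<Rightarrow> 'q poly poly) \<Rightarrow> bool" where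
  "endo_basis p \<phi> n e \<longleftrightarrow>
    (\<forall>i<n. e i \<in> endo_ring p \<phi>) \<and>
    (\<forall>x\<in>endo_ring p \<phi>. \<exists>!c. (\<forall>i\<ge>n. c i = 0) \<and> x = endo_comb p \<phi> n c e)"

definition endo_coords ::
  "'q::{finite,field} poly \<Rightarrow> ('q poly \<Rightarrow> 'q poly poly) \<Rightarrow> nat \<Rightarrow> (nat \<Rightarrow> 'q poly poly) \<Rightarrow>
   'q poly poly \<Rightarrow> nat \<Rightarrow> 'q poly" where
  "endo_coords p \<phi> n e x = (THE c. (\<forall>i\<ge>n. c i = 0) \<and> x = endo_comb p \<phi> n c e)"

text \<open>The trace of multiplication by \<open>x\<close>, and the discriminant \<open>det (Tr (e\<^sub>i e\<^sub>j))\<close>.\<close>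

definition endo_trace ::
  "'q::{finite,field} poly \<Rightarrow> ('q poly \<Rightarrow> 'q poly poly) \<Rightarrow> nat \<Rightarrow> (nat \<Rightarrow> 'q poly poly) \<Rightarrow>
   'q poly poly \<Rightarrow> 'q poly" where
  "endo_trace p \<phi> n e x = (\<Sum>i<n. endo_coords p \<phi> n e (x \<otimes>\<^bsub>residue_twisted_ring p\<^esub> e i) i)"

definition endo_disc ::
  "'q::{finite,field} poly \<Rightarrow> ('q poly \<Rightarrow> 'q poly poly) \<Rightarrow> nat \<Rightarrow> (nat \<Rightarrow> 'q poly poly) \<Rightarrow> 'q poly" where
  "endo_disc p \<phi> n e =
    det (mat n n (\<lambda>(i, j). endo_trace p \<phi> n e (e i \<otimes>\<^bsub>residue_twisted_ring p\<^esub> e j)))"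

text \<open>
  The discriminants of two bases differ by the square of a unit, so all bases generate the same
  ideal.
\<close>

definition disc_ideal ::
  "'q::{finite,field} poly \<Rightarrow> ('q poly \<Rightarrow> 'q poly poly) \<Rightarrow> 'q poly set" where
  "disc_ideal p \<phi> = {f * endo_disc p \<phi> n e | f n e. endo_basis p \<phi> n e}"


subsection \<open>The representation on \<open>\<psi>[m]\<close>\<close>

text \<open>
  Matrices over \<open>A/mA\<close> are represented by matrices over \<open>A\<close>, equality being congruence modulo \<open>m\<close>.
\<close>

definition mat_cong :: "'q::field poly \<Rightarrow> 'q poly mat \<Rightarrow> 'q poly mat \<Rightarrow> bool" where
  "mat_cong m B C \<longleftrightarrow> map_mat (\<lambda>c. c mod m) B = map_mat (\<lambda>c. c mod m) C"

definition GL_mod :: "nat \<Rightarrow> 'q::field poly \<Rightarrow> 'q poly mat set" where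
  "GL_mod r m =
    {B \<in> carrier_mat r r. \<exists>C \<in> carrier_mat r r. mat_cong m (B * C) (1\<^sub>m r) \<and> mat_cong m (C * B) (1\<^sub>m r)}"

definition conj_GL_mod :: "nat \<Rightarrow> 'q::field poly \<Rightarrow> 'q poly mat \<Rightarrow> 'q poly mat \<Rightarrow> bool" where
  "conj_GL_mod r m B C \<longleftrightarrow>
    B \<in> GL_mod r m \<and> C \<in> GL_mod r m \<and> (\<exists>U \<in> GL_mod r m. mat_cong m (U * B) (C * U))"

definition rho_matrix ::
  "nat \<Rightarrow> ('q::{finite,field} poly \<Rightarrow> 'q ratfun poly) \<Rightarrow> (nat \<Rightarrow> 'q closure) \<Rightarrow>
   ('q closure \<Rightarrow> 'q closure) \<Rightarrow> 'q poly mat \<Rightarrow> bool" where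
  "rho_matrix r \<psi> w \<sigma> B \<longleftrightarrow>
    B \<in> carrier_mat r r \<and> (\<forall>j<r. \<sigma> (w j) = (\<Sum>i<r. tw_eval (\<psi> (B $$ (i, j))) (w i)))"

text \<open>
  The representation is defined up to the choice of a basis of \<open>\<psi>[m]\<close>: a basis exists, and in every
  basis the matrix of \<open>\<sigma>\<close> is conjugate to \<open>C\<close>.
\<close>

definition represents_rho ::
  "nat \<Rightarrow> ('q::{finite,field} poly \<Rightarrow> 'q ratfun poly) \<Rightarrow> 'q poly \<Rightarrow>
   ('q closure \<Rightarrow> 'q closure) \<Rightarrow> 'q poly mat \<Rightarrow> bool" where
  "represents_rho r \<psi> m \<sigma> C \<longleftrightarrow>
    (\<exists>w. torsion_basis r \<psi> m w) \<and>
    (\<forall>w. torsion_basis r \<psi> m w \<longrightarrow>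
      (\<exists>B. rho_matrix r \<psi> w \<sigma> B) \<and> (\<forall>B. rho_matrix r \<psi> w \<sigma> B \<longrightarrow> conj_GL_mod r m B C))"

end

theory Submission
  imports Defs
begin

text \<open>
  Let \<open>\<pi> = \<tau>\<^bsup>deg p\<^esup>\<close> be the Frobenius of the reduction \<open>\<phi>\<close> and \<open>E\<close> its endomorphism ring. Reduction modulo a
  prime above \<open>p\<close> is injective on torsion prime to \<open>p\<close> and turns a Frobenius element \<open>\<sigma>\<close> into \<open>\<pi>\<close>. As the
  Weil polynomial kills \<open>\<sigma>\<close> on infinitely many torsion points, \<open>\<pi>\<^sup>2 + a \<pi> + u p = 0\<close> in \<open>E\<close>, so that
  \<open>A[\<pi>] = A + A \<pi>\<close>. From \<open>E/A[\<pi>] \<cong> A/b\<close> one obtains \<open>E = A + A \<beta>\<close> with \<open>b \<beta> \<in> \<pi> + A\<close>, and comparing coefficients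
  in \<open>(2 \<pi> + a)\<^sup>2 = b\<^sup>2 \<delta>\<close> shows \<open>2 \<pi> + a = b \<theta>\<close> for some \<open>\<theta> \<in> E\<close>. Hence \<open>2 \<sigma> + a\<close> kills \<open>\<psi>[b]\<close>, and
  \<open>\<Theta> = (2 \<sigma> + a) / b\<close> is a well defined operator on \<open>\<psi>[m]\<close> with \<open>\<Theta>\<^sup>2 = \<delta>\<close>.

  If \<open>\<Theta>\<close> were a scalar \<open>c\<close> modulo a prime \<open>l\<close> dividing \<open>m\<close>, then \<open>2 \<pi> + a - b c\<close> would kill \<open>\<phi>[b l]\<close> and thus
  be divisible by \<open>b l\<close> in \<open>E\<close>; since \<open>b E \<subseteq> A + A \<pi>\<close>, this would put \<open>\<pi>\<close> into \<open>A\<close>. So \<open>\<Theta>\<close> has a cyclic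
  vector \<open>x\<close> modulo \<open>m\<close>, and in the basis \<open>x, \<Theta> x\<close> the matrix of \<open>\<sigma> = (b \<Theta> - a) / 2\<close> is the asserted one.
\<close>

section \<open>Twisted polynomials\<close>

text \<open>An endomorphism of the reduction does not act on \<open>\<psi>[m]\<close> itself. It is
  transported by lifting its coefficients to \<open>A\<close> and evaluating the lift at torsion
  points. The value is determined only modulo the prime \<open>Q\<close> above \<open>p\<close>, so
  each transfer is a congruence, which becomes an equality only between torsion points of order
  prime to \<open>p\<close>. Hence the conductor \<open>b\<close> must be prime to \<open>p\<close>
  as well; this follows from the discriminant relation for odd \<open>q\<close>.

  The converse passage, from vanishing on torsion to divisibility in \<open>E\<close>, counts roots
  and needs \<open>q^(2 deg N)\<close> points killed by \<open>N\<close>. The hypothesis on the Weil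
  polynomial provides a Tate basis at every prime other than \<open>p\<close>, and the resulting
  torsion bases are glued over the prime powers dividing \<open>N\<close>.

  Reduction is defined on a twist with good coefficients, while the claim concerns
  \<open>\<psi>\<close>; multiplication by the twisting constant links the two. As
  \<open>\<sigma>\<close> is constrained on the separable closure only, its laws apply to a point
  only once that point is known to be separable over \<open>F\<close>.\<close>

lemma power_card_eq_same:
  fixes x :: "'q::{finite,field}"
  shows "x ^ CARD('q) = x"
proof (cases "x = 0")
  case False
  have "x * (\<Prod>y\<in>UNIV-{0}. x * y) = x * x ^ (CARD('q) - 1) * \<Prod>(UNIV-{0})"
    by (simp add: prod.distrib mult_ac)
  also have "x * x ^ (CARD('q) - 1) = x ^ Suc (CARD('q) - 1)"
    by (subst power_Suc) auto
  also have "Suc (CARD('q) - 1) = CARD('q)"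
    using finite_UNIV_card_ge_0[where ?'a = 'q] by simp
  also have "(\<Prod>y\<in>UNIV-{0}. x * y) = (\<Prod>y\<in>UNIV-{0}. y)"
    by (rule prod.reindex_bij_witness[of _ "\<lambda>y. y / x" "\<lambda>y. x * y"]) (use False in auto)
  finally show ?thesis
    by simp
qed auto

lemma two_le_card: "2 \<le> CARD('q::{finite,field})"
proof -
  have "card {0, 1 :: 'q} \<le> CARD('q)" by (rule card_mono) auto
  then show ?thesis by simp
qed

text \<open>The middle terms of \<open>(x + 1)^q\<close> form a polynomial of degree below
  \<open>q\<close> that vanishes at all \<open>q\<close> elements of the field, by
  \<open>x^q = x\<close>; so its coefficients are zero. No expression of \<open>q\<close> as a power
  of the characteristic enters.\<close>

lemma of_nat_card_choose_eq_0:
  assumes "0 < i" "i < CARD('q::{finite,field})"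
  shows "of_nat (CARD('q) choose i) = (0 :: 'q)"
proof -
  let ?q = "CARD('q)"
  define f :: "'q poly" where "f = (\<Sum>i\<in>{0<..<?q}. monom (of_nat (?q choose i)) i)"
  have "poly f x = 0" for x :: 'q
  proof -
    have "(x + 1) ^ ?q = (\<Sum>k\<le>?q. of_nat (?q choose k) * x ^ k)"
      by (simp add: binomial_ring)
    also have "{..?q} = insert 0 (insert ?q {0<..<?q})" by auto
    also have "(\<Sum>k\<in>insert 0 (insert ?q {0<..<?q}). of_nat (?q choose k) * x ^ k) = 1 + (x ^ ?q + poly f x)"
      by (simp add: f_def poly_sum poly_monom)
    finally show ?thesis by (simp add: power_card_eq_same)
  qed
  moreover have "degree f < ?q"
    unfolding f_def by (intro degree_sum_less) (auto intro: le_less_trans[OF degree_monom_le])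
  ultimately have "f = 0"
    using poly_roots_degree[of f] by (cases "f = 0") (auto simp: not_le)
  moreover have "coeff f i = of_nat (?q choose i)"
    using assms by (simp add: f_def coeff_sum)
  ultimately show ?thesis by simp
qed

text \<open>Whether an integer vanishes in a ring depends on the characteristic alone, so the
  vanishing of the middle binomials carries over from the finite field.\<close>

lemma frob_add:
  fixes x y :: "'b::comm_ring_1"
  assumes "CHAR('b) = CHAR('q::{finite,field})"
  shows "(x + y) ^ CARD('q) = x ^ CARD('q) + y ^ CARD('q)"
proof -
  let ?q = "CARD('q)"
  have "of_nat (?q choose i) = (0::'b)" if "i \<in> {0<..<?q}" for i
    using of_nat_card_choose_eq_0[where ?'q = 'q] that by (simp add: of_nat_eq_0_iff_char_dvd assms)
  then have "(\<Sum>k\<in>{0<..<?q}. of_nat (?q choose k) * x ^ k * y ^ (?q - k)) = 0"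
    by (intro sum.neutral) auto
  moreover have "{..?q} = insert 0 (insert ?q {0<..<?q})" by auto
  ultimately show ?thesis
    by (simp add: binomial_ring)
qed

lemma CHAR_fract [simp]: "CHAR('a::idom fract) = CHAR('a)"
proof (rule CHAR_eqI)
  have "of_nat n = to_fract (of_nat n :: 'a)" for n
    by (induction n) simp_all
  then have "of_nat n = (0 :: 'a fract) \<longleftrightarrow> CHAR('a) dvd n" for n
    by (simp add: of_nat_eq_0_iff_char_dvd)
  then show "of_nat CHAR('a) = (0 :: 'a fract)" "\<And>x. of_nat x = (0 :: 'a fract) \<Longrightarrow> CHAR('a) dvd x"
    by simp_all
qed

lemma frob_add_poly: "(x + y :: 'q::{finite,field} poly) ^ CARD('q) = x ^ CARD('q) + y ^ CARD('q)"
  and frob_add_ratfun: "(x' + y' :: 'q ratfun) ^ CARD('q) = x' ^ CARD('q) + y' ^ CARD('q)"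
  and frob_add_closure: "(z + w :: 'q closure) ^ CARD('q) = z ^ CARD('q) + w ^ CARD('q)"
  and frob_add_alg_closure: "(z' + w' :: 'q alg_closure) ^ CARD('q) = z' ^ CARD('q) + w' ^ CARD('q)"
  by (rule frob_add; simp)+




lemma frob_add_iter:
  fixes x y :: "'a::comm_ring_1"
  assumes "\<And>x y :: 'a. (x + y) ^ q = x ^ q + y ^ q"
  shows "(x + y) ^ (q ^ i) = x ^ (q ^ i) + y ^ (q ^ i)"
  by (induction i) (simp_all add: power_mult mult.commute[of q] assms)

text \<open>The twisted product is additive in both arguments, so associativity and the composition
  law need only be checked on monomials.\<close>

lemma poly_add_monom_induct [case_names monom add]:
  assumes "\<And>c n. P (monom c n)" and "\<And>f g. P f \<Longrightarrow> P g \<Longrightarrow> P (f + g)"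
  shows "P (f :: 'a::comm_monoid_add poly)"
proof -
  have "P (\<Sum>i\<in>A. monom (coeff f i) i)" if "finite A" for A
    using that
  proof (induction A)
    case empty
    show ?case using assms(1)[of 0 0] by simp
  qed (auto intro: assms)
  from this[of "{..degree f}"] show ?thesis by (simp add: poly_as_sum_of_monoms)
qed

section \<open>The twisted product as a double sum over coefficients\<close>

lemma sum_lessThan_degree_mono:
  fixes F :: "nat \<Rightarrow> 'a::zero \<Rightarrow> 'b::comm_monoid_add"
  assumes "degree f \<le> N" and "\<And>i. F i 0 = 0"
  shows "(\<Sum>i\<le>degree f. F i (coeff f i)) = (\<Sum>i\<le>N. F i (coeff f i))"
  by (rule sum.mono_neutral_left) (use assms in \<open>auto simp: not_le coeff_eq_0\<close>)

lemma sum_sum_delta: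
  fixes c :: "'a::comm_monoid_add"
  shows "(\<Sum>i\<le>M. \<Sum>j\<le>N. if i = a then if j = b then c else 0 else 0) =
    (if a \<le> (M::nat) \<and> b \<le> (N::nat) then c else 0)"
proof -
  have "(\<Sum>j\<le>N. if i = a then if j = b then c else 0 else 0) =
      (if i = a then if b \<le> N then c else 0 else 0)" for i :: nat
    by simp
  then show ?thesis by simp
qed

context
  fixes q :: nat
  assumes q: "q > 0"
begin

text \<open>The degree may drop in a sum, so distributivity is proved after all sums have been
  extended to a common bound.\<close>

lemma tw_mult_bounds:
  fixes f g :: "'a::comm_ring_1 poly"
  assumes "degree f \<le> M" "degree g \<le> N"
  shows "tw_mult q f g = (\<Sum>i\<le>M. \<Sum>j\<le>N. monom (coeff f i * coeff g j ^ (q ^ i)) (i + j))"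
proof -
  have "tw_mult q f g = (\<Sum>i\<le>degree f. \<Sum>j\<le>N. monom (coeff f i * coeff g j ^ (q ^ i)) (i + j))"
    unfolding tw_mult_def
    by (intro sum.cong refl sum_lessThan_degree_mono[where F = "\<lambda>j c. monom (coeff f _ * c ^ (q ^ _)) (_ + j)"])
      (use assms q in \<open>auto simp: power_0_left\<close>)
  also have "\<dots> = (\<Sum>i\<le>M. \<Sum>j\<le>N. monom (coeff f i * coeff g j ^ (q ^ i)) (i + j))"
    by (rule sum_lessThan_degree_mono[where F = "\<lambda>i c. \<Sum>j\<le>N. monom (c * coeff g j ^ (q ^ i)) (i + j)"])
      (use assms in auto)
  finally show ?thesis .
qed

lemma tw_mult_0_left [simp]: "tw_mult q 0 g = 0"
  and tw_mult_0_right [simp]: "tw_mult q f 0 = 0"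
  using q by (simp_all add: tw_mult_def power_0_left)

lemma tw_mult_add_left: "tw_mult q (f + g) h = tw_mult q f h + tw_mult q g h"
proof -
  define M where "M = max (degree f) (degree g)"
  have "degree f \<le> M" "degree g \<le> M" "degree (f + g) \<le> M"
    by (auto simp: M_def degree_add_le)
  note * = tw_mult_bounds[OF this(1) order_refl] tw_mult_bounds[OF this(2) order_refl]
    tw_mult_bounds[OF this(3) order_refl]
  show ?thesis
    by (simp add: * sum.distrib[symmetric] add_monom[symmetric] algebra_simps del: sum.distrib)
qed

lemma tw_mult_monom_monom [simp]:
  "tw_mult q (monom c i) (monom d j) = monom (c * d ^ (q ^ i)) (i + j)"
proof -
  have "tw_mult q (monom c i) (monom d j) =
      (\<Sum>i'\<le>i. \<Sum>j'\<le>j. monom (coeff (monom c i) i' * coeff (monom d j) j' ^ (q ^ i')) (i' + j'))"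
    by (rule tw_mult_bounds) (auto simp: degree_monom_le)
  also have "\<dots> = (\<Sum>i'\<le>i. \<Sum>j'\<le>j. if i' = i then if j' = j then monom (c * d ^ (q ^ i)) (i + j) else 0 else 0)"
    using q by (intro sum.cong refl) (auto simp: power_0_left)
  also have "\<dots> = monom (c * d ^ (q ^ i)) (i + j)"
    by (simp add: sum_sum_delta)
  finally show ?thesis .
qed

lemma degree_tw_mult_le: "degree (tw_mult q f g) \<le> degree f + degree g"
  unfolding tw_mult_def
  by (intro degree_sum_le finite_atMost order_trans[OF degree_monom_le]) (auto intro: add_mono)

text \<open>Only the index pair \<open>(M, N)\<close> reaches the top exponent. Bounds instead of
  degrees allow its use before the top coefficients are known to be nonzero.\<close>

lemma coeff_tw_mult_degree_sum:
  assumes "degree f \<le> M" "degree g \<le> N"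
  shows "coeff (tw_mult q f g) (M + N) = coeff f M * coeff g N ^ (q ^ M)"
proof -
  have "coeff (tw_mult q f g) (M + N) =
      (\<Sum>i\<le>M. \<Sum>j\<le>N. if i + j = M + N then coeff f i * coeff g j ^ (q ^ i) else 0)"
    by (simp add: tw_mult_bounds[OF assms] coeff_sum)
  also have "\<dots> = (\<Sum>i\<le>M. \<Sum>j\<le>N. if i = M then if j = N then coeff f M * coeff g N ^ (q ^ M) else 0 else 0)"
    by (intro sum.cong refl) auto
  also have "\<dots> = coeff f M * coeff g N ^ (q ^ M)"
    by (simp add: sum_sum_delta)
  finally show ?thesis .
qed

lemma coeff_0_tw_mult: "coeff (tw_mult q f g) 0 = coeff f 0 * coeff g 0"
proof -
  have "coeff (tw_mult q f g) 0 =
      (\<Sum>i\<le>degree f. \<Sum>j\<le>degree g. if i + j = 0 then coeff f i * coeff g j ^ (q ^ i) else 0)"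
    by (simp add: tw_mult_def coeff_sum)
  also have "\<dots> = (\<Sum>i\<le>degree f. \<Sum>j\<le>degree g. if i = 0 then if j = 0 then coeff f 0 * coeff g 0 else 0 else 0)"
    by (intro sum.cong refl) auto
  also have "\<dots> = coeff f 0 * coeff g 0"
    by (simp add: sum_sum_delta)
  finally show ?thesis .
qed

text \<open>It keeps twisted products over a subring of coefficients: the p-integral elements of
  \<open>F\<close>, or the residue field inside its algebraic closure.\<close>

lemma tw_mult_closed:
  fixes S :: "'a::comm_ring_1 set"
  assumes "0 \<in> S" "1 \<in> S" "\<And>x y. x \<in> S \<Longrightarrow> y \<in> S \<Longrightarrow> x + y \<in> S"
    and "\<And>x y. x \<in> S \<Longrightarrow> y \<in> S \<Longrightarrow> x * y \<in> S"
    and "\<And>i. coeff f i \<in> S" "\<And>i. coeff g i \<in> S"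
  shows "coeff (tw_mult q f g) n \<in> S"
proof -
  have pow: "x ^ k \<in> S" if "x \<in> S" for x k
    using that by (induction k) (auto intro: assms)
  have sm: "sum h A \<in> S" if "\<And>x. x \<in> A \<Longrightarrow> h x \<in> S" for h :: "nat \<Rightarrow> 'a" and A
    using that by (induction A rule: infinite_finite_induct) (auto intro: assms)
  show ?thesis
    unfolding tw_mult_def coeff_sum coeff_monom
    by (intro sm) (auto intro!: assms pow)
qed

end

context
  fixes q :: nat
  assumes q: "q > 0" and fr: "\<And>x y :: 'a::comm_ring_1. (x + y) ^ q = x ^ q + y ^ q"
begin

lemma tw_mult_add_right: "tw_mult q f (g + h) = tw_mult q f g + tw_mult q f (h :: 'a poly)"
proof -
  define M where "M = max (degree g) (degree h)"
  have "degree g \<le> M" "degree h \<le> M" "degree (g + h) \<le> M"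
    by (auto simp: M_def degree_add_le)
  note * = tw_mult_bounds[OF q order_refl this(1)] tw_mult_bounds[OF q order_refl this(2)]
    tw_mult_bounds[OF q order_refl this(3)]
  show ?thesis
    by (simp add: * sum.distrib[symmetric] add_monom[symmetric] algebra_simps frob_add_iter[OF fr] del: sum.distrib)
qed

text \<open>On monomials both sides have the coefficient
  \<open>c * d^(q^i) * e^(q^(i+j))\<close>.\<close>

lemma tw_mult_assoc: "tw_mult q (tw_mult q f g) (h :: 'a poly) = tw_mult q f (tw_mult q g h)"
proof (induction f rule: poly_add_monom_induct)
  case (monom c i)
  show ?case
  proof (induction g rule: poly_add_monom_induct)
    case (monom d j)
    show ?case
    proof (induction h rule: poly_add_monom_induct)
      case (monom e k)
      show ?case
        by (simp add: tw_mult_monom_monom[OF q] power_mult_distrib mult.assoc add.assoc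
            flip: power_mult power_add) (simp add: mult.commute power_add)
    qed (simp add: tw_mult_add_right)
  qed (simp add: tw_mult_add_right tw_mult_add_left[OF q])
qed (simp add: tw_mult_add_left[OF q])

end

lemma tw_mult_const_left:
  fixes f :: "'a::comm_ring_1 poly"
  assumes "q > 0"
  shows "tw_mult q [:c:] f = Polynomial.smult c f"
proof -
  have "tw_mult q [:c:] f = (\<Sum>j\<le>degree f. Polynomial.smult c (monom (coeff f j) j))"
    by (simp add: tw_mult_def Polynomial.smult_monom)
  also have "\<dots> = Polynomial.smult c f"
    by (simp add: smult_sum2[symmetric] poly_as_sum_of_monoms)
  finally show ?thesis .
qed

lemma tw_mult_1_left [simp]: "q > 0 \<Longrightarrow> tw_mult q 1 f = f"
  using tw_mult_const_left[of q 1 f] by (simp add: one_pCons)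

lemma tw_mult_1_right [simp]: "q > 0 \<Longrightarrow> tw_mult q f 1 = f"
  by (simp add: tw_mult_def poly_as_sum_of_monoms)

lemma coeff_tw_mult_const_right:
  assumes "q > 0"
  shows "coeff (tw_mult q f [:c:]) i = coeff f i * c ^ (q ^ i)"
  by (simp add: tw_mult_def coeff_sum coeff_eq_0 not_le)

section \<open>Additive polynomials\<close>

text \<open>The coefficient map \<open>h\<close> is a parameter because the same additive polynomial
  is needed over \<open>A\<close>, over \<open>F\<close> and over the closure.\<close>

definition add_poly :: "('a::zero \<Rightarrow> 'b::comm_ring_1) \<Rightarrow> nat \<Rightarrow> 'a poly \<Rightarrow> 'b poly" where
  "add_poly h q f = (\<Sum>i\<le>degree f. monom (h (coeff f i)) (q ^ i))"

definition add_eval :: "('a::zero \<Rightarrow> 'b::comm_ring_1) \<Rightarrow> nat \<Rightarrow> 'a poly \<Rightarrow> 'b \<Rightarrow> 'b" where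
  "add_eval h q f x = (\<Sum>i\<le>degree f. h (coeff f i) * x ^ (q ^ i))"

lemma poly_add_poly: "poly (add_poly h q f) x = add_eval h q f x"
  by (simp add: add_poly_def add_eval_def poly_sum poly_monom)

lemma tw_eval_add_eval: "tw_eval f x = add_eval to_ac CARD('q) (f :: 'q::{finite,field} ratfun poly) x"
  by (simp add: tw_eval_def add_eval_def)

lemma coeff_add_poly:
  assumes "2 \<le> q" "h 0 = 0"
  shows "coeff (add_poly h q f) (q ^ i) = h (coeff f i)"
  using assms by (simp add: add_poly_def coeff_sum coeff_eq_0 not_le)

lemma degree_add_poly_le: "q > 0 \<Longrightarrow> degree (add_poly h q f) \<le> q ^ degree f"
  unfolding add_poly_def
  by (intro degree_sum_le finite_atMost order_trans[OF degree_monom_le]) (auto intro: power_increasing)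

text \<open>The exponents \<open>q^i\<close> with \<open>i > 0\<close> become zero as scalars. Such
  a polynomial is therefore separable as soon as its constant twisted coefficient is
  nonzero.\<close>

lemma pderiv_add_poly:
  assumes "of_nat q = (0 :: 'b)"
  shows "pderiv (add_poly h q f :: 'b::idom poly) = [:h (coeff f 0):]"
proof -
  have "pderiv (add_poly h q f) = (\<Sum>i\<le>degree f. if i = 0 then [:h (coeff f 0):] else 0)"
    unfolding add_poly_def pderiv_sum
    by (intro sum.cong refl) (use assms in \<open>auto simp: pderiv_monom monom_0 power_0_left\<close>)
  then show ?thesis by simp
qed

context
  fixes h :: "'a::comm_ring_1 \<Rightarrow> 'b::comm_ring_1" and q :: nat
  assumes q: "q > 0" and h0: "h 0 = 0"
begin

lemma add_eval_bound:
  assumes "degree f \<le> N"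
  shows "add_eval h q f x = (\<Sum>i\<le>N. h (coeff f i) * x ^ (q ^ i))"
  unfolding add_eval_def
  by (rule sum_lessThan_degree_mono[where F = "\<lambda>i c. h c * x ^ (q ^ i)"]) (use assms h0 in auto)

lemma add_eval_monom [simp]: "add_eval h q (monom c n) x = h c * x ^ (q ^ n)"
proof -
  have "add_eval h q (monom c n) x = (\<Sum>i\<le>n. if i = n then h c * x ^ (q ^ n) else 0)"
    unfolding add_eval_bound[OF degree_monom_le] by (intro sum.cong) (auto simp: h0)
  then show ?thesis by simp
qed

lemma add_eval_const [simp]: "add_eval h q [:c:] x = h c * x"
  using add_eval_monom[of c 0 x] by (simp add: monom_0)

lemma add_eval_at_0 [simp]: "add_eval h q f 0 = 0"
  using q by (simp add: add_eval_def power_0_left)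

context
  assumes hadd: "\<And>x y. h (x + y) = h x + h y"
begin

lemma add_eval_add: "add_eval h q (f + g) x = add_eval h q f x + add_eval h q g x"
proof -
  define N where "N = max (degree f) (degree g)"
  have "degree f \<le> N" "degree g \<le> N" "degree (f + g) \<le> N"
    by (auto simp: N_def degree_add_le)
  then show ?thesis
    by (simp add: add_eval_bound hadd algebra_simps sum.distrib)
qed

lemma add_eval_diff: "add_eval h q (f - g) x = add_eval h q f x - add_eval h q g x"
  using add_eval_add[of "f - g" g x] by simp

end

context
  assumes fr: "\<And>x y :: 'b. (x + y) ^ q = x ^ q + y ^ q"
begin

lemma add_eval_arg_add: "add_eval h q f (x + y) = add_eval h q f x + add_eval h q f y"
  by (simp add: add_eval_def frob_add_iter[OF fr] algebra_simps sum.distrib)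

text \<open>The rule \<open>\<tau> c = c^q \<tau>\<close> is exactly composition of additive
  polynomials; this is what makes the closure an \<open>A\<close>-module.\<close>

lemma add_eval_tw_mult:
  assumes hadd: "\<And>x y. h (x + y) = h x + h y" and hmult: "\<And>x y. h (x * y) = h x * h y"
    and h1: "h 1 = 1" and fr': "\<And>x y :: 'a. (x + y) ^ q = x ^ q + y ^ q"
  shows "add_eval h q (tw_mult q f g) x = add_eval h q f (add_eval h q g x)"
proof (induction f rule: poly_add_monom_induct)
  case (monom c i)
  have hpow: "h (z ^ k) = h z ^ k" for z k
    by (induction k) (simp_all add: h1 hmult)
  show ?case
  proof (induction g rule: poly_add_monom_induct)
    case (monom d j)
    show ?case
      by (simp add: tw_mult_monom_monom[OF q] hmult hpow power_mult_distrib power_add mult.assoc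
          flip: power_mult) (simp add: mult.commute)
  qed (simp add: tw_mult_add_right[OF q fr'] add_eval_add[OF hadd] add_eval_arg_add)
qed (simp add: tw_mult_add_left[OF q] add_eval_add[OF hadd])

end

end

section \<open>Divisibility of polynomials over a field\<close>

lemma poly_bezout:
  fixes a b :: "'a::field poly"
  shows "\<exists>s t. (s * a + t * b) dvd a \<and> (s * a + t * b) dvd b"
\<comment> \<open>The measure puts \<open>b = 0\<close> strictly below the nonzero constants, which
  also have degree 0.\<close>
proof (induction "if b = 0 then 0 else Suc (degree b)" arbitrary: a b rule: less_induct)
  case less
  show ?case
  proof (cases "b = 0")
    case True
    then show ?thesis by (intro exI[of _ 1] exI[of _ 0]) auto
  next
    case False
    then have "a mod b = 0 \<or> degree (a mod b) < degree b"
      using degree_mod_less by blast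
    then have "(if a mod b = 0 then 0 else Suc (degree (a mod b))) < (if b = 0 then 0 else Suc (degree b))"
      using False by auto
    from less[OF this, of b] obtain s t
      where st: "(s * b + t * (a mod b)) dvd b" "(s * b + t * (a mod b)) dvd (a mod b)"
      by blast
    have eq: "s * b + t * (a mod b) = t * a + (s - t * (a div b)) * b"
      by (simp add: algebra_simps minus_div_mult_eq_mod[symmetric])
    have "(s * b + t * (a mod b)) dvd (a div b * b + a mod b)"
      using st by (intro dvd_add dvd_mult)
    then have "(s * b + t * (a mod b)) dvd a" by simp
    with st(1) show ?thesis unfolding eq by blast
  qed
qed

lemma coprime_poly_bezout:
  fixes a b :: "'a::field poly"
  assumes "coprime a b"
  shows "\<exists>s t. s * a + t * b = 1"
proof -
  obtain s t where "(s * a + t * b) dvd a" "(s * a + t * b) dvd b"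
    using poly_bezout by blast
  then have "(s * a + t * b) dvd 1"
    using assms by (rule coprime_common_divisor[rotated])
  then obtain k where "1 = (s * a + t * b) * k" by (elim dvdE)
  then have "(k * s) * a + (k * t) * b = 1" by (simp add: algebra_simps)
  then show ?thesis by blast
qed

lemma irreducible_poly_coprime:
  fixes l a :: "'a::field poly"
  assumes "irreducible l" "\<not> l dvd a"
  shows "coprime l a"
proof (rule coprimeI)
  fix d assume d: "d dvd l" "d dvd a"
  show "is_unit d"
    using irreducibleD'[OF assms(1) d(1)] d(2) assms(2) dvd_trans by blast
qed

lemma coprime_poly_dvd_mult:
  fixes a b c :: "'a::field poly"
  assumes "coprime a b" "a dvd b * c"
  shows "a dvd c"
proof -
  obtain s t where "s * a + t * b = 1" using coprime_poly_bezout[OF assms(1)] by blast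
  then have "c = (s * a + t * b) * c" by simp
  also have "\<dots> = a * (s * c) + t * (b * c)" by (simp add: algebra_simps)
  finally have c: "c = a * (s * c) + t * (b * c)" .
  have "a dvd a * (s * c) + t * (b * c)" by (rule dvd_add[OF dvd_triv_left dvd_mult[OF assms(2)]])
  then show ?thesis by (rule subst[OF c[symmetric], where P = "\<lambda>z. a dvd z"])
qed

lemma coprime_poly_mult_dvd:
  fixes a b c :: "'a::field poly"
  assumes "coprime a b" "a dvd c" "b dvd c"
  shows "a * b dvd c"
proof -
  obtain k where "c = b * k" using assms(3) by (elim dvdE)
  with assms show ?thesis
    using coprime_poly_dvd_mult[of a b k] by (auto simp: mult.commute[of a] intro: mult_dvd_mono)
qed

lemma irreducible_poly_dvd_mult:
  fixes l a b :: "'a::field poly"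
  assumes "irreducible l" "l dvd a * b"
  shows "l dvd a \<or> l dvd b"
  using irreducible_poly_coprime[OF assms(1)] coprime_poly_dvd_mult assms(2) by blast

lemma irreducible_poly_dvd_power:
  fixes l a :: "'a::field poly"
  assumes "irreducible l" "l dvd a ^ n"
  shows "l dvd a"
  using assms(2)
proof (induction n)
  case 0
  then show ?case using assms(1) by (auto simp: Factorial_Ring.irreducible_def)
next
  case (Suc n)
  then show ?case using irreducible_poly_dvd_mult[OF assms(1)] by auto
qed

lemma exists_monic_irreducible_dvd:
  fixes m :: "'a::field poly"
  assumes "m \<noteq> 0" "\<not> is_unit m"
  shows "\<exists>l. lead_coeff l = 1 \<and> irreducible l \<and> l dvd m"
proof -
  have *: "\<exists>l. irreducible l \<and> l dvd m"
    using assms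
  proof (induction "degree m" arbitrary: m rule: less_induct)
    case less
    show ?case
    proof (cases "irreducible m")
      case False
      then obtain x y where xy: "m = x * y" "\<not> is_unit x" "\<not> is_unit y"
        using less.prems by (auto simp: Factorial_Ring.irreducible_def)
      then have "x \<noteq> 0" "y \<noteq> 0" using less.prems by auto
      moreover have "degree y \<noteq> 0" using xy(3) \<open>y \<noteq> 0\<close> by (simp add: is_unit_iff_degree)
      ultimately have "degree x < degree m" by (simp add: xy(1) degree_mult_eq)
      then obtain l where "irreducible l" "l dvd x"
        using less.hyps[of x] \<open>x \<noteq> 0\<close> xy(2) by blast
      then show ?thesis using xy(1) by (intro exI[of _ l]) auto
    qed auto
  qed
  then obtain l where l: "irreducible l" "l dvd m" by blast
  then have "l \<noteq> 0" by auto
  define l' where "l' = Polynomial.smult (inverse (lead_coeff l)) l"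
  have ass: "l' dvd l" "l dvd l'"
    using \<open>l \<noteq> 0\<close> by (auto simp: l'_def smult_dvd_iff dvd_smult)
  have "irreducible l'"
    using l(1) ass unfolding irreducible_altdef
    by (metis dvd_trans dvd_0_left)
  then show ?thesis
    using l(2) ass \<open>l \<noteq> 0\<close> dvd_trans by (intro exI[of _ l']) (auto simp: l'_def)
qed

lemma exists_irreducible_power_factor:
  fixes l m :: "'a::field poly"
  assumes "m \<noteq> 0" "irreducible l"
  shows "\<exists>k m'. m = l ^ k * m' \<and> \<not> l dvd m'"
  using assms(1)
proof (induction "degree m" arbitrary: m rule: less_induct)
  case less
  show ?case
  proof (cases "l dvd m")
    case False
    then show ?thesis by (intro exI[of _ 0] exI[of _ m]) auto
  next
    case True
    then obtain m1 where m1: "m = l * m1" by (elim dvdE)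
    have "degree l \<noteq> 0" using assms(2) by (metis Factorial_Ring.irreducible_def is_unit_iff_degree)
    then have "degree m1 < degree m" using less.prems m1 by (auto simp: degree_mult_eq)
    then obtain k m' where "m1 = l ^ k * m'" "\<not> l dvd m'"
      using less.hyps[of m1] less.prems m1 by auto
    then show ?thesis using m1 by (intro exI[of _ "Suc k"] exI[of _ m']) auto
  qed
qed

lemma coprime_polyI:
  fixes a m :: "'a::field poly"
  assumes "m \<noteq> 0" "\<And>l. irreducible l \<Longrightarrow> l dvd m \<Longrightarrow> \<not> l dvd a"
  shows "coprime a m"
proof (rule coprimeI)
  fix d assume d: "d dvd a" "d dvd m"
  show "is_unit d"
  proof (rule ccontr)
    assume "\<not> is_unit d"
    then obtain l where "irreducible l" "l dvd d"
      using exists_monic_irreducible_dvd[of d] d assms(1) by (metis dvd_0_left)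
    then show False using assms(2)[of l] d dvd_trans by blast
  qed
qed

text \<open>Splitting off the full power of one prime at a time leaves coprime factors, as the
  Chinese remainder arguments for torsion and for quadratic forms require.\<close>

lemma poly_coprime_induct [consumes 1, case_names unit step]:
  fixes m :: "'a::field poly"
  assumes "m \<noteq> 0"
    and unit: "\<And>m. is_unit m \<Longrightarrow> P m"
    and step: "\<And>l k m. lead_coeff l = 1 \<Longrightarrow> irreducible l \<Longrightarrow> k > 0 \<Longrightarrow> \<not> l dvd m \<Longrightarrow> m \<noteq> 0 \<Longrightarrow> P m \<Longrightarrow>
      coprime (l ^ k) m \<Longrightarrow> P (l ^ k * m)"
  shows "P m"
  using assms(1)
proof (induction "degree m" arbitrary: m rule: less_induct)
  case less
  show ?case
  proof (cases "is_unit m")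
    case False
    then obtain l where l: "lead_coeff l = 1" "irreducible l" "l dvd m"
      using exists_monic_irreducible_dvd less.prems by blast
    obtain k m' where m': "m = l ^ k * m'" "\<not> l dvd m'"
      using exists_irreducible_power_factor less.prems l(2) by blast
    have k: "k > 0" using l(3) m' by (cases k) auto
    have "m' \<noteq> 0" "l \<noteq> 0" using less.prems m' l(2) by auto
    moreover have "degree l \<noteq> 0" using l(2) by (metis Factorial_Ring.irreducible_def is_unit_iff_degree)
    ultimately have "degree m' < degree m"
      using k by (simp add: m'(1) degree_mult_eq degree_power_eq)
    then have "P m'" using less.hyps \<open>m' \<noteq> 0\<close> by blast
    moreover have "coprime (l ^ k) m'"
    proof (rule coprime_polyI[OF \<open>m' \<noteq> 0\<close>])
      fix l' assume l': "irreducible l'" "l' dvd m'"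
      show "\<not> l' dvd l ^ k"
      proof
        assume "l' dvd l ^ k"
        then have "l' dvd l" using irreducible_poly_dvd_power l'(1) by blast
        moreover have "\<not> is_unit l'" using l'(1) unfolding Factorial_Ring.irreducible_def by blast
        ultimately have "l dvd l'" using irreducibleD'[OF l(2)] by blast
        then show False using l'(2) m'(2) dvd_trans by blast
      qed
    qed
    ultimately show ?thesis using step l m' k \<open>m' \<noteq> 0\<close> by metis
  qed (rule unit)
qed

text \<open>The form met later is the determinant of \<open>x\<close> and \<open>\<Theta> x\<close>
  in a basis, so a value prime to \<open>m\<close> gives a cyclic vector. Modulo one prime, a form
  with a nonzero coefficient takes a nonzero value at \<open>(1,0)\<close>, \<open>(0,1)\<close> or
  \<open>(1,1)\<close>; the local choices are glued by the Chinese remainder theorem.\<close>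

lemma exists_coprime_quadratic_form_value:
  fixes A B C m :: "'a::field poly"
  assumes "m \<noteq> 0"
    and "\<And>l. irreducible l \<Longrightarrow> l dvd m \<Longrightarrow> \<not> (l dvd A \<and> l dvd B \<and> l dvd C)"
  shows "\<exists>x y. coprime (A * x\<^sup>2 + B * x * y + C * y\<^sup>2) m"
  using assms
proof (induction m rule: poly_coprime_induct)
  case (unit m)
  then show ?case by (auto simp: is_unit_right_imp_coprime)
next
  case (step l k m)
  obtain x y where xy: "coprime (A * x\<^sup>2 + B * x * y + C * y\<^sup>2) m"
    using step by (meson dvd_mult)
  have "\<not> (l dvd A \<and> l dvd B \<and> l dvd C)"
    using step by (meson dvd_mult2 dvd_power)
  then have "\<exists>x0 y0. \<not> l dvd A * x0\<^sup>2 + B * x0 * y0 + C * y0\<^sup>2"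
  proof -
    consider "\<not> l dvd A" | "\<not> l dvd C" | "l dvd A" "l dvd C" "\<not> l dvd B"
      using \<open>\<not> (l dvd A \<and> l dvd B \<and> l dvd C)\<close> by blast
    then show ?thesis
    proof cases
      case 1
      then show ?thesis by (intro exI[of _ 1] exI[of _ 0]) auto
    next
      case 2
      then show ?thesis by (intro exI[of _ 0] exI[of _ 1]) auto
    next
      case 3
      then show ?thesis
        by (intro exI[of _ 1] exI[of _ 1]) (simp add: dvd_add_left_iff dvd_add_right_iff)
    qed
  qed
  then obtain x0 y0 where xy0: "\<not> l dvd A * x0\<^sup>2 + B * x0 * y0 + C * y0\<^sup>2" by blast
  obtain s t where st: "s * l ^ k + t * m = 1"
    using coprime_poly_bezout[OF \<open>coprime (l ^ k) m\<close>] by blast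
  \<comment> \<open>As \<open>s l^k + t m = 1\<close>, this point is congruent to
    \<open>(x, y)\<close> modulo \<open>m\<close> and to \<open>(x0, y0)\<close> modulo
    \<open>l^k\<close>.\<close>
  define x1 y1 where "x1 = x + m * (t * (x0 - x))" and "y1 = y + m * (t * (y0 - y))"
  let ?f = "\<lambda>x y. A * x\<^sup>2 + B * x * y + C * y\<^sup>2"
  have diff: "d dvd ?f x1 y1 - ?f x2 y2" if "d dvd x1 - x2" "d dvd y1 - y2" for d x1 x2 y1 y2 :: "'a poly"
  proof -
    have "?f x1 y1 - ?f x2 y2 = (x1 - x2) * (A * (x1 + x2) + B * y1) + (y1 - y2) * (C * (y1 + y2) + B * x2)"
      by (simp add: power2_eq_square algebra_simps)
    then show ?thesis using that by simp
  qed
  have "x1 - x0 = l ^ k * (s * (x - x0))"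
  proof -
    have "x1 - x0 = (x - x0) * (1 - t * m)" by (simp add: x1_def algebra_simps)
    also have "1 - t * m = s * l ^ k" using st by (simp add: algebra_simps)
    finally show ?thesis by (simp add: mult_ac)
  qed
  moreover have "y1 - y0 = l ^ k * (s * (y - y0))"
  proof -
    have "y1 - y0 = (y - y0) * (1 - t * m)" by (simp add: y1_def algebra_simps)
    also have "1 - t * m = s * l ^ k" using st by (simp add: algebra_simps)
    finally show ?thesis by (simp add: mult_ac)
  qed
  ultimately have "l dvd x1 - x0" "l dvd y1 - y0"
    using step.hyps(3) by (auto simp: dvd_mult2 dvd_power)
  then have l: "\<not> l dvd ?f x1 y1"
    using xy0 diff[of l x1 x0 y1 y0] by (metis dvd_diff_right_iff)
  have mx: "m dvd x1 - x" "m dvd y1 - y" by (simp_all add: x1_def y1_def)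
  have "coprime (?f x1 y1) (l ^ k * m)"
  proof (rule coprime_polyI)
    show "l ^ k * m \<noteq> 0" using step.hyps by auto
    fix l' assume l': "irreducible l'" "l' dvd l ^ k * m"
    show "\<not> l' dvd ?f x1 y1"
    proof (cases "l' dvd m")
      case True
      have "l' dvd ?f x1 y1 - ?f x y" using diff mx True dvd_trans by meson
      moreover have "\<not> l' dvd ?f x y"
        using xy True l'(1) coprime_common_divisor Factorial_Ring.irreducible_def by blast
      ultimately show ?thesis by (metis dvd_diff_right_iff)
    next
      case False
      then have "l' dvd l" using irreducible_poly_dvd_mult[OF l'] irreducible_poly_dvd_power[OF l'(1)] by blast
      then have "l dvd l'"
        using irreducibleD'[OF step.hyps(2)] l'(1) unfolding Factorial_Ring.irreducible_def by blast
      then show ?thesis using l dvd_trans by blast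
    qed
  qed
  then show ?case by blast
qed

section \<open>Torsion of modules over \<open>A\<close>\<close>

lemma card_polys_Poly:
  "card (Poly ` {xs :: 'q::{finite,zero} list. length xs = n}) = CARD('q) ^ n"
proof -
  have "inj_on Poly {xs :: 'q list. length xs = n}"
  proof (rule inj_onI)
    fix xs ys :: "'q list"
    assume *: "xs \<in> {xs. length xs = n}" "ys \<in> {xs. length xs = n}" "Poly xs = Poly ys"
    show "xs = ys"
    proof (rule nth_equalityI)
      fix i assume "i < length xs"
      moreover have "nth_default 0 xs i = nth_default 0 ys i" using *(3) by (metis coeff_Poly_eq)
      ultimately show "xs ! i = ys ! i" using *(1,2) by (simp add: nth_default_def)
    qed (use * in simp)
  qed
  then have "card (Poly ` {xs :: 'q list. length xs = n}) = card {xs :: 'q list. length xs = n}"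
    by (rule card_image)
  also have "\<dots> = CARD('q) ^ n"
    using card_lists_length_eq[of "UNIV :: 'q set" n] by simp
  finally show ?thesis .
qed

text \<open>Coefficient lists of length \<open>degree m\<close> represent the classes of
  \<open>A/mA\<close>: the difference of two of them has no coefficient from \<open>degree m\<close>
  on.\<close>

lemma Poly_dvd_diff_imp_eq:
  fixes m :: "'q::field poly"
  assumes "length xs = degree m" "length ys = degree m" "m dvd Poly xs - Poly ys"
  shows "Poly xs = Poly ys"
proof (rule ccontr)
  assume ne: "Poly xs \<noteq> Poly ys"
  have "coeff (Poly xs - Poly ys) i = 0" if "i \<ge> degree m" for i
    using that assms by (simp add: coeff_Poly nth_default_def)
  moreover have "degree m \<le> degree (Poly xs - Poly ys)"
    using assms(3) ne by (intro dvd_imp_degree_le) auto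
  ultimately have "lead_coeff (Poly xs - Poly ys) = 0" by blast
  then show False using ne by (simp only: leading_coeff_0_iff right_minus_eq)
qed

lemma ex1_unique: "\<exists>!x. P x \<Longrightarrow> P x \<Longrightarrow> P y \<Longrightarrow> x = y"
  by blast

text \<open>An abstract \<open>A\<close>-module, since \<open>\<psi>\<close> and its good model act
  on the same closure in two different ways.\<close>

locale poly_action =
  fixes act :: "'q::{finite,field} poly \<Rightarrow> 'k::ab_group_add \<Rightarrow> 'k"
  assumes act_add_left: "act (a + b) x = act a x + act b x"
    and act_add: "act a (x + y) = act a x + act a y"
    and act_mult: "act (a * b) x = act a (act b x)"
    and act_1 [simp]: "act 1 x = x"
begin

lemma act_0_left [simp]: "act 0 x = 0"
  using act_add_left[of 0 0 x] by simp

lemma act_0 [simp]: "act a 0 = 0"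
  using act_add[of a 0 0] by simp

lemma act_diff_left: "act (a - b) x = act a x - act b x"
  using act_add_left[of "a - b" b x] by (simp add: eq_diff_eq)

lemma act_diff: "act a (x - y) = act a x - act a y"
  using act_add[of a "x - y" y] by (simp add: eq_diff_eq)

lemma act_sum: "act a (\<Sum>i\<in>S. f i) = (\<Sum>i\<in>S. act a (f i))"
  by (induction S rule: infinite_finite_induct) (simp_all add: act_add)

lemma act_commute: "act a (act b x) = act b (act a x)"
  by (metis act_mult mult.commute)

lemma act_eq_0_if_dvd: "act m x = 0 \<Longrightarrow> m dvd c \<Longrightarrow> act c x = 0"
  by (metis act_0 act_mult dvdE mult.commute)

lemma act_cong_if_dvd: "act m x = 0 \<Longrightarrow> m dvd c - d \<Longrightarrow> act c x = act d x"
  using act_eq_0_if_dvd[of m x "c - d"] by (simp add: act_diff_left)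

lemma act_mod: "act m x = 0 \<Longrightarrow> act (c mod m) x = act c x"
  by (rule act_cong_if_dvd) (auto simp: mod_eq_dvd_iff[symmetric])

definition tors :: "'q poly \<Rightarrow> 'k set" where
  "tors m = {x. act m x = 0}"

lemma tors_zero [simp]: "0 \<in> tors m"
  and tors_add: "x \<in> tors m \<Longrightarrow> y \<in> tors m \<Longrightarrow> x + y \<in> tors m"
  and tors_diff: "x \<in> tors m \<Longrightarrow> y \<in> tors m \<Longrightarrow> x - y \<in> tors m"
  and tors_act: "x \<in> tors m \<Longrightarrow> act c x \<in> tors m"
  by (simp_all add: tors_def act_add act_diff act_commute[of m c])

lemma tors_dvd: "x \<in> tors m \<Longrightarrow> m dvd n \<Longrightarrow> x \<in> tors n"
  by (simp add: tors_def act_eq_0_if_dvd)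

lemma tors_act_cofactor:
  assumes "x \<in> tors (d1 * d2)"
  shows "act (t * d2) x \<in> tors d1"
proof -
  have "act (d1 * (t * d2)) x = act t (act (d1 * d2) x)"
    by (simp only: act_mult[symmetric] mult.left_commute)
  then show ?thesis using assms by (simp add: tors_def act_mult)
qed

definition tors_basis :: "nat \<Rightarrow> 'q poly \<Rightarrow> (nat \<Rightarrow> 'k) \<Rightarrow> bool" where
  "tors_basis r m w \<longleftrightarrow>
    (\<forall>i<r. w i \<in> tors m) \<and>
    (\<forall>x\<in>tors m. \<exists>c. x = (\<Sum>i<r. act (c i) (w i))) \<and>
    (\<forall>c. (\<Sum>i<r. act (c i) (w i)) = 0 \<longrightarrow> (\<forall>i<r. m dvd c i))"

lemma tors_basis_indep:
  "tors_basis r m w \<Longrightarrow> (\<Sum>i<r. act (c i) (w i)) = 0 \<Longrightarrow> i < r \<Longrightarrow> m dvd c i"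
  unfolding tors_basis_def by blast

lemma tors_basis_associated:
  assumes "tors_basis r m w" "m dvd n" "n dvd m"
  shows "tors_basis r n w"
proof -
  have "tors n = tors m" using assms(2,3) tors_dvd by blast
  then show ?thesis using assms dvd_trans unfolding tors_basis_def by metis
qed

lemma tors_basis_1: "tors_basis r 1 (\<lambda>_. 0)"
  by (auto simp: tors_basis_def tors_def)

text \<open>With \<open>s d1 + t d2 = 1\<close>, multiplication by \<open>t d2\<close> projects onto
  the \<open>d1\<close>-torsion and multiplication by \<open>s d1\<close> onto the
  \<open>d2\<close>-torsion, so coordinates are found separately and recombined.\<close>

lemma tors_basis_mult:
  assumes w1: "tors_basis r d1 w1" and w2: "tors_basis r d2 w2" and "coprime d1 d2"
  shows "tors_basis r (d1 * d2) (\<lambda>i. w1 i + w2 i)"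
  unfolding tors_basis_def
proof (intro conjI allI impI ballI)
  have k1: "act d1 (w1 i) = 0" and k2: "act d2 (w2 i) = 0" if "i < r" for i
    using that w1 w2 by (auto simp: tors_basis_def tors_def)
  show "w1 i + w2 i \<in> tors (d1 * d2)" if "i < r" for i
    using act_eq_0_if_dvd[OF k1[OF that], of "d1 * d2"] act_eq_0_if_dvd[OF k2[OF that], of "d1 * d2"]
    by (simp add: tors_def act_add)
  obtain s t where st: "s * d1 + t * d2 = 1"
    using coprime_poly_bezout[OF assms(3)] by blast
  show "\<exists>c. x = (\<Sum>i<r. act (c i) (w1 i + w2 i))" if "x \<in> tors (d1 * d2)" for x
  proof -
    have "act (t * d2) x \<in> tors d1" "act (s * d1) x \<in> tors d2"
      using that tors_act_cofactor by (metis mult.commute)+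
    then obtain c e where c: "act (t * d2) x = (\<Sum>i<r. act (c i) (w1 i))"
      and e: "act (s * d1) x = (\<Sum>i<r. act (e i) (w2 i))"
      using w1 w2 unfolding tors_basis_def by meson
    \<comment> \<open>The combined coefficient is congruent to \<open>c i\<close> modulo
      \<open>d1\<close> and to \<open>e i\<close> modulo \<open>d2\<close>.\<close>
    have "act (t * d2 * c i + s * d1 * e i) (w1 i + w2 i) = act (c i) (w1 i) + act (e i) (w2 i)" if "i < r" for i
    proof -
      have td2: "t * d2 = 1 - s * d1" and sd1: "s * d1 = 1 - t * d2"
        using st by (simp_all add: algebra_simps)
      have "act (t * d2 * c i + s * d1 * e i) (w1 i) = act (c i) (w1 i)"
      proof (rule act_cong_if_dvd[OF k1[OF that]])
        have "t * d2 * c i + s * d1 * e i - c i = d1 * (s * (e i - c i))"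
          unfolding td2 by (simp add: algebra_simps)
        then show "d1 dvd t * d2 * c i + s * d1 * e i - c i" by (simp only: dvd_triv_left)
      qed
      moreover have "act (t * d2 * c i + s * d1 * e i) (w2 i) = act (e i) (w2 i)"
      proof (rule act_cong_if_dvd[OF k2[OF that]])
        have "t * d2 * c i + s * d1 * e i - e i = d2 * (t * (c i - e i))"
          unfolding sd1 by (simp add: algebra_simps)
        then show "d2 dvd t * d2 * c i + s * d1 * e i - e i" by (simp only: dvd_triv_left)
      qed
      ultimately show ?thesis by (simp add: act_add)
    qed
    then have "(\<Sum>i<r. act (t * d2 * c i + s * d1 * e i) (w1 i + w2 i)) = act (t * d2) x + act (s * d1) x"
      by (simp add: c e sum.distrib)
    also have "\<dots> = x" using st by (simp add: act_add_left[symmetric] add.commute)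
    finally show ?thesis by metis
  qed
  fix c i assume c: "(\<Sum>i<r. act (c i) (w1 i + w2 i)) = 0" and i: "i < r"
  \<comment> \<open>Multiplying the relation by \<open>d2\<close> removes the part in
    \<open>w2\<close>, and \<open>d2\<close> is invertible modulo \<open>d1\<close>.\<close>
  have "(\<Sum>i<r. act (d2 * c i) (w1 i)) = act d2 (\<Sum>i<r. act (c i) (w1 i + w2 i))"
    unfolding act_sum by (intro sum.cong) (auto simp: act_mult act_add act_commute[of d2] k2)
  then have "d1 dvd d2 * c i" using c i tors_basis_indep[OF w1, of "\<lambda>i. d2 * c i"] by simp
  then have "d1 dvd c i" using coprime_poly_dvd_mult assms(3) by blast
  have "(\<Sum>i<r. act (d1 * c i) (w2 i)) = act d1 (\<Sum>i<r. act (c i) (w1 i + w2 i))"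
    unfolding act_sum by (intro sum.cong) (auto simp: act_mult act_add act_commute[of d1] k1)
  then have "d2 dvd d1 * c i" using c i tors_basis_indep[OF w2, of "\<lambda>i. d1 * c i"] by simp
  then have "d2 dvd c i" using coprime_poly_dvd_mult assms(3) coprime_commute by blast
  then show "d1 * d2 dvd c i" using coprime_poly_mult_dvd \<open>d1 dvd c i\<close> assms(3) by blast
qed

text \<open>Spanning holds because a point of level \<open>n\<close> extends upwards to a Tate
  vector when \<open>l\<close> acts surjectively. For independence, a relation at level
  \<open>n\<close> yields a Tate vector vanishing there, hence \<open>l^n\<close> times another one;
  uniqueness of adic coordinates then makes the coefficients divisible by
  \<open>l^n\<close>.\<close>

lemma tors_basis_of_tate:
  fixes l :: "'q poly"
  assumes surj: "\<And>x. \<exists>y. act l y = x"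
    and e: "\<And>i. i < r \<Longrightarrow> e i 0 = 0" "\<And>i n. i < r \<Longrightarrow> act l (e i (Suc n)) = e i n"
    and coords: "\<And>x. x 0 = 0 \<Longrightarrow> (\<And>n. act l (x (Suc n)) = x n) \<Longrightarrow>
      \<exists>!\<alpha>. (\<forall>i<r. \<alpha> i \<in> adic_ints l) \<and> (\<forall>i\<ge>r. \<alpha> i = (\<lambda>_. 0)) \<and>
        x = (\<lambda>n. \<Sum>i<r. act (\<alpha> i n) (e i n))"
  shows "tors_basis r (l ^ n) (\<lambda>i. e i n)"
  unfolding tors_basis_def
proof (intro conjI allI impI ballI)
  have shift: "act (l ^ k) (e i (j + k)) = e i j" if "i < r" for i j k
  proof (induction k)
    case (Suc k)
    have "act (l ^ Suc k) (e i (j + Suc k)) = act (l ^ k) (act l (e i (Suc (j + k))))"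
      by (simp add: act_mult[symmetric] mult.commute)
    then show ?case by (simp add: e(2)[OF that] Suc)
  qed simp
  have kill: "act (l ^ k) (e i k) = 0" if "i < r" for i k
    using shift[OF that, of k 0] e(1)[OF that] by simp
  show "e i n \<in> tors (l ^ n)" if "i < r" for i
    using kill[OF that] by (simp add: tors_def)
  show "\<exists>c. x = (\<Sum>i<r. act (c i) (e i n))" if x: "x \<in> tors (l ^ n)" for x
  proof -
    obtain g where g: "\<And>x. act l (g x) = x" using surj by metis
    \<comment> \<open>Below level \<open>n\<close> the vector is forced by multiplication with
      \<open>l\<close>; above it, preimages are chosen.\<close>
    define z where "z k = (if k \<le> n then act (l ^ (n - k)) x else (g ^^ (k - n)) x)" for k
    have "z 0 = 0" using x by (simp add: z_def tors_def)
    moreover have "act l (z (Suc k)) = z k" for k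
    proof -
      consider "Suc k \<le> n" | "k = n" | "k > n" by linarith
      then show ?thesis
      proof cases
        case 1
        then have "n - k = Suc (n - Suc k)" by linarith
        with 1 show ?thesis by (simp add: z_def act_mult[symmetric])
      next
        case 2
        then show ?thesis by (simp add: z_def g)
      next
        case 3
        then have "Suc k - n = Suc (k - n)" by linarith
        with 3 show ?thesis by (simp add: z_def g)
      qed
    qed
    ultimately obtain \<alpha> where "z = (\<lambda>n. \<Sum>i<r. act (\<alpha> i n) (e i n))"
      using coords[of z] by blast
    then have "z n = (\<Sum>i<r. act (\<alpha> i n) (e i n))" by metis
    then show ?thesis by (auto simp: z_def)
  qed
  fix c i assume c: "(\<Sum>i<r. act (c i) (e i n)) = 0" and i: "i < r"
  define y where "y k = (\<Sum>i<r. act (c i) (e i k))" for k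
  have y_shift: "act (l ^ k) (y (j + k)) = y j" for j k
    unfolding y_def act_sum by (intro sum.cong refl) (simp add: act_commute[of "l ^ k"] shift)
  have y_Suc: "act l (y (Suc j)) = y j" for j
    using y_shift[of 1 j] by simp
  have y0: "y 0 = 0" by (simp add: y_def e)
  have "y n = 0" using c by (simp add: y_def)
  then obtain \<beta> where \<beta>: "\<forall>i<r. \<beta> i \<in> adic_ints l"
      and z: "(\<lambda>k. y (k + n)) = (\<lambda>k. \<Sum>i<r. act (\<beta> i k) (e i k))"
    using coords[of "\<lambda>k. y (k + n)"] y_Suc by auto
  \<comment> \<open>Two coordinate vectors of \<open>y\<close>: the constants \<open>c i\<close>,
    and \<open>l^n\<close> times the coordinates of the shifted vector. They are reduced modulo
    \<open>l^k\<close> at level \<open>k\<close> to lie in \<open>adic_ints\<close>, and set to 0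
    from index \<open>r\<close> on so that uniqueness applies.\<close>
  define \<alpha>1 where "\<alpha>1 i = (if i < r then (\<lambda>k. c i mod l ^ k) else (\<lambda>_. 0))" for i
  define \<alpha>2 where "\<alpha>2 i = (if i < r then (\<lambda>k. (l ^ n * \<beta> i k) mod l ^ k) else (\<lambda>_. 0))" for i
  have mm: "a mod l ^ Suc k mod l ^ k = a mod l ^ k" for a k
    by (rule mod_mod_cancel) simp
  have "\<alpha>1 i \<in> adic_ints l" if "i < r" for i
    using that mm by (simp add: \<alpha>1_def adic_ints_def)
  moreover have "\<alpha>2 i \<in> adic_ints l" if "i < r" for i
  proof -
    have "\<beta> i k = \<beta> i (Suc k) mod l ^ k" for k
      using \<beta> that unfolding adic_ints_def by blast
    then have eq: "(l ^ n * \<beta> i k) mod l ^ k = (l ^ n * \<beta> i (Suc k)) mod l ^ k" for k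
      by (metis mod_mult_right_eq)
    have "\<alpha>2 i k = \<alpha>2 i (Suc k) mod l ^ k" for k
    proof -
      have "(l ^ n * \<beta> i k) mod l ^ k = (l ^ n * \<beta> i (Suc k)) mod l ^ Suc k mod l ^ k"
        unfolding mm by (rule eq)
      then show ?thesis using that unfolding \<alpha>2_def by (simp only: if_True)
    qed
    then show ?thesis unfolding adic_ints_def by blast
  qed
  moreover have "y = (\<lambda>k. \<Sum>i<r. act (\<alpha>1 i k) (e i k))"
    by (auto simp: \<alpha>1_def y_def kill act_mod intro!: sum.cong)
  moreover have "y = (\<lambda>k. \<Sum>i<r. act (\<alpha>2 i k) (e i k))"
  proof
    fix k
    have "y k = act (l ^ n) (y (k + n))" by (rule y_shift[symmetric])
    also have "y (k + n) = (\<Sum>i<r. act (\<beta> i k) (e i k))" using z by metis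
    also have "act (l ^ n) \<dots> = (\<Sum>i<r. act (\<alpha>2 i k) (e i k))"
      by (auto simp: \<alpha>2_def act_sum kill act_mod act_mult intro!: sum.cong)
    finally show "y k = (\<Sum>i<r. act (\<alpha>2 i k) (e i k))" .
  qed
  ultimately have "\<alpha>1 = \<alpha>2"
    using ex1_unique[OF coords[OF y0 y_Suc], of \<alpha>1 \<alpha>2] by (simp add: \<alpha>1_def \<alpha>2_def)
  \<comment> \<open>At level \<open>n\<close> the second coordinate is a multiple of
    \<open>l^n\<close> reduced to 0.\<close>
  then have "\<alpha>1 i n = \<alpha>2 i n" by simp
  then show "l ^ n dvd c i" using i by (simp add: \<alpha>1_def \<alpha>2_def mod_eq_0_iff_dvd)
qed

lemma tors_basis_2_indep:
  assumes "tors_basis 2 m w" "act c (w 0) + act d (w 1) = 0"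
  shows "m dvd c" "m dvd d"
proof -
  define f where "f = (\<lambda>i::nat. if i = 0 then c else d)"
  have "(\<Sum>i<2. act (f i) (w i)) = 0"
    using assms(2) by (simp add: numeral_2_eq_2 f_def)
  then have "\<forall>i<2. m dvd f i"
    using assms(1) unfolding tors_basis_def by blast
  from this[rule_format, of 0] this[rule_format, of 1] show "m dvd c" "m dvd d"
    by (simp_all add: f_def)
qed

lemma tors_basis_2_eq:
  assumes "tors_basis 2 m w" "act c (w 0) + act d (w 1) = act c' (w 0) + act d' (w 1)"
  shows "m dvd c - c'" "m dvd d - d'"
proof -
  have "act (c - c') (w 0) + act (d - d') (w 1) = 0"
    using assms(2) by (simp add: act_diff_left algebra_simps)
  then show "m dvd c - c'" "m dvd d - d'" using tors_basis_2_indep[OF assms(1)] by blast+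
qed

text \<open>The number equals the degree of the additive polynomial of \<open>m\<close> in rank 2,
  so a nonzero polynomial of smaller degree cannot vanish on all these points. This is the supply
  for the root count modulo \<open>Q\<close>.\<close>

lemma many_torsion_points:
  assumes w: "tors_basis 2 m w"
  shows "\<exists>S\<subseteq>tors m. finite S \<and> card S = CARD('q) ^ (2 * degree m)"
proof -
  define L where "L = Poly ` {xs :: 'q list. length xs = degree m}"
  define f where "f = (\<lambda>(c, d). act c (w 0) + act d (w 1))"
  have cardL: "card L = CARD('q) ^ degree m"
    unfolding L_def by (rule card_polys_Poly)
  then have "finite L" by (intro card_ge_0_finite) simp
  have eq: "c = d" if "c \<in> L" "d \<in> L" "m dvd c - d" for c d
    using that Poly_dvd_diff_imp_eq unfolding L_def by blast
  have "inj_on f (L \<times> L)"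
  proof (rule inj_onI, clarify)
    fix c d c' d' assume L: "c \<in> L" "d \<in> L" "c' \<in> L" "d' \<in> L" and "f (c, d) = f (c', d')"
    then have "act (c - c') (w 0) + act (d - d') (w 1) = 0"
      by (simp add: f_def act_diff_left algebra_simps)
    then have "m dvd c - c'" "m dvd d - d'"
      using tors_basis_2_indep[OF w] by blast+
    then show "c = c' \<and> d = d'"
      using eq L by blast
  qed
  then have "card (f ` (L \<times> L)) = CARD('q) ^ (2 * degree m)"
    by (simp add: card_image card_cartesian_product cardL mult_2 power_add)
  moreover have "f ` (L \<times> L) \<subseteq> tors m"
    using w by (auto simp: f_def tors_basis_def intro!: tors_add tors_act)
  ultimately show ?thesis using \<open>finite L\<close> by (intro exI[of _ "f ` (L \<times> L)"]) auto
qed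

end

text \<open>\<open>\<sigma>\<close> commutes with the action on torsion points only: elsewhere it is unconstrained.\<close>

locale galois_action = poly_action act
  for act :: "'q::{finite,field} poly \<Rightarrow> 'k::ab_group_add \<Rightarrow> 'k" +
  fixes \<sigma> :: "'k \<Rightarrow> 'k"
  assumes sigma_add: "m \<noteq> 0 \<Longrightarrow> x \<in> tors m \<Longrightarrow> y \<in> tors m \<Longrightarrow> \<sigma> (x + y) = \<sigma> x + \<sigma> y"
    and sigma_act: "m \<noteq> 0 \<Longrightarrow> x \<in> tors m \<Longrightarrow> \<sigma> (act c x) = act c (\<sigma> x)"
begin

lemma sigma_0 [simp]: "\<sigma> 0 = 0"
  using sigma_add[of 1 0 0] by simp

lemma sigma_tors: "m \<noteq> 0 \<Longrightarrow> x \<in> tors m \<Longrightarrow> \<sigma> x \<in> tors m"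
  using sigma_act[of m x m] by (simp add: tors_def)

definition satisfies_quadratic :: "'q poly \<Rightarrow> 'q poly \<Rightarrow> 'q poly \<Rightarrow> bool" where
  "satisfies_quadratic a v m \<longleftrightarrow> (\<forall>x\<in>tors m. \<sigma> (\<sigma> x) + act a (\<sigma> x) + act v x = 0)"

text \<open>Cayley-Hamilton for the two by two matrix \<open>M\<close>, whose trace and determinant
  are \<open>- a\<close> and \<open>v\<close> modulo \<open>m\<close>.\<close>

lemma satisfies_quadratic_of_matrix:
  assumes m: "m \<noteq> 0" and w: "tors_basis 2 m w"
    and M: "\<And>j. j < 2 \<Longrightarrow> \<sigma> (w j) = (\<Sum>i<2. act (M i j) (w i))"
    and tr: "m dvd M 0 0 + M 1 1 + a" and dt: "m dvd M 0 0 * M 1 1 - M 0 1 * M 1 0 - v"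
  shows "satisfies_quadratic a v m"
  unfolding satisfies_quadratic_def
proof
  fix x assume x: "x \<in> tors m"
  obtain c where c: "x = (\<Sum>i<2. act (c i) (w i))" using w x unfolding tors_basis_def by blast
  have w01: "w 0 \<in> tors m" "w 1 \<in> tors m" using w by (auto simp: tors_basis_def)
  then have k: "act m (w 0) = 0" "act m (w 1) = 0" by (simp_all add: tors_def)
  have comb: "\<sigma> (act d (w 0) + act e (w 1)) =
      act (d * M 0 0 + e * M 0 1) (w 0) + act (d * M 1 0 + e * M 1 1) (w 1)" for d e
    using M[of 0] M[of 1]
    by (simp add: sigma_add[OF m] sigma_act[OF m] w01[simplified] tors_act numeral_2_eq_2 act_add act_add_left act_mult algebra_simps)
  have x: "x = act (c 0) (w 0) + act (c 1) (w 1)" using c by (simp add: numeral_2_eq_2)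
  \<comment> \<open>These are the errors in trace and determinant; by Cayley-Hamilton
    \<open>M^2 + a M + v = t M - d\<close>.\<close>
  define t d where "t = M 0 0 + M 1 1 + a" and "d = M 0 0 * M 1 1 - M 0 1 * M 1 0 - v"
  have "\<sigma> (\<sigma> x) + act a (\<sigma> x) + act v x =
    act ((c 0 * M 0 0 + c 1 * M 0 1) * t - c 0 * d) (w 0) + act ((c 0 * M 1 0 + c 1 * M 1 1) * t - c 1 * d) (w 1)"
    unfolding x comb by (simp add: t_def d_def act_add act_add_left act_diff_left act_mult[symmetric] algebra_simps)
  also have "\<dots> = 0"
    using tr dt by (simp only: t_def[symmetric] d_def[symmetric] act_eq_0_if_dvd[OF k(1)] act_eq_0_if_dvd[OF k(2)]
        dvd_diff dvd_mult add_0)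
  finally show "\<sigma> (\<sigma> x) + act a (\<sigma> x) + act v x = 0" .
qed

text \<open>The projections by \<open>t d2\<close> and \<open>s d1\<close> split a point;
  \<open>\<sigma>\<close> is additive on the two parts because both are torsion.\<close>

lemma satisfies_quadratic_mult:
  assumes "d1 \<noteq> 0" "d2 \<noteq> 0" "coprime d1 d2" "satisfies_quadratic a v d1" "satisfies_quadratic a v d2"
  shows "satisfies_quadratic a v (d1 * d2)"
  unfolding satisfies_quadratic_def
proof
  fix x assume x: "x \<in> tors (d1 * d2)"
  obtain s t where st: "s * d1 + t * d2 = 1"
    using coprime_poly_bezout[OF assms(3)] by blast
  have ne: "d1 * d2 \<noteq> 0" using assms by simp
  define y z where "y = act (t * d2) x" and "z = act (s * d1) x"
  have yz: "y \<in> tors d1" "z \<in> tors d2"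
    unfolding y_def z_def using x tors_act_cofactor by (metis mult.commute)+
  then have yz': "y \<in> tors (d1 * d2)" "z \<in> tors (d1 * d2)" by (auto intro: tors_dvd)
  have "x = y + z" using st by (simp add: y_def z_def act_add_left[symmetric] add.commute)
  moreover have "\<sigma> (\<sigma> y) + act a (\<sigma> y) + act v y = 0" "\<sigma> (\<sigma> z) + act a (\<sigma> z) + act v z = 0"
    using assms(4,5) yz by (auto simp: satisfies_quadratic_def)
  moreover have "\<sigma> (\<sigma> (y + z)) + act a (\<sigma> (y + z)) + act v (y + z) =
      (\<sigma> (\<sigma> y) + act a (\<sigma> y) + act v y) + (\<sigma> (\<sigma> z) + act a (\<sigma> z) + act v z)"
    using yz' by (simp add: sigma_add[OF ne] sigma_tors[OF ne] act_add)
  ultimately show "\<sigma> (\<sigma> x) + act a (\<sigma> x) + act v x = 0"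
    by simp
qed

end

section \<open>The quotient of \<open>2 \<sigma> + a\<close> by the conductor on torsion
  points\<close>

context galois_action
begin

text \<open>With \<open>- a\<close> as the trace of \<open>\<sigma>\<close>, this is twice its
  trace-free part; doubling keeps the coefficients free of halves.\<close>

definition twice_sigma :: "'q poly \<Rightarrow> 'k \<Rightarrow> 'k" where
  "twice_sigma a x = act 2 (\<sigma> x) + act a x"

context
  fixes a v b \<delta> m :: "'q poly"
  assumes m: "m \<noteq> 0" and b: "b \<noteq> 0"
    and disc: "a\<^sup>2 - 4 * v = b\<^sup>2 * \<delta>"
    and surj: "\<And>x. \<exists>y. act b y = x"
    and kill: "\<And>x. x \<in> tors b \<Longrightarrow> twice_sigma a x = 0"
    and quad: "satisfies_quadratic a v (b * (b * m))"
begin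

lemma twice_sigma_add:
  "n \<noteq> 0 \<Longrightarrow> x \<in> tors n \<Longrightarrow> y \<in> tors n \<Longrightarrow> twice_sigma a (x + y) = twice_sigma a x + twice_sigma a y"
  by (simp add: twice_sigma_def sigma_add act_add algebra_simps)

lemma twice_sigma_act:
  "n \<noteq> 0 \<Longrightarrow> x \<in> tors n \<Longrightarrow> twice_sigma a (act c x) = act c (twice_sigma a x)"
  by (simp add: twice_sigma_def sigma_act act_add act_commute[of c])

definition divide_b :: "'k \<Rightarrow> 'k" where
  "divide_b x = (SOME y. act b y = x)"

lemma act_divide_b [simp]: "act b (divide_b x) = x"
  unfolding divide_b_def using surj by (rule someI_ex)

lemma divide_b_tors: "x \<in> tors n \<Longrightarrow> divide_b x \<in> tors (b * n)"
  by (simp add: tors_def act_mult act_commute[of b n])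

definition \<theta> :: "'k \<Rightarrow> 'k" where
  "\<theta> x = twice_sigma a (divide_b x)"

text \<open>Two preimages of \<open>x\<close> under \<open>b\<close> differ by
  \<open>b\<close>-torsion, which \<open>2 \<sigma> + a\<close> kills. So the arbitrary choice in
  \<open>divide_b\<close> is harmless, and the laws of \<open>\<theta>\<close> follow by picking
  convenient preimages.\<close>

lemma theta_eqI:
  assumes "n \<noteq> 0" "x \<in> tors n" "act b y = x"
  shows "\<theta> x = twice_sigma a y"
proof -
  have y: "y \<in> tors (b * n)"
    using assms(2,3) by (simp add: tors_def act_mult act_commute[of b n])
  have bn: "b * n \<noteq> 0" using assms(1) b by simp
  have "divide_b x - y \<in> tors b" using assms(3) by (simp add: tors_def act_diff)
  then have "twice_sigma a (divide_b x - y) = 0" by (rule kill)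
  moreover have "divide_b x - y \<in> tors (b * n)"
    by (intro tors_diff divide_b_tors y assms(2))
  ultimately have "twice_sigma a ((divide_b x - y) + y) = 0 + twice_sigma a y"
    using twice_sigma_add[OF bn _ y] by metis
  then show ?thesis by (simp add: \<theta>_def)
qed

lemma theta_add:
  assumes "n \<noteq> 0" "x \<in> tors n" "y \<in> tors n"
  shows "\<theta> (x + y) = \<theta> x + \<theta> y"
proof -
  have bn: "b * n \<noteq> 0" using assms(1) b by simp
  have "\<theta> (x + y) = twice_sigma a (divide_b x + divide_b y)"
    by (rule theta_eqI[OF assms(1) tors_add[OF assms(2,3)]]) (simp add: act_add)
  then show ?thesis
    by (simp add: \<theta>_def twice_sigma_add[OF bn] divide_b_tors assms)
qed

lemma theta_act:
  assumes "n \<noteq> 0" "x \<in> tors n"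
  shows "\<theta> (act c x) = act c (\<theta> x)"
proof -
  have bn: "b * n \<noteq> 0" using assms(1) b by simp
  have "\<theta> (act c x) = twice_sigma a (act c (divide_b x))"
    by (rule theta_eqI[OF assms(1) tors_act[OF assms(2)]]) (simp add: act_commute[of b])
  then show ?thesis
    by (simp add: \<theta>_def twice_sigma_act[OF bn] divide_b_tors assms)
qed

lemma act_b_theta: "n \<noteq> 0 \<Longrightarrow> x \<in> tors n \<Longrightarrow> act b (\<theta> x) = twice_sigma a x"
  using twice_sigma_act[of "b * n" "divide_b x" b] divide_b_tors[of x n] b by (simp add: \<theta>_def)

lemma theta_0 [simp]: "\<theta> 0 = 0"
  using theta_act[of 1 0 0] by simp

lemma theta_tors: "n \<noteq> 0 \<Longrightarrow> x \<in> tors n \<Longrightarrow> \<theta> x \<in> tors n"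
  using theta_act[of n x n] by (simp add: tors_def)

text \<open>\<open>(2 \<sigma> + a)^2 = 4 (\<sigma>^2 + a \<sigma> + v) + (a^2 - 4 v)\<close>, whose
  first part vanishes. Two divisions by \<open>b\<close> take place, which is why the quadratic
  relation is required on the torsion of \<open>b * (b * m)\<close>.\<close>

lemma theta_theta:
  assumes x: "x \<in> tors m"
  shows "\<theta> (\<theta> x) = act \<delta> x"
proof -
  define y z where "y = divide_b x" and "z = divide_b y"
  have z: "z \<in> tors (b * (b * m))" and ne: "b * (b * m) \<noteq> 0"
    using x b m by (auto simp: y_def z_def intro!: divide_b_tors)
  have sz: "\<sigma> z \<in> tors (b * (b * m))" by (rule sigma_tors[OF ne z])
  have "act b (twice_sigma a z) = \<theta> x"
    by (simp add: twice_sigma_act[OF ne z, symmetric]) (simp add: z_def \<theta>_def y_def)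
  then have "\<theta> (\<theta> x) = twice_sigma a (twice_sigma a z)"
    by (rule theta_eqI[OF m theta_tors[OF m x]])
  also have "\<dots> = act 4 (\<sigma> (\<sigma> z) + act a (\<sigma> z) + act v z) + act (a\<^sup>2 - 4 * v) z"
  proof -
    have four: "(4 :: 'q poly) = 2 * 2" by simp
    show ?thesis
      using z sz unfolding four power2_eq_square
      by (simp add: twice_sigma_def sigma_add[OF ne] sigma_act[OF ne] tors_act act_add act_diff_left
          act_mult act_add_left act_commute[of a 2])
         (simp add: act_mult[symmetric] act_add_left[symmetric] act_diff_left[symmetric])
  qed
  also have "\<dots> = act (\<delta> * (b * b)) z"
    using quad z disc by (simp add: satisfies_quadratic_def power2_eq_square mult.commute)
  also have "\<dots> = act \<delta> x" by (simp add: act_mult z_def y_def)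
  finally show ?thesis .
qed

text \<open>The vectors \<open>x\<close> and \<open>y = \<theta> x\<close> form a basis modulo
  \<open>m\<close> when their determinant, a quadratic form in \<open>x\<close>, is prime to
  \<open>m\<close>. All coefficients of this form vanish modulo a prime \<open>l\<close> only if
  \<open>\<theta>\<close> is scalar on the \<open>l\<close>-torsion, which \<open>nonscalar\<close>
  excludes. The conclusion gives the column equations for \<open>\<sigma>\<close> in this basis,
  doubled to avoid halves.\<close>

lemma sigma_matrix_conjugate:
  assumes w: "tors_basis 2 m w"
    and nonscalar: "\<And>l c. irreducible l \<Longrightarrow> l dvd m \<Longrightarrow> \<exists>y\<in>tors (b * l). twice_sigma a y \<noteq> act (b * c) y"
    and B: "\<sigma> (w 0) = act B00 (w 0) + act B10 (w 1)" "\<sigma> (w 1) = act B01 (w 0) + act B11 (w 1)"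
  shows "\<exists>x0 x1 y0 y1. coprime (x0 * y1 - x1 * y0) m \<and>
    m dvd 2 * (B00 * x0 + B01 * x1) - (b * y0 - a * x0) \<and>
    m dvd 2 * (B10 * x0 + B11 * x1) - (b * y1 - a * x1) \<and>
    m dvd 2 * (B00 * y0 + B01 * y1) - (b * \<delta> * x0 - a * y0) \<and>
    m dvd 2 * (B10 * y0 + B11 * y1) - (b * \<delta> * x1 - a * y1)"
proof -
  have w01: "w 0 \<in> tors m" "w 1 \<in> tors m" using w by (auto simp: tors_basis_def)
  have span: "\<exists>c d. x = act c (w 0) + act d (w 1)" if "x \<in> tors m" for x
  proof -
    obtain c where "x = (\<Sum>i<2. act (c i) (w i))" using w \<open>x \<in> tors m\<close> unfolding tors_basis_def by blast
    then show ?thesis by (intro exI[of _ "c 0"] exI[of _ "c 1"]) (simp add: numeral_2_eq_2)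
  qed
  obtain T00 T10 T01 T11 where T: "\<theta> (w 0) = act T00 (w 0) + act T10 (w 1)"
      "\<theta> (w 1) = act T01 (w 0) + act T11 (w 1)"
    using span theta_tors[OF m] w01 by metis
  have comb: "\<theta> (act c (w 0) + act d (w 1)) =
      act (c * T00 + d * T01) (w 0) + act (c * T10 + d * T11) (w 1)" for c d
    using w01 by (simp add: theta_add[OF m] theta_act[OF m] tors_act T[simplified] act_add act_add_left act_mult add_ac)
  have "act (T00 * T00 + T10 * T01) (w 0) + act (T00 * T10 + T10 * T11) (w 1) = act \<delta> (w 0) + act 0 (w 1)"
    using theta_theta[OF w01(1)] unfolding T comb by simp
  note sq0 = tors_basis_2_eq[OF w this]
  have "act (T01 * T00 + T11 * T01) (w 0) + act (T01 * T10 + T11 * T11) (w 1) = act 0 (w 0) + act \<delta> (w 1)"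
    using theta_theta[OF w01(2)] unfolding T comb by simp
  note sq1 = tors_basis_2_eq[OF w this]
  have "act (b * T00) (w 0) + act (b * T10) (w 1) = act (2 * B00 + a) (w 0) + act (2 * B10) (w 1)"
    using act_b_theta[OF m w01(1)] unfolding T twice_sigma_def B
    by (simp add: act_add act_add_left act_mult add_ac)
  note bT0 = tors_basis_2_eq[OF w this]
  have "act (b * T01) (w 0) + act (b * T11) (w 1) = act (2 * B01) (w 0) + act (2 * B11 + a) (w 1)"
    using act_b_theta[OF m w01(2)] unfolding T twice_sigma_def B
    by (simp add: act_add act_add_left act_mult add_ac)
  note bT1 = tors_basis_2_eq[OF w this]
  \<comment> \<open>These are the coefficients of \<open>det (x, T x)\<close>; if \<open>l\<close>
    divides all three, \<open>T\<close> is the scalar \<open>T00\<close> modulo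
    \<open>l\<close>.\<close>
  have prim: "\<not> (l dvd T10 \<and> l dvd T11 - T00 \<and> l dvd - T01)" if l: "irreducible l" "l dvd m" for l
  proof
    assume asm: "l dvd T10 \<and> l dvd T11 - T00 \<and> l dvd - T01"
    have "l \<noteq> 0" using l m by auto
    obtain n where n: "m = l * n" using l(2) by (elim dvdE)
    have \<theta>l: "\<theta> x = act T00 x" if x: "x \<in> tors l" for x
    proof -
      obtain c d where cd: "x = act c (w 0) + act d (w 1)" using span x tors_dvd l(2) by blast
      \<comment> \<open>Coordinates of an \<open>l\<close>-torsion point are divisible by
        \<open>m / l\<close>, so only the entries of \<open>T\<close> modulo \<open>l\<close>
        matter.\<close>
      have "act (l * c) (w 0) + act (l * d) (w 1) = 0"
        using x cd by (simp add: tors_def act_add act_mult)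
      from tors_basis_2_indep[OF w this] have "n dvd c" "n dvd d"
        using \<open>l \<noteq> 0\<close> by (auto simp: n)
      then have m_dvd: "m dvd c * e" "m dvd d * e" if "l dvd e" for e
        using that by (auto simp: n mult.commute[of l] intro: mult_dvd_mono)
      have "act (c * T00 + d * T01) (w 0) = act (T00 * c) (w 0)"
        by (rule act_cong_if_dvd[of m]) (use w01 asm m_dvd(2)[of T01] in \<open>auto simp: tors_def algebra_simps\<close>)
      moreover have "act (c * T10 + d * T11) (w 1) = act (T00 * d) (w 1)"
      proof (rule act_cong_if_dvd[of m])
        have eq: "c * T10 + d * T11 - T00 * d = c * T10 + d * (T11 - T00)" by (simp add: algebra_simps)
        show "m dvd c * T10 + d * T11 - T00 * d"
          unfolding eq using asm by (intro dvd_add m_dvd) auto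
      qed (use w01 in \<open>simp add: tors_def\<close>)
      ultimately show ?thesis unfolding cd comb by (simp add: act_add act_mult)
    qed
    obtain y where y: "y \<in> tors (b * l)" and ne: "twice_sigma a y \<noteq> act (b * T00) y"
      using nonscalar[OF l] by blast
    have y_l: "act b y \<in> tors l" using y by (simp add: tors_def act_mult act_commute[of b l])
    have "twice_sigma a y = \<theta> (act b y)"
      by (rule theta_eqI[symmetric, OF \<open>l \<noteq> 0\<close> y_l refl])
    also have "\<dots> = act (b * T00) y" by (simp add: \<theta>l[OF y_l] act_mult act_commute[of b])
    finally show False using ne by contradiction
  qed
  obtain x0 x1 where co: "coprime (T10 * x0\<^sup>2 + (T11 - T00) * x0 * x1 + (- T01) * x1\<^sup>2) m"
    using exists_coprime_quadratic_form_value[OF m prim] by blast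
  define y0 y1 where "y0 = T00 * x0 + T01 * x1" and "y1 = T10 * x0 + T11 * x1"
  have "x0 * y1 - x1 * y0 = T10 * x0\<^sup>2 + (T11 - T00) * x0 * x1 + (- T01) * x1\<^sup>2"
    by (simp add: y0_def y1_def power2_eq_square algebra_simps)
  moreover
  \<comment> \<open>\<open>E\<close> records \<open>b T - (2 B + a)\<close>, and \<open>S\<close>
    below records \<open>T^2 - \<delta>\<close>; all their entries are divisible by
    \<open>m\<close>.\<close>
  define E00 E10 E01 E11 where "E00 = b * T00 - (2 * B00 + a)" and "E10 = b * T10 - 2 * B10"
    and "E01 = b * T01 - 2 * B01" and "E11 = b * T11 - (2 * B11 + a)"
  have E: "m dvd E00" "m dvd E10" "m dvd E01" "m dvd E11"
    using bT0 bT1 by (simp_all add: E00_def E10_def E01_def E11_def)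
  define S00 S10 S01 S11 where "S00 = T00 * T00 + T10 * T01 - \<delta>" and "S10 = T00 * T10 + T10 * T11"
    and "S01 = T01 * T00 + T11 * T01" and "S11 = T01 * T10 + T11 * T11 - \<delta>"
  have S: "m dvd S00" "m dvd S10" "m dvd S01" "m dvd S11"
    using sq0 sq1 by (simp_all add: S00_def S10_def S01_def S11_def)
  have "2 * (B00 * x0 + B01 * x1) - (b * y0 - a * x0) = - (E00 * x0 + E01 * x1)"
    by (simp add: E00_def E01_def y0_def algebra_simps)
  moreover have "2 * (B10 * x0 + B11 * x1) - (b * y1 - a * x1) = - (E10 * x0 + E11 * x1)"
    by (simp add: E10_def E11_def y1_def algebra_simps)
  moreover have "2 * (B00 * y0 + B01 * y1) - (b * \<delta> * x0 - a * y0) =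
      - (E00 * y0 + E01 * y1) + b * (S00 * x0 + S01 * x1)"
    by (simp add: E00_def E01_def S00_def S01_def y0_def y1_def algebra_simps)
  moreover have "2 * (B10 * y0 + B11 * y1) - (b * \<delta> * x1 - a * y1) =
      - (E10 * y0 + E11 * y1) + b * (S10 * x0 + S11 * x1)"
    by (simp add: E10_def E11_def S10_def S11_def y0_def y1_def algebra_simps)
  ultimately show ?thesis
    using co E S
    by (intro exI[of _ x0] exI[of _ x1] exI[of _ y0] exI[of _ y1])
       (simp only: dvd_add dvd_mult dvd_mult2 dvd_minus_iff simp_thms)
qed

end

end

section \<open>Two by two matrices modulo \<open>m\<close>\<close>

lemma mat_cong_2:
  assumes "A \<in> carrier_mat 2 2" "B \<in> carrier_mat 2 2"
  shows "mat_cong m A B \<longleftrightarrow> (m dvd A $$ (0,0) - B $$ (0,0) \<and> m dvd A $$ (0,1) - B $$ (0,1) \<and>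
    m dvd A $$ (1,0) - B $$ (1,0) \<and> m dvd A $$ (1,1) - B $$ (1,1))"
proof -
  have "mat_cong m A B \<longleftrightarrow> (\<forall>i<2. \<forall>j<2. A $$ (i,j) mod m = B $$ (i,j) mod m)"
    using assms unfolding mat_cong_def by (auto simp: mat_eq_iff)
  also have "\<dots> \<longleftrightarrow> (\<forall>i<2. \<forall>j<2. m dvd A $$ (i,j) - B $$ (i,j))"
    by (simp add: mod_eq_dvd_iff)
  finally show ?thesis by (auto simp: numeral_2_eq_2 less_Suc_eq)
qed

lemma mult_mat_2_index:
  assumes "A \<in> carrier_mat 2 2" "B \<in> carrier_mat 2 2" "i < 2" "j < 2"
  shows "(A * B) $$ (i,j) = A $$ (i,0) * B $$ (0,j) + A $$ (i,1) * B $$ (1,j)"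
  using assms by (simp add: scalar_prod_def numeral_2_eq_2)

lemma mat_of_rows_list_2_index [simp]:
  "mat_of_rows_list 2 [[a, b], [c, d]] \<in> carrier_mat 2 2"
  "mat_of_rows_list 2 [[a, b], [c, d]] $$ (0,0) = a"
  "mat_of_rows_list 2 [[a, b], [c, d]] $$ (0,Suc 0) = b"
  "mat_of_rows_list 2 [[a, b], [c, d]] $$ (Suc 0,0) = c"
  "mat_of_rows_list 2 [[a, b], [c, d]] $$ (Suc 0,Suc 0) = d"
  by (simp_all add: mat_of_rows_list_def numeral_2_eq_2)

text \<open>The inverse is \<open>s\<close> times the adjugate, where \<open>s\<close> inverts the
  determinant modulo \<open>m\<close>.\<close>

lemma GL_mod_2I:
  fixes B :: "'q::field poly mat"
  assumes B: "B \<in> carrier_mat 2 2"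
    and co: "coprime (B $$ (0,0) * B $$ (1,1) - B $$ (0,1) * B $$ (1,0)) m"
  shows "B \<in> GL_mod 2 m"
proof -
  obtain s t where st: "s * (B $$ (0,0) * B $$ (1,1) - B $$ (0,1) * B $$ (1,0)) + t * m = 1"
    using coprime_poly_bezout[OF co] by blast
  define C where "C = mat_of_rows_list 2 [[s * B $$ (1,1), - (s * B $$ (0,1))], [- (s * B $$ (1,0)), s * B $$ (0,0)]]"
  have C: "C \<in> carrier_mat 2 2" by (simp add: C_def)
  have det: "s * (B $$ (0,0) * B $$ (1,1) - B $$ (0,1) * B $$ (1,0)) - 1 = - (t * m)"
    using st by (simp add: algebra_simps)
  have det': "s * (B $$ (0,0) * B $$ (1,1)) - s * (B $$ (0,1) * B $$ (1,0)) - 1 = m * (- t)"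
    using det by (simp add: algebra_simps)
  have "m dvd s * (B $$ (0,0) * B $$ (1,1)) - s * (B $$ (0,1) * B $$ (1,0)) - 1"
    unfolding det' by simp
  then have "mat_cong m (B * C) (1\<^sub>m 2)" "mat_cong m (C * B) (1\<^sub>m 2)"
    using B C by (simp_all add: mat_cong_2 mult_mat_2_index del: index_mult_mat)
      (simp_all add: C_def algebra_simps)
  then show ?thesis using B C by (auto simp: GL_mod_def)
qed

text \<open>The columns \<open>(x0, x1)\<close> and \<open>(y0, y1)\<close> form a matrix
  \<open>V\<close> with \<open>B V = V C\<close> modulo \<open>m\<close>. The conjugating matrix is
  the adjugate of \<open>V\<close>, and the unit \<open>D = det V\<close> is cancelled from the
  resulting congruences.\<close>

lemma conj_GL_mod_2I:
  fixes B C :: "'q::field poly mat" and x0 x1 y0 y1 m v :: "'q poly"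
  assumes B: "B \<in> carrier_mat 2 2" and C: "C \<in> carrier_mat 2 2"
    and co: "coprime (x0 * y1 - x1 * y0) m"
    and col0: "m dvd (B $$ (0,0) * x0 + B $$ (0,1) * x1) - (C $$ (0,0) * x0 + C $$ (1,0) * y0)"
      "m dvd (B $$ (1,0) * x0 + B $$ (1,1) * x1) - (C $$ (0,0) * x1 + C $$ (1,0) * y1)"
    and col1: "m dvd (B $$ (0,0) * y0 + B $$ (0,1) * y1) - (C $$ (0,1) * x0 + C $$ (1,1) * y0)"
      "m dvd (B $$ (1,0) * y0 + B $$ (1,1) * y1) - (C $$ (0,1) * x1 + C $$ (1,1) * y1)"
    and detC: "coprime (C $$ (0,0) * C $$ (1,1) - C $$ (0,1) * C $$ (1,0)) m"
  shows "conj_GL_mod 2 m B C"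
proof -
  define b00 b01 b10 b11 c00 c01 c10 c11 where bc: "b00 = B $$ (0,0)" "b01 = B $$ (0,1)" "b10 = B $$ (1,0)"
    "b11 = B $$ (1,1)" "c00 = C $$ (0,0)" "c01 = C $$ (0,1)" "c10 = C $$ (1,0)" "c11 = C $$ (1,1)"
  define D where "D = x0 * y1 - x1 * y0"
  obtain e1 where e1: "b00 * x0 + b01 * x1 = c00 * x0 + c10 * y0 + m * e1"
    using col0(1) unfolding bc[symmetric] by (metis dvdE diff_eq_eq add.commute)
  obtain e2 where e2: "b10 * x0 + b11 * x1 = c00 * x1 + c10 * y1 + m * e2"
    using col0(2) unfolding bc[symmetric] by (metis dvdE diff_eq_eq add.commute)
  obtain e3 where e3: "b00 * y0 + b01 * y1 = c01 * x0 + c11 * y0 + m * e3"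
    using col1(1) unfolding bc[symmetric] by (metis dvdE diff_eq_eq add.commute)
  obtain e4 where e4: "b10 * y0 + b11 * y1 = c01 * x1 + c11 * y1 + m * e4"
    using col1(2) unfolding bc[symmetric] by (metis dvdE diff_eq_eq add.commute)
  have cancel: "m dvd z" if "m dvd D * z" for z
    using coprime_poly_dvd_mult[of m D z] co that by (simp add: D_def coprime_commute)
  \<comment> \<open>This is \<open>det (B V) - det (V C)\<close>; it shows that \<open>B\<close> and
    \<open>C\<close> have the same determinant modulo \<open>m\<close>.\<close>
  have "D * (b00 * b11 - b01 * b10 - (c00 * c11 - c01 * c10)) =
      m * (e1 * (c01 * x1 + c11 * y1) + (c00 * x0 + c10 * y0) * e4 + m * e1 * e4
        - e3 * (c00 * x1 + c10 * y1) - (c01 * x0 + c11 * y0) * e2 - m * e2 * e3)"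
  proof -
    have "D * (b00 * b11 - b01 * b10) =
        (b00 * x0 + b01 * x1) * (b10 * y0 + b11 * y1) - (b00 * y0 + b01 * y1) * (b10 * x0 + b11 * x1)"
      by (simp add: D_def algebra_simps)
    then show ?thesis unfolding e1 e2 e3 e4 by (simp add: D_def algebra_simps)
  qed
  then have "m dvd D * (b00 * b11 - b01 * b10 - (c00 * c11 - c01 * c10))" by simp
  then have dt: "m dvd b00 * b11 - b01 * b10 - (c00 * c11 - c01 * c10)" by (rule cancel)
  have coB: "coprime (b00 * b11 - b01 * b10) m"
  proof (rule coprimeI)
    fix d assume d: "d dvd b00 * b11 - b01 * b10" "d dvd m"
    then have "d dvd b00 * b11 - b01 * b10 - (c00 * c11 - c01 * c10)" using dt dvd_trans by blast
    then have "d dvd c00 * c11 - c01 * c10" using d(1) by (metis dvd_diff_right_iff)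
    then show "is_unit d" using detC d(2) coprime_common_divisor unfolding bc by blast
  qed
  define U where "U = mat_of_rows_list 2 [[y1, - y0], [- x1, x0]]"
  have U: "U \<in> carrier_mat 2 2" by (simp add: U_def)
  have "U \<in> GL_mod 2 m"
    using co by (intro GL_mod_2I U) (simp add: U_def mult.commute)
  moreover have "mat_cong m (U * B) (C * U)"
  proof -
    have me: "m * e1 = b00 * x0 + b01 * x1 - (c00 * x0 + c10 * y0)" "m * e2 = b10 * x0 + b11 * x1 - (c00 * x1 + c10 * y1)"
      "m * e3 = b00 * y0 + b01 * y1 - (c01 * x0 + c11 * y0)" "m * e4 = b10 * y0 + b11 * y1 - (c01 * x1 + c11 * y1)"
      using e1 e2 e3 e4 by simp_all
    have "D * ((y1 * b00 - y0 * b10) - (c00 * y1 - c01 * x1)) =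
        y1 * (y1 * (m * e1) - y0 * (m * e2)) - x1 * (y1 * (m * e3) - y0 * (m * e4))"
      "D * ((y1 * b01 - y0 * b11) - (c01 * x0 - c00 * y0)) =
        x0 * (y1 * (m * e3) - y0 * (m * e4)) - y0 * (y1 * (m * e1) - y0 * (m * e2))"
      "D * ((x0 * b10 - x1 * b00) - (c10 * y1 - c11 * x1)) =
        y1 * (x0 * (m * e2) - x1 * (m * e1)) - x1 * (x0 * (m * e4) - x1 * (m * e3))"
      "D * ((x0 * b11 - x1 * b01) - (c11 * x0 - c10 * y0)) =
        x0 * (x0 * (m * e4) - x1 * (m * e3)) - y0 * (x0 * (m * e2) - x1 * (m * e1))"
      unfolding me by (simp_all add: D_def algebra_simps)
    note ids = this
    have "m dvd (y1 * b00 - y0 * b10) - (c00 * y1 - c01 * x1)" "m dvd (y1 * b01 - y0 * b11) - (c01 * x0 - c00 * y0)"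
      "m dvd (x0 * b10 - x1 * b00) - (c10 * y1 - c11 * x1)" "m dvd (x0 * b11 - x1 * b01) - (c11 * x0 - c10 * y0)"
      by (rule cancel, simp only: ids dvd_diff dvd_mult dvd_triv_left)+
    then show ?thesis
      using B C U by (simp add: mat_cong_2 mult_mat_2_index del: index_mult_mat)
        (simp add: U_def bc algebra_simps)
  qed
  moreover have "B \<in> GL_mod 2 m" "C \<in> GL_mod 2 m"
    using coB detC by (auto intro!: GL_mod_2I B C simp: bc)
  ultimately show ?thesis unfolding conj_GL_mod_def by blast
qed

section \<open>The Frobenius order inside the endomorphism ring\<close>

text \<open>Elements of \<open>E\<close> are only known to commute with the image of
  \<open>A\<close>. The assumption \<open>tf\<close> says that this image is saturated in
  \<open>E\<close>; \<open>gen\<close> and \<open>ord\<close> say that \<open>\<alpha>\<close>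
  generates \<open>E\<close> modulo \<open>A + A \<pi>\<close> with annihilator
  \<open>b\<close>.\<close>

locale frobenius_order =
  fixes \<Phi> :: "'q::field poly \<Rightarrow> 'w::ring_1_no_zero_divisors" and E :: "'w set" and \<pi> \<alpha> :: 'w
    and a v b \<delta> :: "'q poly"
  assumes Phi_add: "\<Phi> (x + y) = \<Phi> x + \<Phi> y"
    and Phi_mult: "\<Phi> (x * y) = \<Phi> x * \<Phi> y"
    and Phi_1: "\<Phi> 1 = 1"
    and Phi_in: "\<Phi> x \<in> E"
    and E_add: "s \<in> E \<Longrightarrow> t \<in> E \<Longrightarrow> s + t \<in> E"
    and E_mult: "s \<in> E \<Longrightarrow> t \<in> E \<Longrightarrow> s * t \<in> E"
    and E_comm: "s \<in> E \<Longrightarrow> s * \<Phi> x = \<Phi> x * s"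
    and pi_in: "\<pi> \<in> E"
    and tf: "x \<noteq> 0 \<Longrightarrow> s \<in> E \<Longrightarrow> \<Phi> x * s = \<Phi> y \<Longrightarrow> s \<in> range \<Phi>"
    and pi_notin: "\<pi> \<notin> range \<Phi>"
    and pi_quad: "\<pi> * \<pi> + \<Phi> a * \<pi> + \<Phi> v = 0"
    and two: "(2 :: 'q) \<noteq> 0"
    and alpha_in: "\<alpha> \<in> E"
    and gen: "s \<in> E \<Longrightarrow> \<exists>y c e. s = \<Phi> y * \<alpha> + (\<Phi> c + \<Phi> e * \<pi>)"
    and ord: "(\<exists>c e. \<Phi> y * \<alpha> = \<Phi> c + \<Phi> e * \<pi>) \<longleftrightarrow> b dvd y"
    and b: "b \<noteq> 0"
    and disc: "a\<^sup>2 - 4 * v = b\<^sup>2 * \<delta>"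
begin

lemma Phi_0 [simp]: "\<Phi> 0 = 0"
  using Phi_add[of 0 0] by simp

lemma Phi_minus: "\<Phi> (- x) = - \<Phi> x"
  using Phi_add[of x "- x"] by (simp add: eq_neg_iff_add_eq_0 add.commute)

lemma Phi_diff: "\<Phi> (x - y) = \<Phi> x - \<Phi> y"
  using Phi_add[of x "- y"] by (simp add: Phi_minus)

lemma E_diff: "s \<in> E \<Longrightarrow> t \<in> E \<Longrightarrow> s - t \<in> E"
proof -
  assume "s \<in> E" "t \<in> E"
  then have "s + \<Phi> (- 1) * t \<in> E" by (intro E_add E_mult Phi_in)
  then show ?thesis by (simp add: Phi_minus Phi_1)
qed

lemma Phi_commute: "\<Phi> x * \<Phi> y = \<Phi> y * \<Phi> x"
  by (metis Phi_mult mult.commute)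

lemma square_expand:
  assumes "z \<in> E"
  shows "(\<Phi> c * z + \<Phi> d) * (\<Phi> c * z + \<Phi> d) = \<Phi> (c * c) * (z * z) + \<Phi> (2 * c * d) * z + \<Phi> (d * d)"
proof -
  note com = E_comm[OF assms]
  have 1: "\<Phi> c * z * (\<Phi> c * z) = \<Phi> (c * c) * (z * z)" by (metis Phi_mult mult.assoc com)
  have 2: "\<Phi> c * z * \<Phi> d = \<Phi> (c * d) * z" by (metis Phi_mult mult.assoc com)
  have 3: "\<Phi> d * (\<Phi> c * z) = \<Phi> (c * d) * z" by (metis Phi_mult mult.assoc mult.commute)
  have 4: "\<Phi> (2 * c * d) * z = \<Phi> (c * d) * z + \<Phi> (c * d) * z"
    unfolding mult.assoc[of 2] mult_2 Phi_add distrib_right ..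
  show ?thesis
    unfolding distrib_left distrib_right 1 2 3 4 Phi_mult[of d d] by (simp add: add_ac)
qed

lemma b_times_E:
  assumes "s \<in> E"
  shows "\<exists>c e. \<Phi> b * s = \<Phi> c + \<Phi> e * \<pi>"
proof -
  obtain y c e where s: "s = \<Phi> y * \<alpha> + (\<Phi> c + \<Phi> e * \<pi>)" using gen assms by blast
  obtain c' e' where ba: "\<Phi> b * \<alpha> = \<Phi> c' + \<Phi> e' * \<pi>" using ord[of b] by auto
  have "\<Phi> b * s = \<Phi> y * (\<Phi> b * \<alpha>) + (\<Phi> (b * c) + \<Phi> (b * e) * \<pi>)"
    unfolding s by (simp add: distrib_left Phi_mult Phi_commute[of b y] flip: mult.assoc)
  also have "\<dots> = \<Phi> (y * c' + b * c) + \<Phi> (y * e' + b * e) * \<pi>"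
    unfolding ba by (simp add: distrib_left distrib_right Phi_add Phi_mult mult.assoc)
  finally show ?thesis by blast
qed

text \<open>As \<open>b s = x + y \<pi>\<close>, the equation puts \<open>(2 - l y) \<pi>\<close>
  into \<open>A\<close>. The factor is nonzero because 2 is a unit and \<open>l\<close> is not, so
  saturation would put \<open>\<pi>\<close> into \<open>A\<close>.\<close>

lemma not_scalar:
  assumes "\<not> is_unit l" "s \<in> E" "\<Phi> 2 * \<pi> + \<Phi> a - \<Phi> (b * c) = \<Phi> (b * l) * s"
  shows False
proof -
  obtain x y where xy: "\<Phi> b * s = \<Phi> x + \<Phi> y * \<pi>" using b_times_E assms(2) by blast
  have "\<Phi> (b * l) * s = \<Phi> l * (\<Phi> b * s)" by (simp add: Phi_mult Phi_commute[of b] flip: mult.assoc)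
  then have "\<Phi> (2 - l * y) * \<pi> = \<Phi> (b * c + l * x - a)"
    using assms(3) unfolding xy
    by (simp add: Phi_add Phi_diff Phi_mult distrib_left distrib_right left_diff_distrib mult.assoc algebra_simps)
  moreover have "2 - l * y \<noteq> 0"
  proof
    assume "2 - l * y = 0"
    then have "l dvd 2" using dvd_triv_left[of l y] by simp
    moreover have "is_unit (2 :: 'q poly)"
      using two by (simp add: is_unit_iff_degree numeral_poly)
    ultimately show False using assms(1) dvd_trans by blast
  qed
  ultimately show False using tf pi_in pi_notin by blast
qed

text \<open>In \<open>b \<alpha> = x + y \<pi>\<close> the polynomial \<open>y\<close> is prime to
  \<open>b\<close>: a common factor \<open>d\<close> would, by saturation, already put
  \<open>(b / d) \<alpha>\<close> into \<open>A + A \<pi>\<close>. Bezout then replaces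
  \<open>\<alpha>\<close> by a \<open>\<beta>\<close> with \<open>E = A + A \<beta>\<close>.\<close>

lemma exists_divisor:
  "\<exists>\<theta>\<in>E. \<Phi> 2 * \<pi> + \<Phi> a = \<Phi> b * \<theta>"
proof -
  obtain x y where xy: "\<Phi> b * \<alpha> = \<Phi> x + \<Phi> y * \<pi>" using ord[of b] by auto
  have "coprime b y"
  proof (rule coprimeI)
    fix d assume "d dvd b" "d dvd y"
    then obtain b' y' where b': "b = d * b'" and y': "y = d * y'" by (elim dvdE)
    have ne: "d \<noteq> 0" "b' \<noteq> 0" using b b' by auto
    have "\<Phi> d * (\<Phi> b' * \<alpha> - \<Phi> y' * \<pi>) = \<Phi> x"
      using xy by (simp add: b' y' Phi_mult right_diff_distrib mult.assoc)
    then have "\<Phi> b' * \<alpha> - \<Phi> y' * \<pi> \<in> range \<Phi>"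
      by (rule tf[OF ne(1), rotated]) (intro E_diff E_mult Phi_in alpha_in pi_in)
    then obtain x' where "\<Phi> b' * \<alpha> = \<Phi> x' + \<Phi> y' * \<pi>" by (auto simp: algebra_simps)
    then have "b dvd b'" using ord[of b'] by blast
    then show "is_unit d" using ne by (simp add: b' mult.commute[of d] dvd_mult_cancel_left)
  qed
  then obtain s t where st: "s * b + t * y = 1" using coprime_poly_bezout by blast
  \<comment> \<open>The choice makes the coefficient of \<open>\<pi>\<close> in
    \<open>b \<beta>\<close> equal to \<open>s b + t y = 1\<close>.\<close>
  define \<beta> where "\<beta> = \<Phi> s * \<pi> + \<Phi> t * \<alpha>"
  have \<beta>E: "\<beta> \<in> E" unfolding \<beta>_def by (intro E_add E_mult Phi_in alpha_in pi_in)
  have b\<beta>: "\<Phi> b * \<beta> = \<pi> + \<Phi> (t * x)"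
  proof -
    have "\<Phi> b * \<beta> = \<Phi> (s * b) * \<pi> + \<Phi> t * (\<Phi> b * \<alpha>)"
      by (simp add: \<beta>_def distrib_left Phi_mult Phi_commute[of b] flip: mult.assoc)
    also have "\<dots> = \<Phi> (s * b + t * y) * \<pi> + \<Phi> (t * x)"
      unfolding xy by (simp add: distrib_left distrib_right Phi_add Phi_mult mult.assoc)
    finally show ?thesis by (simp add: st Phi_1)
  qed
  then have pi: "\<pi> = \<Phi> b * \<beta> - \<Phi> (t * x)" by simp
  have \<beta>_notin: "\<beta> \<notin> range \<Phi>"
  proof
    assume "\<beta> \<in> range \<Phi>"
    then obtain d where "\<beta> = \<Phi> d" by blast
    then have "\<pi> = \<Phi> (b * d - t * x)" using pi by (simp add: Phi_mult Phi_diff)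
    then show False using pi_notin by blast
  qed
  \<comment> \<open>Its multiple by \<open>b\<close> lies in \<open>A\<close>, so saturation
    expresses \<open>\<alpha>\<close>, and with it all of \<open>E\<close>, through
    \<open>\<beta>\<close>.\<close>
  have "\<alpha> - \<Phi> y * \<beta> \<in> range \<Phi>"
  proof (rule tf[OF b])
    have "\<Phi> b * (\<alpha> - \<Phi> y * \<beta>) = \<Phi> b * \<alpha> - \<Phi> y * (\<Phi> b * \<beta>)"
      by (simp add: right_diff_distrib Phi_commute[of b y] flip: mult.assoc)
    also have "\<dots> = \<Phi> (x - y * (t * x))"
      unfolding xy b\<beta> by (simp add: distrib_left Phi_diff Phi_mult)
    finally show "\<Phi> b * (\<alpha> - \<Phi> y * \<beta>) = \<Phi> (x - y * (t * x))" .
  qed (intro E_diff E_mult Phi_in alpha_in \<beta>E)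
  then obtain k where k: "\<alpha> = \<Phi> y * \<beta> + \<Phi> k" by (auto simp: algebra_simps)
  have basis: "\<exists>r n. s = \<Phi> r * \<beta> + \<Phi> n" if "s \<in> E" for s
  proof -
    obtain y' c e where s: "s = \<Phi> y' * \<alpha> + (\<Phi> c + \<Phi> e * \<pi>)" using gen \<open>s \<in> E\<close> by blast
    have "s = \<Phi> (y' * y + e * b) * \<beta> + \<Phi> (y' * k + c - e * (t * x))"
      unfolding s
      by (subst pi, subst k, simp only: Phi_add Phi_diff Phi_mult distrib_left distrib_right right_diff_distrib mult.assoc)
         (simp add: algebra_simps)
    then show ?thesis by blast
  qed
  obtain r n where rn: "\<beta> * \<beta> = \<Phi> r * \<beta> + \<Phi> n" using basis[OF E_mult[OF \<beta>E \<beta>E]] by blast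
  define h where "h = a - 2 * (t * x)"
  define D where "D = \<Phi> 2 * \<pi> + \<Phi> a"
  have D: "D = \<Phi> (2 * b) * \<beta> + \<Phi> h"
    unfolding D_def h_def by (subst pi) (simp add: Phi_diff Phi_mult right_diff_distrib mult.assoc)
  have pp: "\<pi> * \<pi> = - (\<Phi> a * \<pi> + \<Phi> v)"
    using pi_quad by (metis add.assoc add_eq_0_iff2)
  have "D * D = \<Phi> (a * a - 4 * v)"
    unfolding D_def square_expand[OF pi_in] pp
    by (simp add: Phi_mult Phi_diff distrib_left right_diff_distrib mult.assoc)
  then have D2: "D * D = \<Phi> (b\<^sup>2 * \<delta>)" using disc by (simp add: power2_eq_square)
  define c1 c2 where "c1 = 2 * b * (2 * b)" and "c2 = 2 * (2 * b) * h"
  have "D * D = \<Phi> (c1 * r + c2) * \<beta> + \<Phi> (c1 * n + h * h)"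
    unfolding D square_expand[OF \<beta>E] rn c1_def[symmetric] c2_def[symmetric]
    by (simp add: Phi_mult Phi_add distrib_left distrib_right mult.assoc)
  then have "\<Phi> (c1 * r + c2) * \<beta> = \<Phi> (b\<^sup>2 * \<delta> - (c1 * n + h * h))"
    unfolding D2 by (simp add: Phi_diff)
  \<comment> \<open>Otherwise saturation would put \<open>\<beta>\<close> into \<open>A\<close>. As
    \<open>c1 r + c2 = 4 b (b r + h)\<close>, the constant \<open>h\<close> is a multiple of
    \<open>b\<close>, and so is \<open>2 \<pi> + a = 2 b \<beta> + h\<close>.\<close>
  then have "c1 * r + c2 = 0"
    using tf[OF _ \<beta>E] \<beta>_notin by blast
  moreover have "c1 * r + c2 = 2 * (2 * (b * (b * r + h)))"
    by (simp add: c1_def c2_def algebra_simps)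
  moreover have "(2 :: 'q poly) \<noteq> 0" using two by (simp add: numeral_poly)
  ultimately have "b * r + h = 0" using b by (metis mult_eq_0_iff)
  then have h: "h = - (b * r)" by (simp add: eq_neg_iff_add_eq_0 add.commute)
  have "D = \<Phi> b * (\<Phi> 2 * \<beta> - \<Phi> r)"
    unfolding D h by (simp add: Phi_mult Phi_minus right_diff_distrib Phi_commute[of 2] mult.assoc)
  moreover have "\<Phi> 2 * \<beta> - \<Phi> r \<in> E" by (intro E_diff E_mult Phi_in \<beta>E)
  ultimately show ?thesis unfolding D_def by blast
qed

end

section \<open>Twisted polynomials over an algebraic closure of the field of constants\<close>

text \<open>
  Since \<open>A/p\<close> embeds into the algebraic closure of the field of constants, twisted polynomials over
  this one field serve all primes \<open>p\<close>.
\<close>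

typedef (overloaded) 'q twisted = "UNIV :: 'q::{finite,field} alg_closure poly set"
  morphisms tw_coeffs Twisted ..

setup_lifting type_definition_twisted

instantiation twisted :: ("{finite,field}") ring_1_no_zero_divisors
begin

lift_definition zero_twisted :: "'a twisted" is 0 .
lift_definition one_twisted :: "'a twisted" is 1 .
lift_definition plus_twisted :: "'a twisted \<Rightarrow> 'a twisted \<Rightarrow> 'a twisted" is "(+)" .
lift_definition minus_twisted :: "'a twisted \<Rightarrow> 'a twisted \<Rightarrow> 'a twisted" is "(-)" .
lift_definition uminus_twisted :: "'a twisted \<Rightarrow> 'a twisted" is uminus .
lift_definition times_twisted :: "'a twisted \<Rightarrow> 'a twisted \<Rightarrow> 'a twisted" is "tw_mult CARD('a)" .

instance
proof
  have q: "CARD('a) > 0" by simp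
  fix x y z :: "'a twisted"
  show "x * y * z = x * (y * z)"
    by transfer (rule tw_mult_assoc[OF q frob_add_alg_closure])
  show "(x + y) * z = x * z + y * z"
    by transfer (rule tw_mult_add_left[OF q])
  show "x * (y + z) = x * y + x * z"
    by transfer (rule tw_mult_add_right[OF q frob_add_alg_closure])
  show "1 * x = x" "x * 1 = x"
    by (transfer, simp)+
  show "x + y + z = x + (y + z)" "x + y = y + x" "0 + x = x" "- x + x = 0" "x - y = x + - y"
    by (transfer, simp add: algebra_simps)+
  show "0 * x = 0" "x * 0 = 0"
    by (transfer, simp)+
  show "(0 :: 'a twisted) \<noteq> 1"
    by transfer simp
  show "x \<noteq> 0 \<Longrightarrow> y \<noteq> 0 \<Longrightarrow> x * y \<noteq> 0"
  proof transfer
    fix f g :: "'a alg_closure poly"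
    assume "f \<noteq> 0" "g \<noteq> 0"
    then have "coeff (tw_mult CARD('a) f g) (degree f + degree g) \<noteq> 0"
      by (simp add: coeff_tw_mult_degree_sum[OF q])
    then show "tw_mult CARD('a) f g \<noteq> 0" by auto
  qed
qed

end

lemma degree_tw_mult_field:
  fixes f g :: "'a::field poly"
  assumes "q > 0" "f \<noteq> 0" "g \<noteq> 0"
  shows "degree (tw_mult q f g) = degree f + degree g"
proof (rule antisym)
  have "coeff (tw_mult q f g) (degree f + degree g) \<noteq> 0"
    using assms by (simp add: coeff_tw_mult_degree_sum)
  then show "degree f + degree g \<le> degree (tw_mult q f g)" by (rule le_degree)
qed (use assms degree_tw_mult_le in blast)

text \<open>The set \<open>S\<close> is closed like a subfield, so quotient and remainder keep their
  coefficients in the residue field although the ambient field is its algebraic closure.\<close>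

lemma tw_division:
  fixes f g :: "'a::field poly" and S :: "'a set"
  assumes q: "q > 0" and g: "g \<noteq> 0" and deg: "degree g > 0"
    and S: "0 \<in> S" "1 \<in> S" "\<And>x y. x \<in> S \<Longrightarrow> y \<in> S \<Longrightarrow> x + y \<in> S" "\<And>x y. x \<in> S \<Longrightarrow> y \<in> S \<Longrightarrow> x * y \<in> S"
      "\<And>x. x \<in> S \<Longrightarrow> - x \<in> S" "\<And>x. x \<in> S \<Longrightarrow> inverse x \<in> S"
    and "\<And>i. coeff f i \<in> S" and gS: "\<And>i. coeff g i \<in> S"
  shows "\<exists>e r. f = tw_mult q e g + r \<and> degree r < degree g \<and> (\<forall>i. coeff e i \<in> S) \<and> (\<forall>i. coeff r i \<in> S)"
  using assms(10)
proof (induction "degree f" arbitrary: f rule: less_induct)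
  case less
  show ?case
  proof (cases "degree f < degree g")
    case True
    then show ?thesis
      using less.prems S q by (intro exI[of _ 0] exI[of _ f]) auto
  next
    case False
    define k where "k = degree f - degree g"
    \<comment> \<open>The product of \<open>monom c k\<close> and \<open>g\<close> has top
      coefficient \<open>c * lead_coeff g ^ (q ^ k)\<close>, so this \<open>c\<close> cancels the
      top term of \<open>f\<close>.\<close>
    define c where "c = lead_coeff f * inverse (lead_coeff g ^ (q ^ k))"
    have Spow: "x ^ n \<in> S" if "x \<in> S" for x n
      using that by (induction n) (auto intro: S)
    have cS: "c \<in> S" unfolding c_def by (intro S Spow less.prems gS)
    define t where "t = tw_mult q (monom c k) g"
    have tS: "coeff t i \<in> S" for i
      unfolding t_def by (rule tw_mult_closed[OF q]) (auto intro: S gS cS)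
    have deg_t: "degree t \<le> degree f"
    proof -
      have "degree t \<le> degree (monom c k) + degree g" unfolding t_def by (rule degree_tw_mult_le[OF q])
      also have "\<dots> \<le> k + degree g" by (simp add: degree_monom_le)
      finally show ?thesis using False by (simp add: k_def)
    qed
    have "coeff t (k + degree g) = c * lead_coeff g ^ (q ^ k)"
      unfolding t_def by (subst coeff_tw_mult_degree_sum[OF q]) (auto simp: degree_monom_le)
    also have "\<dots> = lead_coeff f" using g by (simp add: c_def)
    finally have lead: "coeff t (degree f) = lead_coeff f" using False by (simp add: k_def)
    have "degree (f - t) \<le> degree f" using deg_t by (simp add: degree_diff_le)
    moreover have "degree f > 0" using False deg by simp
    ultimately have less_deg: "degree (f - t) < degree f"
      using lead by (metis coeff_diff right_minus_eq le_neq_implies_less leading_coeff_0_iff degree_0)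
    have "coeff (f - t) i \<in> S" for i
      using S(3)[OF less.prems S(5)[OF tS]] by (simp add: coeff_diff)
    from less.hyps[OF less_deg this] obtain e r where er: "f - t = tw_mult q e g + r"
      "degree r < degree g" "\<And>i. coeff e i \<in> S" "\<And>i. coeff r i \<in> S" by blast
    have "f = tw_mult q (e + monom c k) g + r"
      using er(1) by (simp add: tw_mult_add_left[OF q] t_def algebra_simps)
    moreover have "coeff (e + monom c k) i \<in> S" for i
      by (auto intro!: S er cS)
    ultimately show ?thesis using er by blast
  qed
qed

text \<open>Reduction is a ring homomorphism on the p-integral fractions only, hence the subring
  \<open>S\<close> containing all coefficients.\<close>

lemma map_poly_tw_mult:
  fixes h :: "'a::comm_ring_1 \<Rightarrow> 'b::comm_ring_1"
  assumes q: "q > 0"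
    and S: "0 \<in> S" "1 \<in> S" "\<And>x y. x \<in> S \<Longrightarrow> y \<in> S \<Longrightarrow> x + y \<in> S" "\<And>x y. x \<in> S \<Longrightarrow> y \<in> S \<Longrightarrow> x * y \<in> S"
    and h: "h 0 = 0" "h 1 = 1" "\<And>x y. x \<in> S \<Longrightarrow> y \<in> S \<Longrightarrow> h (x + y) = h x + h y"
      "\<And>x y. x \<in> S \<Longrightarrow> y \<in> S \<Longrightarrow> h (x * y) = h x * h y"
    and fS: "\<And>i. coeff f i \<in> S" and gS: "\<And>i. coeff g i \<in> S"
  shows "map_poly h (tw_mult q f g) = tw_mult q (map_poly h f) (map_poly h g)"
proof (rule poly_eqI)
  fix n
  have pow: "x ^ k \<in> S \<and> h (x ^ k) = h x ^ k" if "x \<in> S" for x k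
    using that by (induction k) (auto intro: S simp: h)
  have sm: "sum F A \<in> S \<and> h (sum F A) = (\<Sum>x\<in>A. h (F x))" if "\<And>x. F x \<in> S" for F :: "nat \<Rightarrow> 'a" and A
    using that by (induction A rule: infinite_finite_induct) (auto intro: S simp: h)
  have term_S: "(if i + j = n then coeff f i * coeff g j ^ (q ^ i) else 0) \<in> S" for i j
    using pow[OF gS] by (auto intro!: S fS)
  have "coeff (map_poly h (tw_mult q f g)) n =
      h (\<Sum>i\<le>degree f. \<Sum>j\<le>degree g. if i + j = n then coeff f i * coeff g j ^ (q ^ i) else 0)"
    by (simp add: coeff_map_poly h tw_mult_def coeff_sum)
  also have "\<dots> = (\<Sum>i\<le>degree f. \<Sum>j\<le>degree g. if i + j = n then h (coeff f i) * h (coeff g j) ^ (q ^ i) else 0)"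
    using sm term_S by (simp add: if_distrib[of h] h pow fS gS cong: if_cong)
  also have "\<dots> = coeff (tw_mult q (map_poly h f) (map_poly h g)) n"
    by (simp add: tw_mult_bounds[OF q degree_map_poly_le degree_map_poly_le] coeff_sum coeff_map_poly h)
  finally show "coeff (map_poly h (tw_mult q f g)) n = coeff (tw_mult q (map_poly h f) (map_poly h g)) n" .
qed

section \<open>The residue field at a prime\<close>

lemma emb_0 [simp]: "emb 0 = 0" and emb_1 [simp]: "emb 1 = 1"
  and emb_add: "emb (a + b) = emb a + emb b"
  and emb_mult: "emb (a * b) = emb a * emb b"
  and emb_diff: "emb (a - b) = emb a - emb b"
  and emb_minus: "emb (- a) = - emb a"
  by (simp_all add: emb_def)

lemma emb_power: "emb (a ^ n) = emb a ^ n"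
  by (induction n) (simp_all add: emb_mult)

lemma emb_eq_0_iff [simp]: "emb a = 0 \<longleftrightarrow> a = 0"
  by (simp add: emb_def)

lemma to_ac_Fract: "s \<noteq> 0 \<Longrightarrow> to_ac (Fract a s) = emb a / emb s"
  by (simp add: emb_def Fract_conv_to_fract)

text \<open>Sending \<open>T\<close> to a root \<open>\<zeta>\<close> of \<open>p\<close> embeds
  \<open>A/pA\<close> into the algebraic closure of the constants.\<close>

locale residue_prime =
  fixes p :: "'q::{finite,field} poly" and \<zeta> :: "'q alg_closure"
  assumes irr: "irreducible p" and root: "poly (map_poly to_ac p) \<zeta> = 0"
begin

definition ev :: "'q poly \<Rightarrow> 'q alg_closure" where
  "ev a = poly (map_poly to_ac a) \<zeta>"

lemma p_nonzero [simp]: "p \<noteq> 0" using irr by auto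

lemma p_not_unit: "\<not> is_unit p" using irr by (rule irreducible_not_unit)

lemma p_dvd_mult: "p dvd a * b \<longleftrightarrow> p dvd a \<or> p dvd b"
  using irreducible_poly_dvd_mult[OF irr] by auto

lemma not_p_dvd_1 [simp]: "\<not> p dvd 1" by (rule p_not_unit)

lemma ev_pCons [simp]: "ev (pCons c a) = to_ac c + \<zeta> * ev a"
  by (simp add: ev_def Polynomial.map_poly_pCons)

lemma ev_0 [simp]: "ev 0 = 0" by (simp add: ev_def)

lemma ev_1 [simp]: "ev 1 = 1" by (simp add: one_pCons)

lemma ev_add: "ev (a + b) = ev a + ev b"
proof (induction a arbitrary: b)
  case (pCons c a)
  show ?case by (cases b, simp add: pCons.IH) (simp add: algebra_simps)
qed simp

lemma ev_smult: "ev (Polynomial.smult c a) = to_ac c * ev a"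
  by (induction a) (simp_all add: algebra_simps)

lemma ev_mult: "ev (a * b) = ev a * ev b"
  by (induction a) (simp_all add: ev_add ev_smult algebra_simps)

lemma ev_minus: "ev (- a) = - ev a"
  using ev_add[of a "- a"] by (simp add: eq_neg_iff_add_eq_0 add.commute)

lemma ev_diff: "ev (a - b) = ev a - ev b"
  using ev_add[of a "- b"] by (simp add: ev_minus)

lemma ev_p [simp]: "ev p = 0" using root by (simp add: ev_def)

lemma ev_inverse_ex: "\<not> p dvd a \<Longrightarrow> \<exists>b. ev a * ev b = 1"
proof -
  assume "\<not> p dvd a"
  then obtain s t where "s * p + t * a = 1"
    using coprime_poly_bezout[OF irreducible_poly_coprime[OF irr]] by blast
  then have "ev (s * p + t * a) = 1" by simp
  then show ?thesis by (auto simp: ev_add ev_mult mult.commute)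
qed

lemma ev_eq_0_iff: "ev a = 0 \<longleftrightarrow> p dvd a"
proof
  show "ev a = 0 \<Longrightarrow> p dvd a" using ev_inverse_ex[of a] by auto
qed (auto simp: ev_mult)

lemma ev_eq_iff: "ev a = ev b \<longleftrightarrow> p dvd a - b"
  using ev_eq_0_iff[of "a - b"] by (simp add: ev_diff)

lemma ev_mod [simp]: "ev (a mod p) = ev a"
  by (simp add: ev_eq_iff mod_eq_dvd_iff[symmetric])

lemma inverse_range_ev: "x \<in> range ev \<Longrightarrow> inverse x \<in> range ev"
proof (cases "x = 0")
  case True
  then show ?thesis using ev_0 by (metis inverse_zero rangeI)
next
  case False
  assume "x \<in> range ev"
  then obtain a where a: "x = ev a" by blast
  then obtain b where "ev a * ev b = 1" using ev_inverse_ex[of a] False by (auto simp: ev_eq_0_iff)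
  then have "inverse x = ev b" unfolding a by (rule inverse_unique)
  then show ?thesis by blast
qed

text \<open>\<open>residue\<close> is a definite description, so its value must not depend on the
  chosen fraction; this is seen by comparing values at \<open>\<zeta>\<close>.\<close>

lemma residue_Fract:
  assumes "\<not> p dvd s"
  shows "residue p (Fract a s) mod p = residue p (Fract a s)" "ev s * ev (residue p (Fract a s)) = ev a"
proof -
  have s: "s \<noteq> 0" using assms by auto
  obtain t where t: "ev s * ev t = 1" using ev_inverse_ex assms by blast
  define c where "c = (t * a) mod p"
  have ex: "c mod p = c \<and> (\<exists>a' s'. \<not> p dvd s' \<and> Fract a s = Fract a' s' \<and> p dvd s' * c - a')"
  proof (intro conjI exI)
    have "ev (s * c) = ev a"
      unfolding c_def by (simp add: ev_mult) (metis t mult.assoc mult_1)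
    then show "p dvd s * c - a" by (simp add: ev_eq_iff)
  qed (use assms in \<open>auto simp: c_def\<close>)
  have uniq: "d = c" if d: "d mod p = d \<and> (\<exists>a' s'. \<not> p dvd s' \<and> Fract a s = Fract a' s' \<and> p dvd s' * d - a')" for d
  proof -
    obtain a' s' where *: "\<not> p dvd s'" "Fract a s = Fract a' s'" "p dvd s' * d - a'" using d by blast
    have s': "s' \<noteq> 0" using * by auto
    have "a * s' = a' * s" using *(2) s s' by (simp add: eq_fract)
    then have as: "ev a * ev s' = ev a' * ev s" by (metis ev_mult)
    have "ev s' * ev d = ev a'" using *(3) by (simp add: ev_eq_iff flip: ev_mult)
    moreover have "ev s' * ev c = ev a'"
    proof -
      have "ev s' * ev c = ev t * (ev a * ev s')" by (simp add: c_def ev_mult mult_ac)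
      also have "\<dots> = ev a' * (ev s * ev t)" unfolding as by (simp add: mult_ac)
      finally show ?thesis unfolding t by simp
    qed
    moreover have "ev s' \<noteq> 0" using *(1) by (simp add: ev_eq_0_iff)
    ultimately have "ev d = ev c" by (metis mult_left_cancel)
    then have "d mod p = c mod p" by (simp add: ev_eq_iff mod_eq_dvd_iff)
    then show ?thesis using d ex by metis
  qed
  have "residue p (Fract a s) = c"
    unfolding residue_def by (rule the_equality, rule ex, rule uniq)
  then show "residue p (Fract a s) mod p = residue p (Fract a s)" "ev s * ev (residue p (Fract a s)) = ev a"
    using t by (auto simp: c_def ev_mult mult.assoc[symmetric])
qed

text \<open>The reduced representatives \<open>residue p x\<close> do not multiply as polynomials;
  followed by evaluation at \<open>\<zeta>\<close> they give a ring homomorphism on the p-integral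
  fractions.\<close>

definition \<rho> :: "'q ratfun \<Rightarrow> 'q alg_closure" where
  "\<rho> x = ev (residue p x)"

lemma rho_Fract: "\<not> p dvd s \<Longrightarrow> \<rho> (Fract a s) = ev a / ev s"
  using residue_Fract(2)[of s a] by (simp add: \<rho>_def field_simps ev_eq_0_iff)

lemma residue_mod: "integral_at p x \<Longrightarrow> residue p x mod p = residue p x"
  by (auto simp: integral_at_def residue_Fract)

lemma integral_at_to_fract [simp]: "integral_at p (to_fract a)"
  unfolding integral_at_def to_fract_def using not_p_dvd_1 by blast

lemma integral_at_0 [simp]: "integral_at p 0" and integral_at_1 [simp]: "integral_at p 1"
  using integral_at_to_fract[of 0] integral_at_to_fract[of 1] by simp_all

lemma rho_to_fract [simp]: "\<rho> (to_fract a) = ev a"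
  using rho_Fract[OF not_p_dvd_1, of a] by (simp add: to_fract_def)

lemma rho_0 [simp]: "\<rho> 0 = 0" and rho_1 [simp]: "\<rho> 1 = 1"
  using rho_to_fract[of 0] rho_to_fract[of 1] by simp_all

lemma residue_0 [simp]: "residue p 0 = 0"
proof -
  have "ev (residue p 0) = 0" using rho_0 by (simp add: \<rho>_def)
  then have "residue p 0 mod p = 0" by (simp add: ev_eq_0_iff mod_eq_0_iff_dvd)
  then show ?thesis using residue_mod[of 0] by simp
qed

lemma integral_at_add: "integral_at p x \<Longrightarrow> integral_at p y \<Longrightarrow> integral_at p (x + y)"
  and rho_add: "integral_at p x \<Longrightarrow> integral_at p y \<Longrightarrow> \<rho> (x + y) = \<rho> x + \<rho> y"
  and integral_at_mult: "integral_at p x \<Longrightarrow> integral_at p y \<Longrightarrow> integral_at p (x * y)"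
  and rho_mult: "integral_at p x \<Longrightarrow> integral_at p y \<Longrightarrow> \<rho> (x * y) = \<rho> x * \<rho> y"
proof -
  assume "integral_at p x" "integral_at p y"
  then obtain a s b t where *: "\<not> p dvd s" "x = Fract a s" "\<not> p dvd t" "y = Fract b t"
    unfolding integral_at_def by blast
  have ne: "s \<noteq> 0" "t \<noteq> 0" using * by auto
  have st: "\<not> p dvd s * t" using * by (simp add: p_dvd_mult)
  have sum: "x + y = Fract (a * t + b * s) (s * t)" and prod: "x * y = Fract (a * b) (s * t)"
    using * ne by simp_all
  show "integral_at p (x + y)" "integral_at p (x * y)"
    unfolding integral_at_def using sum prod st by blast+
  show "\<rho> (x + y) = \<rho> x + \<rho> y" "\<rho> (x * y) = \<rho> x * \<rho> y"
  proof -
    have "\<rho> (x + y) = ev (a * t + b * s) / ev (s * t)" "\<rho> (x * y) = ev (a * b) / ev (s * t)"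
      unfolding sum prod by (rule rho_Fract[OF st])+
    moreover have "\<rho> x = ev a / ev s" "\<rho> y = ev b / ev t"
      unfolding *(2,4) by (rule rho_Fract[OF *(1)], rule rho_Fract[OF *(3)])
    moreover have "ev s \<noteq> 0" "ev t \<noteq> 0" using * by (simp_all add: ev_eq_0_iff)
    ultimately show "\<rho> (x + y) = \<rho> x + \<rho> y" "\<rho> (x * y) = \<rho> x * \<rho> y"
      by (simp_all add: ev_add ev_mult add_frac_eq)
  qed
qed

lemma integral_at_power: "integral_at p x \<Longrightarrow> integral_at p (x ^ n)"
  by (induction n) (auto intro: integral_at_mult)

lemma unit_at_iff: "unit_at p x \<longleftrightarrow> integral_at p x \<and> \<rho> x \<noteq> 0"
  by (auto simp: unit_at_def integral_at_def rho_Fract ev_eq_0_iff)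

lemma unit_at_imp_integral_inverse: "unit_at p x \<Longrightarrow> integral_at p (inverse x)"
  unfolding unit_at_def integral_at_def by (metis inverse_fract)

lemma common_denominator:
  fixes n :: nat
  assumes "\<And>i. i \<le> n \<Longrightarrow> integral_at p (c i)"
  shows "\<exists>s a. \<not> p dvd s \<and> (\<forall>i\<le>n. to_fract s * c i = to_fract (a i))"
  using assms
proof (induction n)
  case 0
  then obtain a s where "\<not> p dvd s" "c 0 = Fract a s" by (auto simp: integral_at_def)
  moreover then have "s \<noteq> 0" by auto
  ultimately show ?case
    by (intro exI[of _ s] exI[of _ "\<lambda>_. a"]) (simp add: Fract_conv_to_fract)
next
  case (Suc n)
  then obtain s a where sa: "\<not> p dvd s" "\<And>i. i \<le> n \<Longrightarrow> to_fract s * c i = to_fract (a i)"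
    by (metis le_SucI)
  obtain b t where bt: "\<not> p dvd t" "c (Suc n) = Fract b t"
    using Suc.prems[of "Suc n"] by (auto simp: integral_at_def)
  then have t: "t \<noteq> 0" by auto
  show ?case
  proof (intro exI conjI allI impI)
    show "\<not> p dvd s * t" using sa bt by (simp add: p_dvd_mult)
    fix i assume "i \<le> Suc n"
    then consider "i \<le> n" | "i = Suc n" by linarith
    then show "to_fract (s * t) * c i = to_fract ((\<lambda>i. if i \<le> n then t * a i else s * b) i)"
    proof cases
      case 1
      then show ?thesis using sa(2)[of i] by (simp add: mult.assoc mult.left_commute[of "to_fract s"])
    next
      case 2
      then show ?thesis using bt t by (simp add: Fract_conv_to_fract)
    qed
  qed
qed

end

section \<open>Reduction modulo a prime of the integral closure\<close>

lemma poly_map_poly_to_ac_pcompose: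
  fixes f g :: "'a::field poly"
  shows "poly (map_poly to_ac (f \<circ>\<^sub>p g)) x = poly (map_poly to_ac f) (poly (map_poly to_ac g) x)"
proof -
  have add: "poly (map_poly to_ac (f + g)) x = poly (map_poly to_ac f) x + poly (map_poly to_ac g) x" for f g :: "'a poly"
    by (induction f g rule: poly_induct2) (simp_all add: Polynomial.map_poly_pCons algebra_simps)
  have smult: "poly (map_poly to_ac (Polynomial.smult c f)) x = to_ac c * poly (map_poly to_ac f) x" for f :: "'a poly" and c
    by (induction f) (simp_all add: Polynomial.map_poly_pCons algebra_simps)
  have mult: "poly (map_poly to_ac (f * g)) x = poly (map_poly to_ac f) x * poly (map_poly to_ac g) x" for f g :: "'a poly"
    by (induction f) (simp_all add: Polynomial.map_poly_pCons add smult algebra_simps)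
  show ?thesis
    by (induction f) (simp_all add: Polynomial.map_poly_pCons pcompose_pCons add mult)
qed

text \<open>Substituting \<open>c X\<close> for \<open>X\<close> preserves a Bezout relation between
  \<open>f\<close> and its derivative, up to the constant \<open>c\<close>. It serves to pass from
  an integral multiple \<open>s x\<close> back to \<open>x\<close>.\<close>

lemma sep_closure_scale:
  fixes z :: "'q::{finite,field} closure"
  assumes "to_ac c * z \<in> sep_closure" "c \<noteq> 0"
  shows "z \<in> sep_closure"
proof -
  obtain f :: "'q ratfun poly" where f: "coprime f (pderiv f)" "poly (map_poly to_ac f) (to_ac c * z) = 0"
    using assms(1) by (auto simp: sep_closure_def)
  define g where "g = f \<circ>\<^sub>p [:0, c:]"
  obtain s t where "s * f + t * pderiv f = 1" using coprime_poly_bezout[OF f(1)] by blast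
  then have "(s * f + t * pderiv f) \<circ>\<^sub>p [:0, c:] = 1 \<circ>\<^sub>p [:0, c:]" by simp
  then have "(s \<circ>\<^sub>p [:0, c:]) * g + (t \<circ>\<^sub>p [:0, c:]) * (pderiv f \<circ>\<^sub>p [:0, c:]) = 1"
    by (simp add: pcompose_add pcompose_mult g_def)
  moreover have "pderiv f \<circ>\<^sub>p [:0, c:] = Polynomial.smult (inverse c) (pderiv g)"
    using assms(2) by (simp add: g_def pderiv_pcompose pderiv_pCons)
  ultimately have bez: "(s \<circ>\<^sub>p [:0, c:]) * g + Polynomial.smult (inverse c) (t \<circ>\<^sub>p [:0, c:]) * pderiv g = 1"
    by simp
  have "coprime g (pderiv g)"
  proof (rule coprimeI)
    fix d assume "d dvd g" "d dvd pderiv g"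
    then have "d dvd (s \<circ>\<^sub>p [:0, c:]) * g + Polynomial.smult (inverse c) (t \<circ>\<^sub>p [:0, c:]) * pderiv g"
      by (intro dvd_add dvd_mult)
    then show "is_unit d" unfolding bez .
  qed
  moreover have "poly (map_poly to_ac g) z = 0"
    using f(2) unfolding g_def poly_map_poly_to_ac_pcompose
    by (simp add: Polynomial.map_poly_pCons mult.commute)
  ultimately show ?thesis unfolding sep_closure_def by blast
qed

lemma to_ac_in_sep_closure: "to_ac c \<in> (sep_closure :: 'q::{finite,field} closure set)"
proof -
  have "coprime [:- c, 1:] (pderiv [:- c, 1:])"
    by (simp add: pderiv_pCons is_unit_right_imp_coprime)
  moreover have "poly (map_poly to_ac [:- c, 1:]) (to_ac c) = 0"
    by (simp add: Polynomial.map_poly_pCons)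
  ultimately show ?thesis unfolding sep_closure_def by blast
qed

lemma emb_in_integral_closure: "emb a \<in> integral_closure"
proof -
  have "poly (map_poly emb [:- a, 1:]) (emb a) = 0" "lead_coeff [:- a, 1:] = 1"
    by (simp_all add: Polynomial.map_poly_pCons emb_minus)
  moreover have "emb a \<in> sep_closure" by (simp add: emb_def to_ac_in_sep_closure)
  ultimately show ?thesis
    unfolding integral_closure_def by blast
qed

locale frobenius_place = residue_prime p \<zeta>
  for p :: "'q::{finite,field} poly" and \<zeta> +
  fixes Q :: "'q closure set" and \<sigma> :: "'q closure \<Rightarrow> 'q closure"
  assumes prime_Q: "primeideal Q (ring_of_type_algebra\<lparr>carrier := integral_closure\<rparr>)"
    and Q_emb: "{a. emb a \<in> Q} = {a. p dvd a}"
    and sigma: "\<sigma> \<in> abs_galois"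
    and frob: "\<forall>x\<in>integral_closure. \<sigma> x - x ^ (CARD('q) ^ degree p) \<in> Q"
begin

abbreviation (input) \<O> :: "'q closure set" where "\<O> \<equiv> integral_closure"

lemma O_add: "x \<in> \<O> \<Longrightarrow> y \<in> \<O> \<Longrightarrow> x + y \<in> \<O>"
  and O_mult: "x \<in> \<O> \<Longrightarrow> y \<in> \<O> \<Longrightarrow> x * y \<in> \<O>"
  and Q_subset: "x \<in> Q \<Longrightarrow> x \<in> \<O>"
  and Q_add: "x \<in> Q \<Longrightarrow> y \<in> Q \<Longrightarrow> x + y \<in> Q"
  and Q_mult: "x \<in> Q \<Longrightarrow> y \<in> \<O> \<Longrightarrow> y * x \<in> Q"
  and Q_prime: "x \<in> \<O> \<Longrightarrow> y \<in> \<O> \<Longrightarrow> x * y \<in> Q \<Longrightarrow> x \<in> Q \<or> y \<in> Q"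
proof -
  interpret primeideal Q "ring_of_type_algebra\<lparr>carrier := \<O>\<rparr>" by (rule prime_Q)
  show "x \<in> \<O> \<Longrightarrow> y \<in> \<O> \<Longrightarrow> x + y \<in> \<O>"
    using a_closed[of x y] by (simp add: ring_of_type_algebra_def)
  show "x \<in> \<O> \<Longrightarrow> y \<in> \<O> \<Longrightarrow> x * y \<in> \<O>"
    using m_closed[of x y] by (simp add: ring_of_type_algebra_def)
  show "x \<in> Q \<Longrightarrow> x \<in> \<O>"
    using a_subset by (auto simp: ring_of_type_algebra_def)
  show "x \<in> Q \<Longrightarrow> y \<in> Q \<Longrightarrow> x + y \<in> Q"
    using a_closed[of x y] additive_subgroup.a_closed[OF is_additive_subgroup, of x y] by (simp add: ring_of_type_algebra_def)
  show "x \<in> Q \<Longrightarrow> y \<in> \<O> \<Longrightarrow> y * x \<in> Q"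
    using I_l_closed[of x y] by (simp add: ring_of_type_algebra_def)
  show "x \<in> \<O> \<Longrightarrow> y \<in> \<O> \<Longrightarrow> x * y \<in> Q \<Longrightarrow> x \<in> Q \<or> y \<in> Q"
    using I_prime[of x y] by (simp add: ring_of_type_algebra_def)
qed

lemma emb_in_Q_iff: "emb a \<in> Q \<longleftrightarrow> p dvd a"
  using Q_emb by blast

text \<open>
  Torsion points of a good model are integral over \<open>A\<close> only up to a denominator prime to \<open>p\<close>, hence
  the localisations of \<open>\<O>\<close> and \<open>Q\<close>.
\<close>

definition Op :: "'q closure \<Rightarrow> bool" where
  "Op x \<longleftrightarrow> (\<exists>s. \<not> p dvd s \<and> emb s * x \<in> \<O>)"

definition Qp :: "'q closure \<Rightarrow> bool" where
  "Qp x \<longleftrightarrow> (\<exists>s. \<not> p dvd s \<and> emb s * x \<in> Q)"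

lemma Op_mult: assumes "Op x" "Op y" shows "Op (x * y)"
proof -
  obtain s t where st: "\<not> p dvd s" "emb s * x \<in> \<O>" "\<not> p dvd t" "emb t * y \<in> \<O>"
    using assms unfolding Op_def by blast
  have eq: "emb (s * t) * (x * y) = (emb s * x) * (emb t * y)" by (simp add: emb_mult mult_ac)
  have "emb (s * t) * (x * y) \<in> \<O>" unfolding eq by (intro O_mult st)
  moreover have "\<not> p dvd s * t" using st by (simp add: p_dvd_mult)
  ultimately show ?thesis unfolding Op_def by blast
qed

lemma Op_add: assumes "Op x" "Op y" shows "Op (x + y)"
proof -
  obtain s t where st: "\<not> p dvd s" "emb s * x \<in> \<O>" "\<not> p dvd t" "emb t * y \<in> \<O>"
    using assms unfolding Op_def by blast
  have "emb (s * t) * (x + y) = emb t * (emb s * x) + emb s * (emb t * y)"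
    by (simp add: emb_mult algebra_simps)
  then have "emb (s * t) * (x + y) \<in> \<O>"
    using O_add O_mult emb_in_integral_closure st by metis
  moreover have "\<not> p dvd s * t" using st by (simp add: p_dvd_mult)
  ultimately show ?thesis unfolding Op_def by blast
qed

lemma Op_emb [simp]: "Op (emb a)"
  unfolding Op_def using emb_in_integral_closure[of "1 * a"] not_p_dvd_1 by (metis emb_mult)

lemma Op_0 [simp]: "Op 0" and Op_1 [simp]: "Op 1"
  using Op_emb[of 0] Op_emb[of 1] by simp_all

lemma Op_minus: "Op x \<Longrightarrow> Op (- x)"
  using Op_mult[OF Op_emb[of "- 1"], of x] by (simp add: emb_minus)

lemma Op_diff: "Op x \<Longrightarrow> Op y \<Longrightarrow> Op (x - y)"
  using Op_add[of x "- y"] Op_minus by simp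

lemma Op_power: "Op x \<Longrightarrow> Op (x ^ n)"
  by (induction n) (auto intro: Op_mult)

lemma Op_sum: "(\<And>i. i \<in> A \<Longrightarrow> Op (f i)) \<Longrightarrow> Op (sum f A)"
  by (induction A rule: infinite_finite_induct) (auto intro: Op_add)

lemma Qp_mult: assumes "Qp x" "Op y" shows "Qp (y * x)"
proof -
  obtain s t where st: "\<not> p dvd s" "emb s * x \<in> Q" "\<not> p dvd t" "emb t * y \<in> \<O>"
    using assms unfolding Op_def Qp_def by blast
  have eq: "emb (s * t) * (y * x) = (emb t * y) * (emb s * x)" by (simp add: emb_mult mult_ac)
  have "emb (s * t) * (y * x) \<in> Q" unfolding eq by (intro Q_mult st)
  moreover have "\<not> p dvd s * t" using st by (simp add: p_dvd_mult)
  ultimately show ?thesis unfolding Qp_def by blast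
qed

lemma Qp_mult_right: "Qp x \<Longrightarrow> Op y \<Longrightarrow> Qp (x * y)"
  using Qp_mult[of x y] by (simp add: mult.commute)

lemma Qp_add: assumes "Qp x" "Qp y" shows "Qp (x + y)"
proof -
  obtain s t where st: "\<not> p dvd s" "emb s * x \<in> Q" "\<not> p dvd t" "emb t * y \<in> Q"
    using assms unfolding Qp_def by blast
  have "emb (s * t) * (x + y) = emb t * (emb s * x) + emb s * (emb t * y)"
    by (simp add: emb_mult algebra_simps)
  then have "emb (s * t) * (x + y) \<in> Q"
    using Q_add Q_mult emb_in_integral_closure st by metis
  moreover have "\<not> p dvd s * t" using st by (simp add: p_dvd_mult)
  ultimately show ?thesis unfolding Qp_def by blast
qed

lemma Qp_minus: "Qp x \<Longrightarrow> Qp (- x)"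
  using Qp_mult[OF _ Op_emb[of "- 1"], of x] by (simp add: emb_minus)

lemma Qp_diff: "Qp x \<Longrightarrow> Qp y \<Longrightarrow> Qp (x - y)"
  using Qp_add[of x "- y"] Qp_minus by simp

lemma Qp_sum: "(\<And>i. i \<in> A \<Longrightarrow> Qp (f i)) \<Longrightarrow> Qp 0 \<Longrightarrow> Qp (sum f A)"
  by (induction A rule: infinite_finite_induct) (auto intro: Qp_add)

lemma Qp_cancel: "\<not> p dvd s \<Longrightarrow> Qp (emb s * x) \<Longrightarrow> Qp x"
  unfolding Qp_def by (metis emb_mult mult.assoc p_dvd_mult)

lemma Op_cancel: "\<not> p dvd s \<Longrightarrow> Op (emb s * x) \<Longrightarrow> Op x"
  unfolding Op_def by (metis emb_mult mult.assoc p_dvd_mult)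

lemma Qp_emb_iff [simp]: "Qp (emb a) \<longleftrightarrow> p dvd a"
proof
  assume "Qp (emb a)"
  then obtain s where "\<not> p dvd s" "emb (s * a) \<in> Q" by (auto simp: Qp_def emb_mult)
  then show "p dvd a" by (simp add: emb_in_Q_iff p_dvd_mult)
next
  assume "p dvd a"
  then have "emb (1 * a) \<in> Q" by (simp add: emb_in_Q_iff)
  then show "Qp (emb a)" unfolding Qp_def using not_p_dvd_1 by (metis emb_mult)
qed

lemma Qp_0 [simp]: "Qp 0"
  using Qp_emb_iff[of 0] by simp

lemma Qp_prime: assumes "Op x" "Op y" "Qp (x * y)" shows "Qp x \<or> Qp y"
proof -
  obtain s t r where st: "\<not> p dvd s" "emb s * x \<in> \<O>" "\<not> p dvd t" "emb t * y \<in> \<O>"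
    "\<not> p dvd r" "emb r * (x * y) \<in> Q"
    using assms unfolding Op_def Qp_def by blast
  have "emb (s * t) * (emb r * (x * y)) = (emb (s * r) * x) * (emb t * y)" by (simp add: emb_mult mult_ac)
  moreover have "emb (s * t) * (emb r * (x * y)) \<in> Q" by (intro Q_mult st emb_in_integral_closure)
  moreover have "emb (s * r) * x \<in> \<O>"
    using O_mult[OF emb_in_integral_closure[of r] st(2)] by (simp add: emb_mult mult_ac)
  ultimately have "emb (s * r) * x \<in> Q \<or> emb t * y \<in> Q" using Q_prime st(4) by metis
  moreover have "\<not> p dvd s * r" using st by (simp add: p_dvd_mult)
  ultimately show ?thesis unfolding Qp_def using st(3) by blast
qed

lemma Qp_power_diff: assumes "Op x" "Op y" "Qp (x - y)" shows "Qp (x ^ n - y ^ n)"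
proof (induction n)
  case (Suc n)
  have "x ^ Suc n - y ^ Suc n = x * (x ^ n - y ^ n) + (x - y) * y ^ n" by (simp add: algebra_simps)
  then show ?case
    using Qp_add[OF Qp_mult[OF Suc assms(1)] Qp_mult_right[OF assms(3) Op_power[OF assms(2)]]] by simp
qed simp

lemma Op_to_ac: "integral_at p x \<Longrightarrow> Op (to_ac x)"
  and Qp_residue: "integral_at p x \<Longrightarrow> Qp (to_ac x - emb (residue p x))"
proof -
  assume "integral_at p x"
  then obtain a s where as: "\<not> p dvd s" "x = Fract a s" unfolding integral_at_def by blast
  then have s: "s \<noteq> 0" by auto
  have eq: "emb s * to_ac x = emb a" using s as(2) by (simp add: to_ac_Fract)
  show "Op (to_ac x)" by (rule Op_cancel[OF as(1)]) (simp add: eq)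
  have "p dvd a - s * residue p x"
    using residue_Fract(2)[OF as(1), of a] as(2) by (subst dvd_diff_commute) (simp add: ev_eq_iff flip: ev_mult)
  then have "Qp (emb (a - s * residue p x))" by simp
  also have "emb (a - s * residue p x) = emb s * (to_ac x - emb (residue p x))"
    by (simp add: emb_diff emb_mult right_diff_distrib eq)
  finally show "Qp (to_ac x - emb (residue p x))" by (rule Qp_cancel[OF as(1)])
qed

lemma Op_poly: "(\<And>i. Op (coeff f i)) \<Longrightarrow> Op x \<Longrightarrow> Op (poly f x)"
  by (auto simp: poly_altdef intro!: Op_sum Op_mult Op_power)

lemma Op_synthetic_div:
  assumes "\<And>i. Op (coeff f i)" "Op x"
  shows "Op (coeff (synthetic_div f x) i)"
  using assms
proof (induction f arbitrary: i)
  case (pCons c f)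
  have f: "Op (coeff f j)" for j using pCons.prems(1)[of "Suc j"] by simp
  then show ?case using pCons.IH[OF f pCons.prems(2)] Op_poly[OF f pCons.prems(2)]
    by (simp add: coeff_pCons split: nat.splits)
qed simp

text \<open>The bound on the number of roots over the residue domain. Synthetic division keeps the
  argument inside the localised ring: \<open>(y - x) g(y) = f(y) - f(x)\<close>, and distinct points
  of \<open>S\<close> stay distinct modulo \<open>Q\<close>.\<close>

lemma Qp_coeffs_if_many_roots:
  assumes "\<And>i. Op (coeff f i)" and "finite S" "degree f < card S"
    and "\<And>x. x \<in> S \<Longrightarrow> Op x" "\<And>x. x \<in> S \<Longrightarrow> Qp (poly f x)"
    and "\<And>x y. x \<in> S \<Longrightarrow> y \<in> S \<Longrightarrow> Qp (x - y) \<Longrightarrow> x = y"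
  shows "Qp (coeff f i)"
  using assms
proof (induction "degree f" arbitrary: f S i)
  case 0
  then obtain c where c: "f = [:c:]" by (metis degree_eq_zeroE)
  obtain x where "x \<in> S" using 0 by (metis card.empty ex_in_conv not_less_zero)
  then have "Qp c" using 0 c by (metis poly_pCons poly_0 mult_zero_right add.right_neutral)
  then show ?case by (simp add: c coeff_pCons split: nat.splits)
next
  case (Suc d)
  obtain x where x: "x \<in> S" using Suc.prems by (metis card.empty ex_in_conv not_less_zero)
  define g where "g = synthetic_div f x"
  have fg: "f + Polynomial.smult x g = pCons (poly f x) g"
    unfolding g_def by (rule synthetic_div_correct)
  have Og: "Op (coeff g j)" for j
    unfolding g_def by (rule Op_synthetic_div) (use Suc.prems x in auto)
  have "Qp (coeff g j)" for j
  proof (rule Suc.hyps(1))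
    show "d = degree g" using Suc.hyps(2) by (simp add: g_def degree_synthetic_div)
    show "degree g < card (S - {x})"
      using Suc.prems Suc.hyps(2) x by (simp add: g_def degree_synthetic_div)
    fix y assume y: "y \<in> S - {x}"
    have "poly f y + x * poly g y = poly f x + y * poly g y"
      using arg_cong[OF fg, of "\<lambda>f. poly f y"] by simp
    then have "(y - x) * poly g y = poly f y - poly f x" by (simp add: algebra_simps)
    then have "Qp ((y - x) * poly g y)" using Suc.prems(5) x y by (auto intro: Qp_diff)
    then have "Qp (y - x) \<or> Qp (poly g y)"
      by (rule Qp_prime[rotated -1]) (use Suc.prems(4) x y Og in \<open>auto intro: Op_diff Op_poly\<close>)
    then show "Qp (poly g y)" using Suc.prems(6)[of y x] x y by auto
  qed (use Og Suc.prems in auto)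
  then have g: "Qp (coeff g j)" for j .
  have "f = pCons (poly f x) g - Polynomial.smult x g" using fg by (simp add: algebra_simps)
  then have "coeff f i = coeff (pCons (poly f x) g) i - x * coeff g i" by (metis coeff_diff coeff_smult)
  moreover have "Qp (coeff (pCons (poly f x) g) i)"
    using g Suc.prems(5)[OF x] by (simp add: coeff_pCons split: nat.splits)
  ultimately show ?case using g Suc.prems(4)[OF x] by (auto intro!: Qp_diff Qp_mult)
qed

text \<open>\<open>\<sigma>\<close> is a homomorphism on the separable closure only; this brings all
  p-integral points under its laws.\<close>

lemma Op_in_sep_closure: assumes "Op x" shows "x \<in> sep_closure"
proof -
  obtain s where "\<not> p dvd s" "emb s * x \<in> \<O>" using assms by (auto simp: Op_def)
  moreover then have "to_fract s \<noteq> 0" by auto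
  ultimately show ?thesis
    using sep_closure_scale[of "to_fract s" x] by (auto simp: integral_closure_def emb_def)
qed

lemma sigma_to_ac [simp]: "\<sigma> (to_ac x) = to_ac x"
  using sigma by (simp add: abs_galois_def)

lemma sigma_emb [simp]: "\<sigma> (emb a) = emb a"
  by (simp add: emb_def)

lemma sigma_plus: "Op x \<Longrightarrow> Op y \<Longrightarrow> \<sigma> (x + y) = \<sigma> x + \<sigma> y"
  and sigma_times: "Op x \<Longrightarrow> Op y \<Longrightarrow> \<sigma> (x * y) = \<sigma> x * \<sigma> y"
  using sigma Op_in_sep_closure[of x] Op_in_sep_closure[of y]
  by (auto simp: abs_galois_def ring_iso_def ring_hom_def ring_of_type_algebra_def)

lemma sigma_pow: "Op x \<Longrightarrow> \<sigma> (x ^ n) = \<sigma> x ^ n"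
proof (induction n)
  case 0
  show ?case using sigma_emb[of 1] by simp
qed (simp add: sigma_times Op_power)

lemma sigma_sum: "(\<And>i. i \<in> A \<Longrightarrow> Op (f i)) \<Longrightarrow> \<sigma> (sum f A) = (\<Sum>i\<in>A. \<sigma> (f i))"
proof (induction A rule: infinite_finite_induct)
  case (insert i A)
  then show ?case by (simp add: sigma_plus Op_sum)
qed (use sigma_emb[of 0] in simp_all)

text \<open>As \<open>\<sigma>\<close> fixes \<open>A\<close>, its Frobenius congruence at
  \<open>emb a\<close> is Fermat's congruence in the residue field.\<close>

lemma fermat: "p dvd a ^ (CARD('q) ^ degree p) - a"
proof -
  have "\<sigma> (emb a) - emb a ^ (CARD('q) ^ degree p) \<in> Q"
    using frob emb_in_integral_closure by blast
  then have "emb (a - a ^ (CARD('q) ^ degree p)) \<in> Q" by (simp add: emb_diff emb_power)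
  then show ?thesis by (simp add: emb_in_Q_iff dvd_diff_commute)
qed

text \<open>Passing from \<open>s x\<close> to \<open>x\<close> leaves the error
  \<open>(s^n - s) x^n\<close> with \<open>n = q^(deg p)\<close>, which Fermat's congruence
  absorbs.\<close>

lemma Qp_frob:
  assumes "Op x"
  shows "Qp (\<sigma> x - x ^ (CARD('q) ^ degree p))"
proof -
  let ?n = "CARD('q) ^ degree p"
  obtain s where s: "\<not> p dvd s" "emb s * x \<in> \<O>" using assms by (auto simp: Op_def)
  have "\<sigma> (emb s * x) - (emb s * x) ^ ?n \<in> Q" using frob s(2) by blast
  then have 1: "Qp (\<sigma> (emb s * x) - (emb s * x) ^ ?n)"
    unfolding Qp_def using not_p_dvd_1 by (metis emb_1 mult_1)
  have 2: "Qp (emb (s ^ ?n - s) * x ^ ?n)"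
    using fermat[of s] by (intro Qp_mult_right Op_power assms) simp
  have "emb s * (\<sigma> x - x ^ ?n) = (\<sigma> (emb s * x) - (emb s * x) ^ ?n) + emb (s ^ ?n - s) * x ^ ?n"
    by (simp add: sigma_times assms emb_diff emb_power power_mult_distrib algebra_simps)
  then show ?thesis using Qp_cancel[OF s(1)] Qp_add[OF 1 2] by metis
qed

end

section \<open>Drinfeld modules\<close>

locale tw_rep =
  fixes \<psi> :: "'q::{finite,field} poly \<Rightarrow> 'q ratfun poly"
  assumes psi_add: "\<psi> (a + b) = \<psi> a + \<psi> b"
    and psi_mult: "\<psi> (a * b) = tw_mult CARD('q) (\<psi> a) (\<psi> b)"
    and psi_const: "\<psi> [:c:] = [:to_fract [:c:]:]"
    and psi_T: "coeff (\<psi> [:0, 1:]) 0 = to_fract [:0, 1:]"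
begin

lemma psi_0 [simp]: "\<psi> 0 = 0" and psi_1 [simp]: "\<psi> 1 = 1"
  using psi_const[of 0] psi_const[of 1] by (simp_all flip: one_pCons)

text \<open>Horner's rule: properties of the coefficients of \<open>\<psi>_T\<close> propagate to
  \<open>\<psi>_a\<close> by induction on \<open>a\<close>.\<close>

lemma psi_pCons: "\<psi> (pCons c a) = [:to_fract [:c:]:] + tw_mult CARD('q) (\<psi> a) (\<psi> [:0, 1:])"
proof -
  have "pCons c a = [:c:] + a * [:0, 1:]" by simp
  then show ?thesis by (metis psi_add psi_mult psi_const)
qed

lemma coeff_0_psi: "coeff (\<psi> a) 0 = to_fract a"
proof (induction a)
  case (pCons c a)
  have "pCons c a = [:c:] + a * [:0, 1:]" by simp
  then have "to_fract (pCons c a) = to_fract [:c:] + to_fract a * to_fract [:0, 1:]"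
    by (metis to_fract_add to_fract_mult)
  then show ?case by (simp add: psi_pCons[of c a] coeff_0_tw_mult pCons.IH psi_T)
qed simp

abbreviation act :: "'q poly \<Rightarrow> 'q closure \<Rightarrow> 'q closure" where
  "act a x \<equiv> tw_eval (\<psi> a) x"

sublocale poly_action "\<lambda>a x. tw_eval (\<psi> a) x"
proof
  have q: "CARD('q) > 0" and h0: "to_ac 0 = (0 :: 'q closure)" by simp_all
  fix a b :: "'q poly" and x y :: "'q closure"
  show "act (a + b) x = act a x + act b x"
    unfolding tw_eval_add_eval psi_add by (rule add_eval_add[where h = to_ac, OF q h0]) simp
  show "act a (x + y) = act a x + act a y"
    unfolding tw_eval_add_eval by (rule add_eval_arg_add[where h = to_ac, OF q h0 frob_add_closure])
  show "act (a * b) x = act a (act b x)"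
    unfolding tw_eval_add_eval psi_mult
    by (rule add_eval_tw_mult[where h = to_ac, OF q h0 frob_add_closure]) (simp_all add: frob_add_ratfun)
  show "act 1 x = x"
    using add_eval_const[where h = to_ac, OF q h0, of 1 x] unfolding tw_eval_add_eval psi_1
    by (simp add: one_pCons)
qed

end

lemma tw_rep_of_drinfeld_module:
  assumes "drinfeld_module r \<psi>"
  shows "tw_rep \<psi>"
  using assms unfolding drinfeld_module_def
  by unfold_locales (auto simp: ring_hom_def ring_of_type_algebra_def twisted_ring_def)

context tw_rep
begin

lemma coeff_drinfeld_twist:
  "coeff (drinfeld_twist c \<psi> a) i = inverse c * (coeff (\<psi> a) i * c ^ (CARD('q) ^ i))"
  by (simp add: drinfeld_twist_def tw_mult_const_left coeff_tw_mult_const_right)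

lemma tw_rep_drinfeld_twist:
  assumes "c \<noteq> 0"
  shows "tw_rep (drinfeld_twist c \<psi>)"
proof
  have q: "CARD('q) > 0" by simp
  note assoc = tw_mult_assoc[OF q frob_add_ratfun]
  have cc: "tw_mult CARD('q) [:c:] [:inverse c:] = 1"
    using assms by (simp add: tw_mult_const_left one_pCons)
  show "drinfeld_twist c \<psi> (a + b) = drinfeld_twist c \<psi> a + drinfeld_twist c \<psi> b" for a b
    by (rule poly_eqI) (simp add: coeff_drinfeld_twist psi_add algebra_simps)
  show "drinfeld_twist c \<psi> (a * b) = tw_mult CARD('q) (drinfeld_twist c \<psi> a) (drinfeld_twist c \<psi> b)" for a b
  proof -
    have "tw_mult CARD('q) (drinfeld_twist c \<psi> a) (drinfeld_twist c \<psi> b) =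
      tw_mult CARD('q) [:inverse c:] (tw_mult CARD('q) (\<psi> a) (tw_mult CARD('q)
        (tw_mult CARD('q) [:c:] [:inverse c:]) (tw_mult CARD('q) (\<psi> b) [:c:])))"
      unfolding drinfeld_twist_def by (simp only: assoc)
    then show ?thesis
      unfolding cc by (simp add: drinfeld_twist_def psi_mult assoc)
  qed
  show "drinfeld_twist c \<psi> [:t:] = [:to_fract [:t:]:]" for t
    by (rule poly_eqI) (use assms in \<open>simp add: coeff_drinfeld_twist psi_const coeff_pCons split: nat.splits\<close>)
  show "coeff (drinfeld_twist c \<psi> [:0, 1:]) 0 = to_fract [:0, 1:]"
    using assms by (simp add: coeff_drinfeld_twist psi_T)
qed

lemma degree_drinfeld_twist:
  assumes "c \<noteq> 0"
  shows "degree (drinfeld_twist c \<psi> a) = degree (\<psi> a)"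
proof -
  have "coeff (drinfeld_twist c \<psi> a) i = 0 \<longleftrightarrow> coeff (\<psi> a) i = 0" for i
    using assms by (simp add: coeff_drinfeld_twist)
  then show ?thesis by (simp add: degree_def)
qed

lemma tw_eval_drinfeld_twist:
  assumes "c \<noteq> 0"
  shows "tw_eval (drinfeld_twist c \<psi> a) x = inverse (to_ac c) * act a (to_ac c * x)"
  by (simp add: tw_eval_def degree_drinfeld_twist[OF assms] coeff_drinfeld_twist power_mult_distrib
      sum_distrib_left mult_ac)

end

locale good_rep = tw_rep \<psi> + residue_prime p \<zeta>
  for \<psi> :: "'q::{finite,field} poly \<Rightarrow> 'q ratfun poly" and p :: "'q poly" and \<zeta> +
  assumes deg_T: "degree (\<psi> [:0, 1:]) = 2" and good: "good_model 2 p \<psi>"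
begin

lemma integral_psi: "integral_at p (coeff (\<psi> a) i)"
proof (induction a arbitrary: i)
  case (pCons c a)
  have "integral_at p (coeff (\<psi> [:0, 1:]) j)" for j
  proof (cases "j \<le> 2")
    case True
    then show ?thesis using good by (simp add: good_model_def)
  next
    case False
    then show ?thesis using deg_T by (simp add: coeff_eq_0)
  qed
  then have "integral_at p (coeff (tw_mult CARD('q) (\<psi> a) (\<psi> [:0, 1:])) i)"
    using tw_mult_closed[of "CARD('q)" "Collect (integral_at p)" "\<psi> a" "\<psi> [:0, 1:]" i] pCons.IH
    by (simp add: integral_at_add integral_at_mult)
  moreover have "integral_at p (coeff [:to_fract [:c:]:] i)"
    by (simp add: coeff_pCons split: nat.splits)
  ultimately show ?case by (simp only: psi_pCons[of c a] coeff_add integral_at_add)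
qed simp

text \<open>The top coefficient for \<open>pCons c a\<close> is the one for \<open>a\<close> times a
  power of that of \<open>\<psi>_T\<close>, a unit at \<open>p\<close>. So reduction preserves the
  degree \<open>2 * degree a\<close>.\<close>

lemma psi_degree_bound_unit:
  assumes "a \<noteq> 0"
  shows "degree (\<psi> a) \<le> 2 * degree a \<and> unit_at p (coeff (\<psi> a) (2 * degree a))"
  using assms
proof (induction a)
  case (pCons c a)
  show ?case
  proof (cases "a = 0")
    case True
    then have "c \<noteq> 0" using pCons by simp
    then show ?thesis using True by (simp add: psi_const unit_at_iff)
  next
    case False
    then have IH: "degree (\<psi> a) \<le> 2 * degree a" "unit_at p (coeff (\<psi> a) (2 * degree a))"
      using pCons.IH by auto
    let ?g = "tw_mult CARD('q) (\<psi> a) (\<psi> [:0, 1:])"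
    have "degree ?g \<le> degree (\<psi> a) + degree (\<psi> [:0, 1:])" by (rule degree_tw_mult_le) simp
    then have "degree (\<psi> (pCons c a)) \<le> 2 * degree (pCons c a)"
      unfolding psi_pCons[of c a] using IH(1) False deg_T by (intro degree_add_le) auto
    moreover have "coeff (\<psi> (pCons c a)) (2 * degree (pCons c a)) =
        coeff (\<psi> a) (2 * degree a) * coeff (\<psi> [:0, 1:]) 2 ^ (CARD('q) ^ (2 * degree a))"
      using coeff_tw_mult_degree_sum[of "CARD('q)" "\<psi> a" "2 * degree a" "\<psi> [:0, 1:]" 2] IH(1) False deg_T
      by (simp add: psi_pCons[of c a])
    moreover have "unit_at p (coeff (\<psi> a) (2 * degree a) * coeff (\<psi> [:0, 1:]) 2 ^ (CARD('q) ^ (2 * degree a)))"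
    proof -
      have u: "integral_at p (coeff (\<psi> [:0, 1:]) 2)" "\<rho> (coeff (\<psi> [:0, 1:]) 2) \<noteq> 0"
        using good by (auto simp: good_model_def unit_at_iff)
      have "\<rho> (x ^ n) = \<rho> x ^ n" if "integral_at p x" for x n
        using that by (induction n) (simp_all add: rho_mult integral_at_power)
      then show ?thesis
        using IH(2) u by (simp add: unit_at_iff rho_mult integral_at_mult integral_at_power)
    qed
    ultimately show ?thesis by simp
  qed
qed simp

lemma degree_psi: "a \<noteq> 0 \<Longrightarrow> degree (\<psi> a) = 2 * degree a"
proof -
  assume a: "a \<noteq> 0"
  have "coeff (\<psi> a) (2 * degree a) \<noteq> 0"
    using psi_degree_bound_unit[OF a] by (auto simp: unit_at_iff)
  then show ?thesis using psi_degree_bound_unit[OF a] le_degree by (meson antisym)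
qed

lemma degree_map_rho_psi: "a \<noteq> 0 \<Longrightarrow> degree (map_poly \<rho> (\<psi> a)) = 2 * degree a"
proof -
  assume a: "a \<noteq> 0"
  have "coeff (map_poly \<rho> (\<psi> a)) (2 * degree a) \<noteq> 0"
    using psi_degree_bound_unit[OF a] by (simp add: coeff_map_poly unit_at_iff)
  moreover have "degree (map_poly \<rho> (\<psi> a)) \<le> 2 * degree a"
    using degree_map_poly_le[of \<rho> "\<psi> a"] degree_psi[OF a] by simp
  ultimately show ?thesis using le_degree by (meson antisym)
qed

text \<open>The reduced module with coefficients viewed in the algebraic closure of the constants,
  where twisted polynomials have no zero divisors.\<close>

definition \<Phi> :: "'q poly \<Rightarrow> 'q twisted" where
  "\<Phi> a = Twisted (map_poly \<rho> (\<psi> a))"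

lemma tw_coeffs_Phi: "tw_coeffs (\<Phi> a) = map_poly \<rho> (\<psi> a)"
  by (simp add: \<Phi>_def Twisted_inverse)

lemma Phi_add: "\<Phi> (a + b) = \<Phi> a + \<Phi> b"
  unfolding tw_coeffs_inject[symmetric] plus_twisted.rep_eq tw_coeffs_Phi
  by (rule poly_eqI) (simp add: coeff_map_poly psi_add rho_add integral_psi)

lemma Phi_mult: "\<Phi> (a * b) = \<Phi> a * \<Phi> b"
  unfolding tw_coeffs_inject[symmetric] times_twisted.rep_eq tw_coeffs_Phi psi_mult
  by (rule map_poly_tw_mult[where S = "Collect (integral_at p)"])
     (simp_all add: rho_add rho_mult integral_at_add integral_at_mult integral_psi)

lemma Phi_1: "\<Phi> 1 = 1"
  unfolding tw_coeffs_inject[symmetric] one_twisted.rep_eq tw_coeffs_Phi psi_1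
  by (simp add: one_pCons Polynomial.map_poly_pCons)

end

section \<open>Reduction of a good model together with a Frobenius element\<close>

locale reduction = good_rep \<psi> p \<zeta> + frobenius_place p \<zeta> Q \<sigma>
  for \<psi> :: "'q::{finite,field} poly \<Rightarrow> 'q ratfun poly" and p :: "'q poly" and \<zeta> Q \<sigma>
begin

definition \<phi> :: "'q poly \<Rightarrow> 'q poly poly" where
  "\<phi> a = map_poly (residue p) (\<psi> a)"

text \<open>Polynomials over \<open>A\<close> serve as lifts: \<open>bar\<close> gives their class
  over the residue field, while \<open>evalA\<close> evaluates them on the closure of
  \<open>F\<close>. At p-integral points, lifts of the same class have values congruent modulo
  \<open>Q\<close>.\<close>

definition bar :: "'q poly poly \<Rightarrow> 'q twisted" where
  "bar f = Twisted (map_poly ev f)"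

lemma coeff_bar [simp]: "coeff (tw_coeffs (bar f)) i = ev (coeff f i)"
  by (simp add: bar_def Twisted_inverse coeff_map_poly)

lemma bar_eqI: "(\<And>i. ev (coeff f i) = coeff (tw_coeffs w) i) \<Longrightarrow> bar f = w"
  unfolding tw_coeffs_inject[symmetric] by (rule poly_eqI) simp

lemma bar_eq_iff: "bar f = bar g \<longleftrightarrow> (\<forall>i. p dvd coeff f i - coeff g i)"
  unfolding tw_coeffs_inject[symmetric] poly_eq_iff by (simp add: ev_eq_iff)

lemma bar_phi [simp]: "bar (\<phi> a) = \<Phi> a"
  by (rule bar_eqI) (simp add: \<phi>_def tw_coeffs_Phi coeff_map_poly \<rho>_def)

lemma bar_add: "bar (f + g) = bar f + bar g"
  by (rule bar_eqI) (simp add: plus_twisted.rep_eq ev_add)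

lemma bar_diff: "bar (f - g) = bar f - bar g"
  by (rule bar_eqI) (simp add: minus_twisted.rep_eq ev_diff)

lemma bar_0 [simp]: "bar 0 = 0"
  by (rule bar_eqI) (simp add: zero_twisted.rep_eq)

lemma bar_tw_mult: "bar (tw_mult CARD('q) f g) = bar f * bar g"
  unfolding tw_coeffs_inject[symmetric] times_twisted.rep_eq bar_def Twisted_inverse[OF UNIV_I]
  by (rule map_poly_tw_mult[where S = UNIV]) (simp_all add: ev_add ev_mult)

text \<open>Reduced coefficients put the lift into the concrete residue ring; the bound on its
  degree is what the root count uses.\<close>

lemma lift_ex:
  assumes "\<And>i. coeff f i \<in> range ev"
  shows "\<exists>g. bar g = Twisted f \<and> degree g \<le> degree f \<and> reduce_coeffs p g = g"
proof -
  define unev where "unev x = (SOME a. ev a = x) mod p" for x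
  have ev_unev: "ev (unev x) = x" if "x \<in> range ev" for x
    using that someI_ex[of "\<lambda>a. ev a = x"] by (auto simp: unev_def)
  have "ev (SOME a. ev a = 0) = 0" by (rule someI[of "\<lambda>a. ev a = 0" 0]) simp
  then have unev_0: "unev 0 = 0" by (simp add: unev_def ev_eq_0_iff mod_eq_0_iff_dvd)
  have "bar (map_poly unev f) = Twisted f"
    by (rule bar_eqI) (simp add: coeff_map_poly unev_0 ev_unev[OF assms] Twisted_inverse)
  moreover have "reduce_coeffs p (map_poly unev f) = map_poly unev f"
    by (rule poly_eqI, simp add: reduce_coeffs_def coeff_map_poly unev_0) (simp add: unev_def)
  ultimately show ?thesis using degree_map_poly_le by blast
qed

abbreviation evalA :: "'q poly poly \<Rightarrow> 'q closure \<Rightarrow> 'q closure" where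
  "evalA \<equiv> add_eval emb CARD('q)"

lemma card_pos: "CARD('q) > 0" by simp

lemmas evalA_add = add_eval_add[where h = emb, OF card_pos emb_0 emb_add]
lemmas evalA_diff = add_eval_diff[where h = emb, OF card_pos emb_0 emb_add]
lemmas evalA_monom = add_eval_monom[where h = emb, OF card_pos emb_0]
lemmas evalA_at_0 = add_eval_at_0[where h = emb, OF card_pos emb_0]
lemmas evalA_tw_mult = add_eval_tw_mult[where h = emb, OF card_pos emb_0 frob_add_closure emb_add emb_mult emb_1 frob_add_poly]

lemma Op_evalA: "Op x \<Longrightarrow> Op (evalA f x)"
  unfolding add_eval_def by (intro Op_sum Op_mult Op_power Op_emb)

lemma Qp_evalA_arg: "Op x \<Longrightarrow> Op y \<Longrightarrow> Qp (x - y) \<Longrightarrow> Qp (evalA f x - evalA f y)"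
  unfolding add_eval_def sum_subtractf[symmetric] right_diff_distrib[symmetric]
  by (intro Qp_sum Qp_mult Qp_power_diff Op_emb) simp_all

lemma Qp_evalA_bar:
  assumes "bar f = bar g" "Op x"
  shows "Qp (evalA f x - evalA g x)"
proof -
  have "p dvd coeff (f - g) i" for i using assms(1) by (simp add: bar_eq_iff)
  then have "Qp (evalA (f - g) x)"
    unfolding add_eval_def by (intro Qp_sum Qp_mult_right Op_power assms(2)) simp_all
  then show ?thesis by (simp add: evalA_diff)
qed

lemma Qp_trans: "Qp (x - y) \<Longrightarrow> Qp (y - z) \<Longrightarrow> Qp (x - z)"
  using Qp_add[of "x - y" "y - z"] by simp

lemma Qp_sym: "Qp (x - y) \<Longrightarrow> Qp (y - x)"
  using Qp_minus[of "x - y"] by simp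

lemma Qp_act_phi:
  assumes "Op x"
  shows "Qp (act a x - evalA (\<phi> a) x)"
proof -
  have "degree (\<phi> a) \<le> degree (\<psi> a)" unfolding \<phi>_def by (rule degree_map_poly_le)
  then have "evalA (\<phi> a) x = (\<Sum>i\<le>degree (\<psi> a). emb (coeff (\<phi> a) i) * x ^ (CARD('q) ^ i))"
    by (rule add_eval_bound[where h = emb, OF card_pos emb_0])
  then have "act a x - evalA (\<phi> a) x =
      (\<Sum>i\<le>degree (\<psi> a). (to_ac (coeff (\<psi> a) i) - emb (residue p (coeff (\<psi> a) i))) * x ^ (CARD('q) ^ i))"
    by (simp add: tw_eval_def sum_subtractf left_diff_distrib \<phi>_def coeff_map_poly)
  then show ?thesis
    by (simp only:) (intro Qp_sum Qp_mult_right Op_power assms Qp_residue integral_psi Qp_0)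
qed

text \<open>Dividing by the top coefficient, a unit at \<open>p\<close>, and scaling by a common
  denominator \<open>s\<close> prime to \<open>p\<close> makes \<open>s x\<close> a root of a monic
  polynomial over \<open>A\<close>, which is separable because its derivative is a nonzero
  constant.\<close>

lemma Op_tors:
  assumes N: "N \<noteq> 0" and x: "x \<in> tors N"
  shows "Op x"
proof -
  let ?q = "CARD('q)"
  define n where "n = degree (\<psi> N)"
  define c where "c i = coeff (\<psi> N) i / coeff (\<psi> N) n" for i
  have n: "n = 2 * degree N" unfolding n_def by (rule degree_psi[OF N])
  have un: "unit_at p (coeff (\<psi> N) n)" unfolding n using psi_degree_bound_unit[OF N] by blast
  then have ne: "coeff (\<psi> N) n \<noteq> 0" by (auto simp: unit_at_iff)
  have "integral_at p (c i)" for i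
    unfolding c_def divide_inverse
    by (intro integral_at_mult integral_psi unit_at_imp_integral_inverse un)
  then obtain s a where s: "\<not> p dvd s" and a: "\<And>i. i \<le> n \<Longrightarrow> to_fract s * c i = to_fract (a i)"
    using common_denominator[of n c] by blast
  have s0: "s \<noteq> 0" using s by auto
  \<comment> \<open>Passing from \<open>x\<close> to \<open>s x\<close> multiplies the coefficient
    at \<open>q^i\<close> by \<open>s^(q^n - q^i)\<close>; one factor \<open>s\<close> is used up in
    \<open>a i = s c i\<close>.\<close>
  define g :: "'q poly poly" where
    "g = monom 1 n + (\<Sum>i<n. monom (a i * s ^ (?q ^ n - ?q ^ i - 1)) i)"
  have coeff_g: "coeff g i = (if i < n then a i * s ^ (?q ^ n - ?q ^ i - 1) else if i = n then 1 else 0)" for i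
    by (auto simp: g_def coeff_sum)
  have deg_g: "degree g \<le> n"
    by (rule degree_le) (simp add: coeff_g)
  have q2: "2 \<le> ?q" by (rule two_le_card)
  define G where "G = add_poly id ?q g"
  have mapG: "map_poly h G = add_poly h ?q g" if "h 0 = 0" "\<And>x y. h (x + y) = h x + h y" for h :: "'q poly \<Rightarrow> 'z::comm_ring_1"
  proof -
    have hsum: "h (sum F A) = (\<Sum>i\<in>A. h (F i))" for F and A :: "nat set"
      by (induction A rule: infinite_finite_induct) (simp_all add: that)
    show ?thesis
      by (rule poly_eqI) (simp add: G_def add_poly_def coeff_map_poly that(1) coeff_sum hsum if_distrib[of h] cong: if_cong)
  qed
  define y where "y = emb s * x"
  have term_eq: "emb (coeff g i) * y ^ (?q ^ i) = emb s ^ (?q ^ n) * (to_ac (c i) * x ^ (?q ^ i))" if "i \<le> n" for i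
  proof (cases "i = n")
    case True
    then show ?thesis using ne by (simp add: coeff_g c_def y_def power_mult_distrib)
  next
    case False
    then have "?q ^ i < ?q ^ n" using that q2 by (simp add: power_strict_increasing)
    then have e: "?q ^ n = Suc (?q ^ n - ?q ^ i - 1) + ?q ^ i" by simp
    have "emb (a i) = emb s * to_ac (c i)" using a[OF that] by (metis emb_def to_ac_mult)
    then have "emb (coeff g i) * y ^ (?q ^ i) =
        emb s ^ (Suc (?q ^ n - ?q ^ i - 1) + ?q ^ i) * (to_ac (c i) * x ^ (?q ^ i))"
      using False that by (simp add: coeff_g y_def emb_mult emb_power power_mult_distrib power_add mult_ac)
    then show ?thesis unfolding e[symmetric] .
  qed
  have root: "add_eval emb ?q g y = 0"
  proof -
    have "add_eval emb ?q g y = (\<Sum>i\<le>n. emb (coeff g i) * y ^ (?q ^ i))"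
      by (rule add_eval_bound[where h = emb, OF card_pos emb_0 deg_g])
    also have "\<dots> = (\<Sum>i\<le>n. emb s ^ (?q ^ n) * (to_ac (c i) * x ^ (?q ^ i)))"
      by (intro sum.cong refl term_eq) simp
    also have "\<dots> = emb s ^ (?q ^ n) / to_ac (coeff (\<psi> N) n) * act N x"
      by (simp add: tw_eval_def n_def[symmetric] c_def sum_distrib_left)
    also have "\<dots> = 0" using x by (simp add: tors_def)
    finally show ?thesis .
  qed
  have "y \<in> integral_closure"
    unfolding integral_closure_def
  proof (intro CollectI conjI exI)
    show "poly (map_poly emb G) y = 0"
      using root by (simp add: mapG emb_add poly_add_poly)
    have "degree G \<le> ?q ^ degree g" unfolding G_def by (rule degree_add_poly_le) simp
    also have "\<dots> \<le> ?q ^ n" using deg_g q2 by (intro power_increasing) auto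
    finally have "degree G \<le> ?q ^ n" .
    moreover have cG: "coeff G (?q ^ n) = 1"
      unfolding G_def using coeff_add_poly[of ?q id g n] q2 by (simp add: coeff_g)
    ultimately have "degree G = ?q ^ n" by (intro antisym le_degree) auto
    then show "lead_coeff G = 1" using cG by simp
    have comp: "map_poly to_ac (map_poly to_fract G) = map_poly emb G"
      by (rule poly_eqI) (simp add: coeff_map_poly emb_def)
    have "of_nat ?q = (0 :: 'q ratfun)"
    proof -
      have "of_nat ?q = (0 :: 'q)" using of_nat_card_choose_eq_0[of 1, where ?'q = 'q] q2 by simp
      then have "CHAR('q) dvd ?q" by (simp add: of_nat_eq_0_iff_char_dvd)
      then show ?thesis by (simp add: of_nat_eq_0_iff_char_dvd)
    qed
    then have "pderiv (map_poly to_fract G) = [:to_fract (coeff g 0):]"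
      by (simp add: mapG pderiv_add_poly)
    \<comment> \<open>For \<open>n = 0\<close> this coefficient is the leading one; otherwise it
      comes from \<open>N\<close>, the constant coefficient of \<open>\<psi>_N\<close>.\<close>
    moreover have "coeff g 0 \<noteq> 0"
    proof (cases "n = 0")
      case False
      have "to_fract s * c 0 \<noteq> 0" using s0 N ne by (simp add: c_def coeff_0_psi)
      then have "a 0 \<noteq> 0" using a[of 0] by auto
      then show ?thesis using False s0 by (simp add: coeff_g)
    qed (simp add: coeff_g)
    ultimately have "is_unit (pderiv (map_poly to_fract G))"
      by (simp add: is_unit_iff_degree)
    then have "coprime (map_poly to_fract G) (pderiv (map_poly to_fract G))"
      by (rule is_unit_right_imp_coprime)
    moreover have "poly (map_poly to_ac (map_poly to_fract G)) y = 0"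
      unfolding comp using root by (simp add: mapG emb_add poly_add_poly)
    ultimately show "y \<in> sep_closure" unfolding sep_closure_def by blast
  qed
  then show ?thesis using s unfolding Op_def y_def by blast
qed

text \<open>Dividing \<open>\<psi>_N(x) = 0\<close> by a nonzero \<open>x\<close> leaves
  \<open>N\<close> plus terms divisible by \<open>x\<close>. If \<open>x\<close> vanished modulo
  \<open>Q\<close>, so would \<open>N\<close>, against \<open>N\<close> being prime to
  \<open>p\<close>.\<close>

lemma tors_eq_0_if_Qp:
  assumes N: "\<not> p dvd N" and x: "x \<in> tors N" and Q: "Qp x"
  shows "x = 0"
proof (rule ccontr)
  assume x0: "x \<noteq> 0"
  let ?q = "CARD('q)"
  have N0: "N \<noteq> 0" using N by auto
  have Ox: "Op x" by (rule Op_tors[OF N0 x])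
  define f where "f i = to_ac (coeff (\<psi> N) i) * x ^ (?q ^ i - 1)" for i
  have xq: "x ^ (?q ^ i) = x * x ^ (?q ^ i - 1)" for i
  proof -
    have "?q ^ i = Suc (?q ^ i - 1)" by simp
    then show ?thesis by (metis power_Suc)
  qed
  have "act N x = x * (\<Sum>i\<le>degree (\<psi> N). f i)"
    unfolding tw_eval_def f_def sum_distrib_left by (intro sum.cong refl) (simp only: xq mult_ac)
  then have "(\<Sum>i\<le>degree (\<psi> N). f i) = 0" using x x0 by (simp add: tors_def)
  moreover have "(\<Sum>i\<le>degree (\<psi> N). f i) = f 0 + (\<Sum>i\<in>{1..degree (\<psi> N)}. f i)"
    by (simp add: sum.atMost_shift sum.atLeast1_atMost_eq[symmetric] atMost_atLeast0 sum.atLeast_Suc_atMost)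
  moreover have "f 0 = emb N" by (simp add: f_def coeff_0_psi emb_def)
  ultimately have eq: "emb N = - (\<Sum>i\<in>{1..degree (\<psi> N)}. f i)" by (simp add: eq_neg_iff_add_eq_0)
  have "Qp (f i)" if "i \<ge> 1" for i
  proof -
    have "2 ^ 1 \<le> ?q ^ i"
      using two_le_card[where ?'q = 'q] that by (metis power_increasing power_mono order_trans one_le_numeral zero_le_numeral)
    then have "?q ^ i - 1 = Suc (?q ^ i - 2)" by simp
    then have "x ^ (?q ^ i - 1) = x ^ (?q ^ i - 2) * x" by (metis power_Suc2)
    then show ?thesis
      unfolding f_def by (simp only:) (intro Qp_mult Op_power Ox Op_to_ac integral_psi Q)
  qed
  then have "Qp (emb N)" unfolding eq by (intro Qp_minus Qp_sum) auto
  then show False using N by simp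
qed

text \<open>Right division by \<open>\<Phi> N\<close> leaves a remainder of degree below
  \<open>2 * degree N\<close> that still vanishes on the torsion modulo \<open>Q\<close>. Its
  additive polynomial has degree below \<open>card S\<close>, and torsion points prime to
  \<open>p\<close> are incongruent, so the remainder is zero.\<close>

lemma right_factor_if_kills:
  assumes N: "\<not> p dvd N" and deg: "degree N > 0"
    and S: "S \<subseteq> tors N" "finite S" "card S = CARD('q) ^ (2 * degree N)"
    and kills: "\<And>x. x \<in> tors N \<Longrightarrow> Qp (evalA f x)"
  shows "\<exists>e. bar f = e * \<Phi> N \<and> (\<forall>i. coeff (tw_coeffs e) i \<in> range ev)"
proof -
  let ?q = "CARD('q)"
  have N0: "N \<noteq> 0" using N by auto
  define g where "g = map_poly \<rho> (\<psi> N)"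
  have dg: "degree g = 2 * degree N" unfolding g_def by (rule degree_map_rho_psi[OF N0])
  have "\<exists>e r. tw_coeffs (bar f) = tw_mult ?q e g + r \<and> degree r < degree g \<and>
      (\<forall>i. coeff e i \<in> range ev) \<and> (\<forall>i. coeff r i \<in> range ev)"
  proof (rule tw_division)
    show "g \<noteq> 0" "degree g > 0" using dg deg by auto
    show "coeff g i \<in> range ev" for i by (simp add: g_def coeff_map_poly \<rho>_def)
    show "0 \<in> range ev" "1 \<in> range ev" using ev_0 ev_1 by (metis rangeI)+
    show "x \<in> range ev \<Longrightarrow> inverse x \<in> range ev" for x by (rule inverse_range_ev)
    fix x y assume "x \<in> range ev"
    then obtain a where x: "x = ev a" by blast
    show "- x \<in> range ev" unfolding x ev_minus[symmetric] by (rule rangeI)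
    assume "y \<in> range ev"
    then obtain b where y: "y = ev b" by blast
    show "x + y \<in> range ev" unfolding x y ev_add[symmetric] by (rule rangeI)
    show "x * y \<in> range ev" unfolding x y ev_mult[symmetric] by (rule rangeI)
  qed simp_all
  then obtain e r where er: "tw_coeffs (bar f) = tw_mult ?q e g + r" "degree r < degree g"
    "\<And>i. coeff e i \<in> range ev" "\<And>i. coeff r i \<in> range ev" by blast
  obtain e' where e': "bar e' = Twisted e" using lift_ex[of e] er(3) by blast
  obtain r' where r': "bar r' = Twisted r" "degree r' \<le> degree r" using lift_ex[of r] er(4) by blast
  have fer: "bar f = Twisted e * \<Phi> N + Twisted r"
    unfolding tw_coeffs_inject[symmetric] plus_twisted.rep_eq times_twisted.rep_eq tw_coeffs_Phi
    by (simp add: er(1) Twisted_inverse g_def)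
  then have bars: "bar f = bar (tw_mult ?q e' (\<phi> N) + r')"
    by (simp add: bar_add bar_tw_mult e' r')
  have r_kills: "Qp (evalA r' x)" if x: "x \<in> tors N" for x
  proof -
    have Ox: "Op x" by (rule Op_tors[OF N0 x])
    have "Qp (act N x - evalA (\<phi> N) x)" by (rule Qp_act_phi[OF Ox])
    then have "Qp (evalA (\<phi> N) x - 0)" using x Qp_minus by (fastforce simp: tors_def)
    then have 1: "Qp (evalA e' (evalA (\<phi> N) x) - evalA e' 0)"
      by (intro Qp_evalA_arg Op_evalA Ox) simp_all
    have 2: "Qp (evalA f x - evalA (tw_mult ?q e' (\<phi> N) + r') x)"
      by (rule Qp_evalA_bar[OF bars Ox])
    have "Qp (evalA f x - (evalA f x - evalA (tw_mult ?q e' (\<phi> N) + r') x) -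
        (evalA e' (evalA (\<phi> N) x) - evalA e' 0))"
      by (rule Qp_diff[OF Qp_diff[OF kills[OF x] 2] 1])
    then show ?thesis by (simp add: evalA_add evalA_tw_mult evalA_at_0)
  qed
  have Qp_coeffs: "Qp (coeff (add_poly emb ?q r') j)" for j
  proof (rule Qp_coeffs_if_many_roots[OF _ S(2)])
    show "Op (coeff (add_poly emb ?q r') i)" for i
      unfolding add_poly_def coeff_sum by (intro Op_sum) simp
    have "degree (add_poly emb ?q r') \<le> ?q ^ degree r'" by (rule degree_add_poly_le) simp
    also have "\<dots> < ?q ^ (2 * degree N)"
      using r'(2) er(2) dg two_le_card[where ?'q = 'q] by (intro power_strict_increasing) auto
    finally show "degree (add_poly emb ?q r') < card S" by (simp add: S)
    show "Op x" if "x \<in> S" for x using that S(1) Op_tors[OF N0] by blast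
    show "Qp (poly (add_poly emb ?q r') x)" if "x \<in> S" for x
      using that S(1) r_kills by (auto simp: poly_add_poly)
    show "x = y" if "x \<in> S" "y \<in> S" "Qp (x - y)" for x y
      using tors_eq_0_if_Qp[OF N tors_diff _, of x y] that S(1) by auto
  qed
  \<comment> \<open>The twisted coefficients sit at the exponents \<open>q^i\<close> of the additive
    polynomial.\<close>
  have "p dvd coeff r' i" for i
    using Qp_coeffs[of "?q ^ i"] coeff_add_poly[of ?q emb r' i] two_le_card[where ?'q = 'q] by simp
  then have "bar r' = 0" by (intro bar_eqI) (simp add: ev_eq_0_iff zero_twisted.rep_eq)
  then have "bar f = Twisted e * \<Phi> N" using fer r'(1) by simp
  then show ?thesis using er(3) by (metis Twisted_inverse UNIV_I)
qed

end

section \<open>The endomorphism ring of the reduction\<close>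

context reduction
begin

sublocale galois_action "\<lambda>a x. tw_eval (\<psi> a) x" \<sigma>
proof
  fix m :: "'q poly" and x y :: "'q closure"
  assume m: "m \<noteq> 0" and x: "x \<in> tors m"
  have Ox: "Op x" by (rule Op_tors[OF m x])
  show "\<sigma> (x + y) = \<sigma> x + \<sigma> y" if "y \<in> tors m"
    by (rule sigma_plus[OF Ox Op_tors[OF m that]])
  show "\<sigma> (act c x) = act c (\<sigma> x)" for c
    unfolding tw_eval_def
    by (simp add: sigma_sum sigma_times sigma_pow Ox Op_mult Op_power Op_to_ac integral_psi)
qed

definition \<pi> :: "'q twisted" where
  "\<pi> = bar (monom 1 (degree p))"

text \<open>The condition on \<open>range ev\<close> keeps to endomorphisms over the residue field;
  over its algebraic closure the centralizer can be larger.\<close>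

definition \<E> :: "'q twisted set" where
  "\<E> = {w. (\<forall>i. coeff (tw_coeffs w) i \<in> range ev) \<and> (\<forall>a. w * \<Phi> a = \<Phi> a * w)}"

lemma bar_in_E_iff: "bar f \<in> \<E> \<longleftrightarrow> (\<forall>a. bar f * \<Phi> a = \<Phi> a * bar f)"
  by (simp add: \<E>_def)

lemma E_eq_bar:
  assumes "w \<in> \<E>"
  obtains f where "bar f = w" "reduce_coeffs p f = f"
proof -
  have "coeff (tw_coeffs w) i \<in> range ev" for i using assms by (simp add: \<E>_def)
  from lift_ex[OF this] show ?thesis using that by (auto simp: tw_coeffs_inverse)
qed

lemma Phi_in_E: "\<Phi> a \<in> \<E>"
  using bar_in_E_iff[of "\<phi> a"] by (simp flip: Phi_mult) (simp add: mult.commute)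

lemma E_add: assumes "s \<in> \<E>" "t \<in> \<E>" shows "s + t \<in> \<E>"
proof -
  obtain f g where fg: "bar f = s" "bar g = t" using assms E_eq_bar by metis
  have "s * \<Phi> a = \<Phi> a * s" "t * \<Phi> a = \<Phi> a * t" for a using assms by (simp_all add: \<E>_def)
  then show ?thesis
    using bar_in_E_iff[of "f + g"] by (simp add: bar_add fg distrib_left distrib_right)
qed

lemma E_mult: assumes "s \<in> \<E>" "t \<in> \<E>" shows "s * t \<in> \<E>"
proof -
  obtain f g where fg: "bar f = s" "bar g = t" using assms E_eq_bar by metis
  have "s * \<Phi> a = \<Phi> a * s" "t * \<Phi> a = \<Phi> a * t" for a using assms by (simp_all add: \<E>_def)
  then have "s * t * \<Phi> a = \<Phi> a * (s * t)" for a by (metis mult.assoc)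
  then show ?thesis
    using bar_in_E_iff[of "tw_mult CARD('q) f g"] by (simp add: bar_tw_mult fg)
qed

lemma Phi_eq_0_iff: "\<Phi> a = 0 \<longleftrightarrow> a = 0"
proof
  assume "\<Phi> a = 0"
  then have *: "map_poly \<rho> (\<psi> a) = 0" by (metis tw_coeffs_Phi zero_twisted.rep_eq)
  show "a = 0"
  proof (rule ccontr)
    assume a: "a \<noteq> 0"
    have "coeff (map_poly \<rho> (\<psi> a)) (2 * degree a) = 0" using * by simp
    then show False using psi_degree_bound_unit[OF a] by (simp add: coeff_map_poly unit_at_iff)
  qed
qed (use Phi_add[of 0 0] in simp)

text \<open>\<open>\<Phi> N\<close> commutes with the image of \<open>A\<close> and can be
  cancelled, so a right quotient of an endomorphism by it is again one.\<close>

lemma E_right_cancel: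
  assumes "w * \<Phi> N \<in> \<E>" "N \<noteq> 0" "\<forall>i. coeff (tw_coeffs w) i \<in> range ev"
  shows "w \<in> \<E>"
proof -
  have "\<Phi> N \<noteq> 0" using assms(2) by (simp add: Phi_eq_0_iff)
  moreover have "w * \<Phi> a * \<Phi> N = \<Phi> a * w * \<Phi> N" for a
  proof -
    have "w * \<Phi> N * \<Phi> a = \<Phi> a * (w * \<Phi> N)" using assms(1) by (simp add: \<E>_def)
    moreover have "\<Phi> N * \<Phi> a = \<Phi> a * \<Phi> N" by (metis Phi_mult mult.commute)
    ultimately show ?thesis by (metis mult.assoc)
  qed
  ultimately have "w * \<Phi> a = \<Phi> a * w" for a by (metis mult_right_cancel)
  then show ?thesis using assms(3) by (simp add: \<E>_def)
qed

text \<open>The coefficients of \<open>bar f\<close> lie in a field with \<open>q^(deg p)\<close>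
  elements, so raising them to that power fixes them.\<close>

lemma pi_commute: "\<pi> * bar f = bar f * \<pi>"
proof -
  let ?q = "CARD('q)" and ?d = "degree p"
  have "bar (tw_mult ?q (monom 1 ?d) f) = bar (tw_mult ?q f (monom 1 ?d))"
  proof (induction f rule: poly_add_monom_induct)
    case (monom c n)
    have "p dvd c ^ (?q ^ ?d) - c" by (rule fermat)
    then show ?case by (simp add: tw_mult_monom_monom[OF card_pos] bar_eq_iff add.commute)
  next
    case (add f g)
    then show ?case
      by (simp add: tw_mult_add_right[OF card_pos frob_add_poly] tw_mult_add_left[OF card_pos] bar_add)
  qed
  then show ?thesis by (simp add: bar_tw_mult \<pi>_def)
qed

lemma pi_in_E: "\<pi> \<in> \<E>"
  using bar_in_E_iff[of "monom 1 (degree p)"] pi_commute[of "\<phi> _"] by (simp add: \<pi>_def)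

lemma Phi_diff: "\<Phi> (a - b) = \<Phi> a - \<Phi> b"
  using Phi_add[of "a - b" b] by simp

lemma Phi_minus: "\<Phi> (- a) = - \<Phi> a"
  using Phi_diff[of 0 a] by (simp add: Phi_eq_0_iff)

lemma degree_times:
  "v \<noteq> 0 \<Longrightarrow> w \<noteq> 0 \<Longrightarrow> degree (tw_coeffs (v * w)) = degree (tw_coeffs v) + degree (tw_coeffs w)"
  unfolding times_twisted.rep_eq
  by (rule degree_tw_mult_field) (auto simp: zero_twisted.rep_eq simp flip: tw_coeffs_inject)

lemma degree_Phi: "a \<noteq> 0 \<Longrightarrow> degree (tw_coeffs (\<Phi> a)) = 2 * degree a"
  by (simp add: tw_coeffs_Phi degree_map_rho_psi)

text \<open>Division with remainder gives \<open>\<Phi> x (s - \<Phi> (y div x)) = \<Phi> r\<close>.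
  A nonzero left side has degree at least \<open>2 * degree x\<close>, too large for
  \<open>r\<close>.\<close>

lemma Phi_saturated:
  assumes x: "x \<noteq> 0" and eq: "\<Phi> x * s = \<Phi> y"
  shows "s \<in> range \<Phi>"
proof (rule ccontr)
  assume s: "s \<notin> range \<Phi>"
  define r where "r = y mod x"
  have "y = x * (y div x) + r" by (simp add: r_def)
  then have "\<Phi> y = \<Phi> x * \<Phi> (y div x) + \<Phi> r" by (metis Phi_add Phi_mult)
  then have r: "\<Phi> x * (s - \<Phi> (y div x)) = \<Phi> r" using eq by (simp add: right_diff_distrib)
  have "s - \<Phi> (y div x) \<noteq> 0" using s by auto
  moreover have "\<Phi> x \<noteq> 0" using x by (simp add: Phi_eq_0_iff)
  ultimately have "\<Phi> r \<noteq> 0" and "degree (tw_coeffs (\<Phi> r)) \<ge> 2 * degree x"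
    unfolding r[symmetric] by (simp_all add: degree_times degree_Phi x)
  then have "r \<noteq> 0" "degree r \<ge> degree x" by (auto simp: Phi_eq_0_iff degree_Phi)
  then show False using degree_mod_less[OF x, of y] by (simp add: r_def)
qed

lemma degree_pi: "degree (tw_coeffs \<pi>) = degree p" "\<pi> \<noteq> 0"
proof -
  have "tw_coeffs \<pi> = monom 1 (degree p)"
    unfolding \<pi>_def by (rule poly_eqI) simp
  then show "degree (tw_coeffs \<pi>) = degree p" "\<pi> \<noteq> 0"
    by (auto simp: degree_monom_eq zero_twisted.rep_eq simp flip: tw_coeffs_inject)
qed

text \<open>If \<open>\<pi> = \<Phi> c\<close>, then \<open>degree p = 2 * degree c\<close>, while
  the quadratic equation makes \<open>c\<close> divide \<open>p\<close>. Irreducibility leaves for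
  \<open>c\<close> only degree 0 or at least the degree of \<open>p\<close>.\<close>

lemma pi_notin:
  assumes quad: "\<pi> * \<pi> + \<Phi> a * \<pi> + \<Phi> (Polynomial.smult u p) = 0" and u: "u \<noteq> 0"
  shows "\<pi> \<notin> range \<Phi>"
proof
  assume "\<pi> \<in> range \<Phi>"
  then obtain c where c: "\<pi> = \<Phi> c" by blast
  have c0: "c \<noteq> 0" using degree_pi(2) c by (auto simp: Phi_eq_0_iff)
  have d: "degree p = 2 * degree c" using degree_pi(1) c0 by (simp add: c degree_Phi)
  have dp: "degree p > 0" using p_not_unit by (simp add: is_unit_iff_degree)
  have "\<Phi> (c * c + a * c + Polynomial.smult u p) = 0"
    using quad by (simp add: c Phi_add Phi_mult)
  then have "Polynomial.smult u p = c * (- c - a)" unfolding Phi_eq_0_iff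
    by (simp add: algebra_simps eq_neg_iff_add_eq_0)
  then have "c dvd Polynomial.smult u p" by simp
  then have "c dvd p" using u by (simp add: dvd_smult_iff)
  then have "is_unit c \<or> p dvd c" using irreducibleD'[OF irr] by blast
  then show False
  proof
    assume "is_unit c"
    then show False using d dp c0 by (simp add: is_unit_iff_degree)
  next
    assume "p dvd c"
    then have "degree p \<le> degree c" using c0 by (rule dvd_imp_degree_le)
    then show False using d dp by simp
  qed
qed

text \<open>Lifts to \<open>A\<close> of \<open>\<pi>^2 + a \<pi> + v\<close> and, next, of
  \<open>2 \<pi> + a - c\<close>. At a torsion point they agree modulo \<open>Q\<close> with the
  same expressions in \<open>\<sigma>\<close>.\<close>

definition quad_lift :: "'q poly \<Rightarrow> 'q poly \<Rightarrow> 'q poly poly" where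
  "quad_lift a v = tw_mult CARD('q) (monom 1 (degree p)) (monom 1 (degree p)) +
     tw_mult CARD('q) (\<phi> a) (monom 1 (degree p)) + \<phi> v"

definition linear_lift :: "'q poly \<Rightarrow> 'q poly \<Rightarrow> 'q poly poly" where
  "linear_lift a c = tw_mult CARD('q) (\<phi> 2) (monom 1 (degree p)) + \<phi> a - \<phi> c"

lemma bar_quad_lift: "bar (quad_lift a v) = \<pi> * \<pi> + \<Phi> a * \<pi> + \<Phi> v"
  by (simp only: quad_lift_def bar_add bar_tw_mult bar_phi \<pi>_def)

lemma bar_linear_lift: "bar (linear_lift a c) = \<Phi> 2 * \<pi> + \<Phi> a - \<Phi> c"
  by (simp add: linear_lift_def bar_add bar_diff bar_tw_mult \<pi>_def)

lemma Qp_evalA_frob: "Op x \<Longrightarrow> Qp (evalA (monom 1 (degree p)) x - \<sigma> x)"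
  using Qp_sym[OF Qp_frob[of x]] by (simp add: evalA_monom)

lemma Qp_evalA_phi_frob:
  assumes "N \<noteq> 0" "x \<in> tors N"
  shows "Qp (evalA (tw_mult CARD('q) (\<phi> a) (monom 1 (degree p))) x - act a (\<sigma> x))"
proof -
  have Ox: "Op x" and Osx: "Op (\<sigma> x)"
    using assms Op_tors sigma_tors by blast+
  have "Qp (evalA (\<phi> a) (evalA (monom 1 (degree p)) x) - evalA (\<phi> a) (\<sigma> x))"
    by (intro Qp_evalA_arg Op_evalA Ox Osx Qp_evalA_frob)
  moreover have "Qp (evalA (\<phi> a) (\<sigma> x) - act a (\<sigma> x))"
    by (rule Qp_sym[OF Qp_act_phi[OF Osx]])
  ultimately show ?thesis unfolding evalA_tw_mult by (rule Qp_trans)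
qed

lemma Qp_evalA_quad_lift:
  assumes "N \<noteq> 0" "x \<in> tors N"
  shows "Qp (evalA (quad_lift a v) x - (\<sigma> (\<sigma> x) + act a (\<sigma> x) + act v x))"
proof -
  have Ox: "Op x" and Osx: "Op (\<sigma> x)"
    using assms Op_tors sigma_tors by blast+
  let ?m = "monom 1 (degree p) :: 'q poly poly"
  have "Qp (evalA ?m (evalA ?m x) - evalA ?m (\<sigma> x))"
    by (intro Qp_evalA_arg Op_evalA Ox Osx Qp_evalA_frob)
  moreover have "Qp (evalA ?m (\<sigma> x) - \<sigma> (\<sigma> x))" by (rule Qp_evalA_frob[OF Osx])
  ultimately have 1: "Qp (evalA ?m (evalA ?m x) - \<sigma> (\<sigma> x))" by (rule Qp_trans)
  have 2: "Qp (evalA (tw_mult CARD('q) (\<phi> a) ?m) x - act a (\<sigma> x))"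
    by (rule Qp_evalA_phi_frob[OF assms])
  have 3: "Qp (evalA (\<phi> v) x - act v x)" by (rule Qp_sym[OF Qp_act_phi[OF Ox]])
  have "evalA (quad_lift a v) x - (\<sigma> (\<sigma> x) + act a (\<sigma> x) + act v x) =
    (evalA ?m (evalA ?m x) - \<sigma> (\<sigma> x)) + (evalA (tw_mult CARD('q) (\<phi> a) ?m) x - act a (\<sigma> x)) +
    (evalA (\<phi> v) x - act v x)"
    unfolding quad_lift_def evalA_add evalA_tw_mult[of ?m ?m] by (simp add: algebra_simps)
  then show ?thesis using Qp_add[OF Qp_add[OF 1 2] 3] by (simp only:)
qed

lemma Qp_evalA_linear_lift:
  assumes "N \<noteq> 0" "x \<in> tors N"
  shows "Qp (evalA (linear_lift a c) x - (twice_sigma a x - act c x))"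
proof -
  have Ox: "Op x" using assms Op_tors by blast
  let ?m = "monom 1 (degree p) :: 'q poly poly"
  have 1: "Qp (evalA (tw_mult CARD('q) (\<phi> 2) ?m) x - act 2 (\<sigma> x))"
    by (rule Qp_evalA_phi_frob[OF assms])
  have 2: "Qp (evalA (\<phi> a) x - act a x)" and 3: "Qp (evalA (\<phi> c) x - act c x)"
    by (rule Qp_sym[OF Qp_act_phi[OF Ox]])+
  have "evalA (linear_lift a c) x - (twice_sigma a x - act c x) =
    (evalA (tw_mult CARD('q) (\<phi> 2) ?m) x - act 2 (\<sigma> x)) + (evalA (\<phi> a) x - act a x) - (evalA (\<phi> c) x - act c x)"
    unfolding linear_lift_def evalA_add evalA_diff twice_sigma_def by (simp add: algebra_simps)
  then show ?thesis using Qp_diff[OF Qp_add[OF 1 2] 3] by (simp only:)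
qed

definition enough_torsion :: "'q poly \<Rightarrow> bool" where
  "enough_torsion N \<longleftrightarrow> (\<exists>S\<subseteq>tors N. finite S \<and> card S = CARD('q) ^ (2 * degree N))"

text \<open>A nonzero value would have \<open>\<Phi> (l^n)\<close> as a right factor for every
  \<open>n\<close>, against its fixed degree.\<close>

lemma pi_quad:
  assumes l: "irreducible l" "\<not> p dvd l"
    and pts: "\<And>n. enough_torsion (l ^ n)" and quad: "\<And>n. satisfies_quadratic a v (l ^ n)"
  shows "\<pi> * \<pi> + \<Phi> a * \<pi> + \<Phi> v = 0"
proof (rule ccontr)
  let ?f = "bar (quad_lift a v)"
  assume "\<pi> * \<pi> + \<Phi> a * \<pi> + \<Phi> v \<noteq> 0"
  then have f0: "?f \<noteq> 0" by (simp add: bar_quad_lift)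
  \<comment> \<open>\<open>n\<close> exceeds the degree of the expression, while the factor alone
    has degree \<open>2 n * degree l\<close>.\<close>
  define n where "n = Suc (degree (tw_coeffs ?f))"
  have l0: "l \<noteq> 0" and dl: "degree l > 0"
    using l(1) irreducible_not_unit[OF l(1)] by (auto simp: is_unit_iff_degree)
  have dN: "degree (l ^ n) = n * degree l" by (simp add: degree_power_eq l0)
  have pN: "\<not> p dvd l ^ n" using l(2) irreducible_poly_dvd_power[OF irr] by blast
  have N0: "l ^ n \<noteq> 0" using l0 by simp
  obtain S where S: "S \<subseteq> tors (l ^ n)" "finite S" "card S = CARD('q) ^ (2 * degree (l ^ n))"
    using pts[of n] by (auto simp: enough_torsion_def)
  have "\<exists>e. ?f = e * \<Phi> (l ^ n) \<and> (\<forall>i. coeff (tw_coeffs e) i \<in> range ev)"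
  proof (rule right_factor_if_kills[OF pN _ S])
    show "degree (l ^ n) > 0" unfolding dN using dl by (simp add: n_def)
    fix x assume x: "x \<in> tors (l ^ n)"
    show "Qp (evalA (quad_lift a v) x)"
      using Qp_evalA_quad_lift[OF N0 x, of a v] quad[of n] x by (simp add: satisfies_quadratic_def)
  qed
  then obtain e where e: "?f = e * \<Phi> (l ^ n)" by blast
  then have "e \<noteq> 0" using f0 by auto
  moreover have "\<Phi> (l ^ n) \<noteq> 0" using N0 by (simp add: Phi_eq_0_iff)
  ultimately have "degree (tw_coeffs ?f) = degree (tw_coeffs e) + 2 * (n * degree l)"
    unfolding e by (simp add: degree_times degree_Phi[OF N0] dN)
  moreover have "n \<le> n * degree l" using dl by simp
  ultimately show False by (simp add: n_def)
qed

text \<open>\<open>\<theta>'\<close> commutes with \<open>\<Phi> b\<close>, so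
  \<open>2 \<pi> + a = \<theta>' \<Phi> b\<close> kills the \<open>b\<close>-torsion modulo
  \<open>Q\<close>. The value at \<open>x\<close> is again \<open>b\<close>-torsion, and a point of
  order prime to \<open>p\<close> that vanishes modulo \<open>Q\<close> is 0.\<close>

lemma kills_torsion:
  assumes b: "\<not> p dvd b" and \<theta>: "\<theta>' \<in> \<E>" "\<Phi> 2 * \<pi> + \<Phi> a = \<Phi> b * \<theta>'" and x: "x \<in> tors b"
  shows "twice_sigma a x = 0"
proof -
  have b0: "b \<noteq> 0" using b by auto
  have Ox: "Op x" by (rule Op_tors[OF b0 x])
  obtain t where t: "bar t = \<theta>'" using E_eq_bar[OF \<theta>(1)] by blast
  have "\<Phi> b * \<theta>' = \<theta>' * \<Phi> b" using \<theta>(1) by (simp add: \<E>_def)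
  then have bars: "bar (linear_lift a 0) = bar (tw_mult CARD('q) t (\<phi> b))"
    using \<theta>(2) by (simp add: bar_linear_lift bar_tw_mult t Phi_eq_0_iff)
  have "Qp (act b x - evalA (\<phi> b) x)" by (rule Qp_act_phi[OF Ox])
  then have "Qp (evalA (\<phi> b) x - 0)" using x Qp_minus by (fastforce simp: tors_def)
  then have "Qp (evalA t (evalA (\<phi> b) x) - evalA t 0)"
    by (intro Qp_evalA_arg Op_evalA Ox) simp_all
  then have 1: "Qp (evalA (tw_mult CARD('q) t (\<phi> b)) x - 0)"
    by (simp add: evalA_at_0 evalA_tw_mult)
  have "Qp (evalA (linear_lift a 0) x - 0)"
    by (rule Qp_trans[OF Qp_evalA_bar[OF bars Ox] 1])
  moreover have "Qp ((twice_sigma a x - act 0 x) - evalA (linear_lift a 0) x)"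
    by (rule Qp_sym[OF Qp_evalA_linear_lift[OF b0 x]])
  ultimately have "Qp ((twice_sigma a x - act 0 x) - 0)" by (blast intro: Qp_trans)
  then have "Qp (twice_sigma a x)" by (simp add: tw_eval_def)
  moreover have "twice_sigma a x \<in> tors b"
    by (simp add: twice_sigma_def tors_add tors_act sigma_tors[OF b0 x] x)
  ultimately show ?thesis using tors_eq_0_if_Qp[OF b] by blast
qed

text \<open>The root count yields a right factor \<open>\<Phi> N\<close>; the quotient lies in
  \<open>\<E>\<close>, hence commutes with it, and the factor moves to the left.\<close>

lemma factor_if_scalar:
  assumes N: "\<not> p dvd N" "degree N > 0" "enough_torsion N"
    and scalar: "\<And>y. y \<in> tors N \<Longrightarrow> twice_sigma a y = act c y"
  shows "\<exists>e\<in>\<E>. \<Phi> 2 * \<pi> + \<Phi> a - \<Phi> c = \<Phi> N * e"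
proof -
  have N0: "N \<noteq> 0" using N by auto
  obtain S where S: "S \<subseteq> tors N" "finite S" "card S = CARD('q) ^ (2 * degree N)"
    using N(3) by (auto simp: enough_torsion_def)
  have "\<exists>e. bar (linear_lift a c) = e * \<Phi> N \<and> (\<forall>i. coeff (tw_coeffs e) i \<in> range ev)"
  proof (rule right_factor_if_kills[OF N(1,2) S])
    fix x assume x: "x \<in> tors N"
    show "Qp (evalA (linear_lift a c) x)"
      using Qp_evalA_linear_lift[OF N0 x, of a c] scalar[OF x] by simp
  qed
  then obtain e where e: "\<Phi> 2 * \<pi> + \<Phi> a - \<Phi> c = e * \<Phi> N" "\<forall>i. coeff (tw_coeffs e) i \<in> range ev"
    by (auto simp: bar_linear_lift)
  have "\<Phi> 2 * \<pi> + \<Phi> a + \<Phi> (- c) \<in> \<E>"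
    by (intro E_add E_mult Phi_in_E pi_in_E)
  then have "e * \<Phi> N \<in> \<E>" using e(1) by (simp add: Phi_minus)
  then have "e \<in> \<E>" using E_right_cancel N0 e(2) by blast
  moreover then have "e * \<Phi> N = \<Phi> N * e" by (simp add: \<E>_def)
  ultimately show ?thesis using e(1) by auto
qed

section \<open>Comparison with the concrete endomorphism ring and the Frobenius order\<close>

lemma bar_reduce [simp]: "bar (reduce_coeffs p f) = bar f"
  by (rule bar_eqI) (simp add: reduce_coeffs_def coeff_map_poly)

lemma reduce_coeffs_idem: "reduce_coeffs p (reduce_coeffs p f) = reduce_coeffs p f"
  by (rule poly_eqI) (simp add: reduce_coeffs_def coeff_map_poly)

lemma reduce_coeffs_add: "reduce_coeffs p (f + g) = reduce_coeffs p f + reduce_coeffs p g"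
  by (rule poly_eqI) (simp add: reduce_coeffs_def coeff_map_poly poly_mod_add_left)

lemma reduce_coeffs_minus: "reduce_coeffs p (- f) = - reduce_coeffs p f"
  by (rule poly_eqI) (simp add: reduce_coeffs_def coeff_map_poly poly_mod_minus_left)

lemma reduce_coeffs_eq_iff: "reduce_coeffs p f = reduce_coeffs p g \<longleftrightarrow> bar f = bar g"
  by (subst poly_eq_iff) (simp add: reduce_coeffs_def coeff_map_poly bar_eq_iff mod_eq_dvd_iff)

lemma endo_ring_iff: "f \<in> endo_ring p \<phi> \<longleftrightarrow> reduce_coeffs p f = f \<and> bar f \<in> \<E>"
  by (simp add: endo_ring_def residue_twisted_ring_def bar_in_E_iff reduce_coeffs_eq_iff bar_tw_mult)

lemma bar_endo_smult: "bar (endo_smult p \<phi> a f) = \<Phi> a * bar f"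
  by (simp add: endo_smult_def residue_twisted_ring_def bar_tw_mult)

lemma endo_smult_closed: "f \<in> endo_ring p \<phi> \<Longrightarrow> endo_smult p \<phi> a f \<in> endo_ring p \<phi>"
  by (simp add: endo_ring_iff bar_endo_smult E_mult Phi_in_E)
     (simp add: endo_smult_def residue_twisted_ring_def reduce_coeffs_idem)

lemma bar_sum: "bar (\<Sum>i\<in>A. f i) = (\<Sum>i\<in>A. bar (f i))"
  by (induction A rule: infinite_finite_induct) (simp_all add: bar_add)

lemma bar_monom_power: "bar (monom 1 (degree p * i)) = \<pi> ^ i"
proof (induction i)
  case 0
  show ?case by (rule bar_eqI) (simp add: one_twisted.rep_eq coeff_1)
next
  case (Suc i)
  have "monom 1 (degree p * Suc i) = tw_mult CARD('q) (monom 1 (degree p)) (monom 1 (degree p * i) :: 'q poly poly)"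
    by (simp add: tw_mult_monom_monom[OF card_pos])
  then show ?case by (simp only: bar_tw_mult Suc power_Suc \<pi>_def)
qed

context
  fixes a v
  assumes quad: "\<pi> * \<pi> + \<Phi> a * \<pi> + \<Phi> v = 0"
begin

lemma pi_power: "\<exists>c e. \<pi> ^ i = \<Phi> c + \<Phi> e * \<pi>"
proof (induction i)
  case 0
  show ?case by (intro exI[of _ 1] exI[of _ 0]) (simp add: Phi_1 Phi_eq_0_iff)
next
  case (Suc i)
  then obtain c e where ce: "\<pi> ^ i = \<Phi> c + \<Phi> e * \<pi>" by blast
  have sq: "\<pi> * \<pi> = - (\<Phi> a * \<pi> + \<Phi> v)"
    using quad by (metis add.assoc add_eq_0_iff2)
  have "\<pi> ^ Suc i = \<Phi> c * \<pi> + \<Phi> e * (\<pi> * \<pi>)"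
    by (simp only: power_Suc2 ce distrib_right mult.assoc)
  also have "\<dots> = \<Phi> (- (e * v)) + \<Phi> (c - e * a) * \<pi>"
    unfolding sq
    by (simp add: Phi_diff Phi_minus Phi_mult left_diff_distrib right_diff_distrib mult.assoc)
  finally show ?case by blast
qed

text \<open>The quadratic equation reduces every power of \<open>\<pi>\<close> to
  \<open>A + A \<pi>\<close>.\<close>

lemma frob_order_iff:
  "f \<in> frob_order p \<phi> \<longleftrightarrow> reduce_coeffs p f = f \<and> (\<exists>c e. bar f = \<Phi> c + \<Phi> e * \<pi>)"
proof
  assume "f \<in> frob_order p \<phi>"
  then obtain g where g: "f = (\<Sum>i\<le>degree g. endo_smult p \<phi> (coeff g i) (monom 1 (degree p * i)))"
    unfolding frob_order_def by blast
  have red: "reduce_coeffs p (\<Sum>i\<in>A. endo_smult p \<phi> (coeff g i) (monom 1 (degree p * i))) =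
      (\<Sum>i\<in>A. endo_smult p \<phi> (coeff g i) (monom 1 (degree p * i)))" for A
    by (induction A rule: infinite_finite_induct)
       (simp_all add: reduce_coeffs_add endo_smult_def residue_twisted_ring_def reduce_coeffs_idem,
        simp_all add: reduce_coeffs_def)
  have "\<exists>c e. (\<Sum>i\<in>A. \<Phi> (coeff g i) * \<pi> ^ i) = \<Phi> c + \<Phi> e * \<pi>" for A
  proof (induction A rule: infinite_finite_induct)
    case (insert i A)
    then obtain c e c' e' where *: "(\<Sum>i\<in>A. \<Phi> (coeff g i) * \<pi> ^ i) = \<Phi> c + \<Phi> e * \<pi>"
      "\<pi> ^ i = \<Phi> c' + \<Phi> e' * \<pi>" using pi_power[of i] by blast
    have "(\<Sum>i\<in>insert i A. \<Phi> (coeff g i) * \<pi> ^ i) =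
        \<Phi> (coeff g i) * (\<Phi> c' + \<Phi> e' * \<pi>) + (\<Phi> c + \<Phi> e * \<pi>)"
      using insert by (simp add: *)
    also have "\<dots> = \<Phi> (coeff g i * c' + c) + \<Phi> (coeff g i * e' + e) * \<pi>"
      by (simp add: Phi_add Phi_mult distrib_left distrib_right mult.assoc)
    finally show ?case by blast
  qed (use Phi_eq_0_iff[of 0] in \<open>auto intro!: exI[of _ 0]\<close>)
  then show "reduce_coeffs p f = f \<and> (\<exists>c e. bar f = \<Phi> c + \<Phi> e * \<pi>)"
    unfolding g using red by (simp add: bar_sum bar_endo_smult bar_monom_power)
next
  assume "reduce_coeffs p f = f \<and> (\<exists>c e. bar f = \<Phi> c + \<Phi> e * \<pi>)"
  then obtain c e where f: "reduce_coeffs p f = f" "bar f = \<Phi> c + \<Phi> e * \<pi>" by blast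
  define h where "h i = endo_smult p \<phi> (coeff [:c, e:] i) (monom 1 (degree p * i))" for i
  have rh: "reduce_coeffs p (h i) = h i" for i
    by (simp add: h_def endo_smult_def residue_twisted_ring_def reduce_coeffs_idem)
  \<comment> \<open>For \<open>e = 0\<close> the polynomial \<open>[:c, e:]\<close> has degree 0,
    and its sum stops before index 1.\<close>
  have h1: "h 1 = 0" if "e = 0"
  proof -
    have "bar (h 1) = bar 0" using that Phi_eq_0_iff[of 0] by (simp add: h_def bar_endo_smult)
    then have "reduce_coeffs p (h 1) = reduce_coeffs p 0" by (simp only: reduce_coeffs_eq_iff)
    then show ?thesis using rh[of 1] by (simp add: reduce_coeffs_def)
  qed
  have "(\<Sum>i\<le>degree [:c, e:]. h i) = h 0 + h 1"
    using h1 by (cases "e = 0") (simp_all add: degree_pCons_eq_if)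
  moreover have "f = h 0 + h 1"
  proof -
    have "bar (h 0 + h 1) = bar f"
      unfolding f(2) bar_add h_def bar_endo_smult bar_monom_power by simp
    then have "reduce_coeffs p (h 0 + h 1) = reduce_coeffs p f" by (simp only: reduce_coeffs_eq_iff)
    then show ?thesis by (simp add: reduce_coeffs_add rh f(1))
  qed
  ultimately have "f = (\<Sum>i\<le>degree [:c, e:]. h i)" by simp
  then show "f \<in> frob_order p \<phi>" unfolding frob_order_def h_def by blast
qed

end

end

text \<open>\<open>\<alpha>\<close> represents the preimage of the class of 1. Linearity then sends
  the class of \<open>s y \<alpha>\<close> to that of \<open>y\<close>, which is zero exactly for
  multiples of \<open>b\<close>.\<close>

lemma quot_modules_iso_cyclic:
  fixes M N :: "'a::ab_group_add set" and b :: "'r::comm_ring_1"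
  assumes iso: "quot_modules_iso s M N (*) UNIV (range ((*) b))"
    and N: "0 \<in> N" "\<And>x y. x \<in> N \<Longrightarrow> y \<in> N \<Longrightarrow> x + y \<in> N" "\<And>x. x \<in> N \<Longrightarrow> - x \<in> N"
    and s: "\<And>r x. x \<in> M \<Longrightarrow> s r x \<in> M" "\<And>x. x \<in> M \<Longrightarrow> s 0 x = 0"
  shows "\<exists>\<alpha>\<in>M. (\<forall>x\<in>M. \<exists>y. x - s y \<alpha> \<in> N) \<and> (\<forall>y. s y \<alpha> \<in> N \<longleftrightarrow> b dvd y)"
proof -
  let ?G = "additive_group M" and ?H = "additive_group (UNIV :: 'r set)" and ?B = "range ((*) b)"
  obtain h where h: "h \<in> iso (?G Mod N) (?H Mod ?B)"
    and lin: "\<And>r x y. x \<in> M \<Longrightarrow> h (N #>\<^bsub>?G\<^esub> x) = ?B #>\<^bsub>?H\<^esub> y \<Longrightarrow>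
      h (N #>\<^bsub>?G\<^esub> s r x) = ?B #>\<^bsub>?H\<^esub> (r * y)"
    using iso unfolding quot_modules_iso_def by blast
  have coset: "C #>\<^bsub>additive_group L\<^esub> x = (\<lambda>n. n + x) ` C" for C L and x :: "'z::ab_group_add"
    by (auto simp: r_coset_def additive_group_def)
  have coset_eq: "(C #>\<^bsub>additive_group L\<^esub> x = C #>\<^bsub>additive_group L\<^esub> y) \<longleftrightarrow> x - y \<in> C"
    if C: "0 \<in> C" "\<And>x y. x \<in> C \<Longrightarrow> y \<in> C \<Longrightarrow> x + y \<in> C" "\<And>x. x \<in> C \<Longrightarrow> - x \<in> C"
    for C L and x y :: "'z::ab_group_add"
  proof
    assume "C #>\<^bsub>additive_group L\<^esub> x = C #>\<^bsub>additive_group L\<^esub> y"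
    moreover have "x \<in> C #>\<^bsub>additive_group L\<^esub> x" using C(1) unfolding coset by force
    ultimately show "x - y \<in> C" unfolding coset by auto
  next
    assume xy: "x - y \<in> C"
    have "n + x = (n + (x - y)) + y" "n + y = (n + - (x - y)) + x" for n by simp_all
    then have "n + x \<in> (\<lambda>n. n + y) ` C" "n + y \<in> (\<lambda>n. n + x) ` C" if "n \<in> C" for n
      using C(2)[OF that xy] C(2)[OF that C(3)[OF xy]] by (metis image_eqI)+
    then show "C #>\<^bsub>additive_group L\<^esub> x = C #>\<^bsub>additive_group L\<^esub> y"
      unfolding coset by (intro equalityI image_subsetI)
  qed
  have cN: "N #>\<^bsub>?G\<^esub> x = N #>\<^bsub>?G\<^esub> y \<longleftrightarrow> x - y \<in> N" for x y
    by (rule coset_eq) (use N in auto)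
  have cB: "?B #>\<^bsub>?H\<^esub> x = ?B #>\<^bsub>?H\<^esub> y \<longleftrightarrow> b dvd x - y" for x y
  proof -
    have "?B #>\<^bsub>?H\<^esub> x = ?B #>\<^bsub>?H\<^esub> y \<longleftrightarrow> x - y \<in> ?B"
    proof (rule coset_eq)
      show "0 \<in> ?B" by (rule range_eqI[of _ _ 0]) simp
      show "u + w \<in> ?B" if "u \<in> ?B" "w \<in> ?B" for u w
        using that by (auto simp flip: distrib_left)
      show "- u \<in> ?B" if "u \<in> ?B" for u
        using that by (auto simp flip: mult_minus_right)
    qed
    then show ?thesis by (auto simp: dvd_def)
  qed
  have carG: "carrier (?G Mod N) = {N #>\<^bsub>?G\<^esub> x | x. x \<in> M}"
    by (auto simp: FactGroup_def RCOSETS_def additive_group_def)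
  have carH: "carrier (?H Mod ?B) = {?B #>\<^bsub>?H\<^esub> x | x. True}"
    by (auto simp: FactGroup_def RCOSETS_def additive_group_def)
  have bij: "bij_betw h (carrier (?G Mod N)) (carrier (?H Mod ?B))"
    using h by (simp add: iso_def)
  have "?B #>\<^bsub>?H\<^esub> 1 \<in> h ` carrier (?G Mod N)"
    using bij carH unfolding bij_betw_def by blast
  then obtain \<alpha> where \<alpha>: "\<alpha> \<in> M" "h (N #>\<^bsub>?G\<^esub> \<alpha>) = ?B #>\<^bsub>?H\<^esub> 1"
    unfolding carG by auto
  have h\<alpha>: "h (N #>\<^bsub>?G\<^esub> s y \<alpha>) = ?B #>\<^bsub>?H\<^esub> y" for y
    using lin[OF \<alpha>, of y] by simp
  have inj: "x - z \<in> N \<longleftrightarrow> h (N #>\<^bsub>?G\<^esub> x) = h (N #>\<^bsub>?G\<^esub> z)" if "x \<in> M" "z \<in> M" for x z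
  proof -
    have "N #>\<^bsub>?G\<^esub> x \<in> carrier (?G Mod N)" "N #>\<^bsub>?G\<^esub> z \<in> carrier (?G Mod N)"
      using that carG by blast+
    then show ?thesis
      unfolding cN[symmetric] by (rule inj_on_eq_iff[OF bij_betw_imp_inj_on[OF bij], symmetric])
  qed
  have "\<exists>y. x - s y \<alpha> \<in> N" if x: "x \<in> M" for x
  proof -
    have "h (N #>\<^bsub>?G\<^esub> x) \<in> carrier (?H Mod ?B)"
      using bij carG x unfolding bij_betw_def by blast
    then obtain y where "h (N #>\<^bsub>?G\<^esub> x) = ?B #>\<^bsub>?H\<^esub> y" unfolding carH by blast
    then have "x - s y \<alpha> \<in> N" using inj[OF x s(1)[OF \<alpha>(1)]] h\<alpha> by simp
    then show ?thesis by blast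
  qed
  moreover have "s y \<alpha> \<in> N \<longleftrightarrow> b dvd y" for y
  proof -
    have "s y \<alpha> \<in> N \<longleftrightarrow> s y \<alpha> - s 0 \<alpha> \<in> N" using s(2)[OF \<alpha>(1)] by simp
    also have "\<dots> \<longleftrightarrow> ?B #>\<^bsub>?H\<^esub> y = ?B #>\<^bsub>?H\<^esub> 0"
      using inj[OF s(1)[OF \<alpha>(1)] s(1)[OF \<alpha>(1)], of y 0] h\<alpha> by simp
    finally show ?thesis unfolding cB by simp
  qed
  ultimately show ?thesis using \<alpha>(1) by blast
qed

section \<open>Torsion points and the Tate module\<close>

lemma det_mat_2:
  fixes A :: "'a::comm_ring_1 mat"
  assumes "A \<in> carrier_mat 2 2"
  shows "det A = A $$ (0,0) * A $$ (1,1) - A $$ (0,1) * A $$ (1,0)"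
proof -
  have "det A = (\<Sum>i<2. A $$ (i,0) * cofactor A i 0)"
    by (rule laplace_expansion_column[OF assms]) simp
  also have "\<dots> = A $$ (0,0) * A $$ (1,1) - A $$ (0,1) * A $$ (1,0)"
  proof -
    have "det (mat_delete A i 0) = mat_delete A i 0 $$ (0,0)" for i
      by (rule det_single) (use assms in \<open>simp add: mat_delete_def\<close>)
    then show ?thesis
      using assms by (simp add: cofactor_def numeral_2_eq_2 mat_delete_def mult.commute)
  qed
  finally show ?thesis .
qed

lemma char_poly_mat_2:
  fixes f :: "nat \<Rightarrow> nat \<Rightarrow> 'a::comm_ring_1"
  shows "char_poly (mat 2 2 (\<lambda>(i, j). f i j)) =
    [:f 0 0 * f 1 1 - f 0 1 * f 1 0, - (f 0 0 + f 1 1), 1:]"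
proof -
  have "char_poly_matrix (mat 2 2 (\<lambda>(i, j). f i j)) \<in> carrier_mat 2 2"
    by (simp add: char_poly_matrix_def)
  from det_mat_2[OF this] show ?thesis
    unfolding char_poly_def by (simp add: char_poly_matrix_def algebra_simps)
qed

context tw_rep
begin

text \<open>The additive polynomial minus \<open>x\<close> has the linear coefficient
  \<open>b\<close>, so it is not constant and has a root.\<close>

lemma act_surj:
  assumes "b \<noteq> 0"
  shows "\<exists>y. act b y = x"
proof -
  let ?q = "CARD('q)"
  define f where "f = add_poly to_ac ?q (\<psi> b) - [:x:]"
  have "coeff (add_poly to_ac ?q (\<psi> b)) (?q ^ 0) = to_ac (coeff (\<psi> b) 0)"
    by (rule coeff_add_poly[OF two_le_card]) simp
  then have "coeff f 1 \<noteq> 0" using assms by (simp add: f_def coeff_0_psi)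
  then have "degree f > 0" using le_degree[of f 1] by simp
  then obtain y where "poly f y = 0" using alg_closed_imp_poly_has_root by blast
  then show ?thesis by (auto simp: f_def poly_add_poly tw_eval_add_eval)
qed

lemma torsion_basis_iff: "torsion_basis r \<psi> m w \<longleftrightarrow> tors_basis r m w"
  by (simp add: torsion_basis_def tors_basis_def torsion_def tors_def)

text \<open>Level \<open>n\<close> of the Tate basis is a basis of the \<open>l^n\<close>-torsion,
  and modulo \<open>l^n\<close> the characteristic polynomial fixes trace and determinant of the
  matrix there.\<close>

lemma tate_torsion:
  assumes gal: "galois_action (\<lambda>a x. tw_eval (\<psi> a) x) \<sigma>" and l: "irreducible l"
    and tate: "tate_char_poly 2 \<psi> l \<sigma> [:v, a, 1:]"
  shows "\<exists>w. tors_basis 2 (l ^ n) w"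
    and "galois_action.satisfies_quadratic (\<lambda>a x. tw_eval (\<psi> a) x) \<sigma> a v (l ^ n)"
proof -
  interpret galois_action "\<lambda>a x. tw_eval (\<psi> a) x" \<sigma> by (rule gal)
  obtain e M where e: "tate_basis 2 \<psi> l e"
    and M: "\<And>j. j < 2 \<Longrightarrow> (\<lambda>n. \<sigma> (e j n)) = tate_comb 2 \<psi> (\<lambda>i. M i j) e"
    and cp: "\<And>n. map_poly (\<lambda>c. c mod l ^ n) (char_poly (mat 2 2 (\<lambda>(i, j). M i j n))) =
           map_poly (\<lambda>c. c mod l ^ n) [:v, a, 1:]"
    using tate unfolding tate_char_poly_def by blast
  have l0: "l \<noteq> 0" using l by auto
  have w: "tors_basis 2 (l ^ n) (\<lambda>i. e i n)"
  proof (rule tors_basis_of_tate)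
    show "\<exists>y. act l y = x" for x by (rule act_surj[OF l0])
    show "e i 0 = 0" "act l (e i (Suc n)) = e i n" if "i < 2" for i n
      using e that by (auto simp: tate_basis_def tate_module_def)
    fix x :: "nat \<Rightarrow> 'q closure"
    assume "x 0 = 0" "\<And>n. act l (x (Suc n)) = x n"
    then have "x \<in> tate_module \<psi> l" by (simp add: tate_module_def)
    then show "\<exists>!\<alpha>. (\<forall>i<2. \<alpha> i \<in> adic_ints l) \<and> (\<forall>i\<ge>2. \<alpha> i = (\<lambda>_. 0)) \<and>
        x = (\<lambda>n. \<Sum>i<2. act (\<alpha> i n) (e i n))"
      using e unfolding tate_basis_def tate_comb_def by blast
  qed
  then show "\<exists>w. tors_basis 2 (l ^ n) w" by blast
  show "satisfies_quadratic a v (l ^ n)"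
  proof (rule satisfies_quadratic_of_matrix[OF _ w, where M = "\<lambda>i j. M i j n"])
    show "l ^ n \<noteq> 0" using l0 by simp
    show "\<sigma> (e j n) = (\<Sum>i<2. act (M i j n) (e i n))" if "j < 2" for j
      using fun_cong[OF M[OF that], of n] by (simp add: tate_comb_def)
    have c: "coeff (char_poly (mat 2 2 (\<lambda>(i, j). M i j n))) k mod l ^ n = coeff [:v, a, 1:] k mod l ^ n" for k
    proof -
      have "coeff (map_poly (\<lambda>c. c mod l ^ n) f) k = coeff f k mod l ^ n" for f
        by (simp add: coeff_map_poly)
      then show ?thesis using cp[of n] by metis
    qed
    show "l ^ n dvd M 0 0 n * M 1 1 n - M 0 1 n * M 1 0 n - v"
      using c[of 0] unfolding char_poly_mat_2 by (simp add: mod_eq_dvd_iff)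
    have "l ^ n dvd - (M 0 0 n + M 1 1 n) - a"
      using c[of 1] unfolding char_poly_mat_2 by (simp add: mod_eq_dvd_iff)
    moreover have "- (M 0 0 n + M 1 1 n) - a = - (M 0 0 n + M 1 1 n + a)" by simp
    ultimately show "l ^ n dvd M 0 0 n + M 1 1 n + a" by (simp only: dvd_minus_iff)
  qed
qed

text \<open>The Tate modules give both properties for prime powers; coprime factors are then
  glued.\<close>

lemma torsion_structure:
  assumes gal: "galois_action (\<lambda>a x. tw_eval (\<psi> a) x) \<sigma>"
    and tate: "\<And>l. lead_coeff l = 1 \<Longrightarrow> irreducible l \<Longrightarrow> l \<noteq> p \<Longrightarrow> tate_char_poly 2 \<psi> l \<sigma> [:v, a, 1:]"
    and p: "irreducible p" and N: "N \<noteq> 0" "\<not> p dvd N"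
  shows "(\<exists>w. tors_basis 2 N w) \<and> galois_action.satisfies_quadratic (\<lambda>a x. tw_eval (\<psi> a) x) \<sigma> a v N"
proof -
  interpret galois_action "\<lambda>a x. tw_eval (\<psi> a) x" \<sigma> by (rule gal)
  show ?thesis
    using N
  proof (induction N rule: poly_coprime_induct)
    case (unit N)
    have "tors_basis 2 N (\<lambda>_. 0)"
      by (rule tors_basis_associated[OF tors_basis_1]) (use unit in auto)
    have zero: "x = 0" if "x \<in> tors N" for x
    proof -
      have "x \<in> tors 1" using tors_dvd[OF that] unit by blast
      then have "act 1 x = 0" unfolding tors_def by blast
      then show ?thesis using act_1[of x] by metis
    qed
    have "satisfies_quadratic a v N"
      unfolding satisfies_quadratic_def
    proof
      fix x assume "x \<in> tors N"
      then have "x = 0" by (rule zero)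
      then show "\<sigma> (\<sigma> x) + act a (\<sigma> x) + act v x = 0" by simp
    qed
    with \<open>tors_basis 2 N (\<lambda>_. 0)\<close> show ?case by blast
  next
    case (step l k N)
    have "l \<noteq> p" using step by (metis dvd_mult2 dvd_power)
    note t = tate_torsion[OF gal step.hyps(2) tate[OF step.hyps(1,2) this]]
    have N: "\<not> p dvd N" using step.prems by auto
    obtain w1 where w1: "tors_basis 2 (l ^ k) w1" using t(1) by blast
    obtain w2 where w2: "tors_basis 2 N w2" and q2: "satisfies_quadratic a v N" using step N by blast
    have "tors_basis 2 (l ^ k * N) (\<lambda>i. w1 i + w2 i)"
      by (rule tors_basis_mult[OF w1 w2 \<open>coprime (l ^ k) N\<close>])
    moreover have "satisfies_quadratic a v (l ^ k * N)"
      by (rule satisfies_quadratic_mult[OF _ \<open>N \<noteq> 0\<close> \<open>coprime (l ^ k) N\<close> t(2) q2]) (use step.hyps(2) in auto)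
    ultimately show ?case by blast
  qed
qed

end

text \<open>The twisting constant may fail to be integral at \<open>p\<close>, so multiplicativity
  is taken from membership in the separable closure and not from p-integrality.\<close>

lemma (in frobenius_place) sigma_scale:
  assumes "x \<in> sep_closure"
  shows "\<sigma> (to_ac c * x) = to_ac c * \<sigma> x"
  using sigma assms to_ac_in_sep_closure[of c]
  by (auto simp: abs_galois_def ring_iso_def ring_hom_def ring_of_type_algebra_def)

lemma (in reduction) frobenius_order_exists:
  assumes quad: "\<pi> * \<pi> + \<Phi> a * \<pi> + \<Phi> (Polynomial.smult u p) = 0" and u: "u \<noteq> 0"
    and two: "(2 :: 'q) \<noteq> 0" and b: "b \<noteq> 0"
    and disc: "a\<^sup>2 - 4 * Polynomial.smult u p = b\<^sup>2 * \<delta>"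
    and iso: "quot_modules_iso (endo_smult p \<phi>) (endo_ring p \<phi>) (frob_order p \<phi>) (*) UNIV (range ((*) b))"
  shows "\<exists>\<alpha>. frobenius_order \<Phi> \<E> \<pi> \<alpha> a (Polynomial.smult u p) b \<delta>"
proof -
  note fo = frob_order_iff[OF quad]
  have "\<exists>\<alpha>\<in>endo_ring p \<phi>. (\<forall>x\<in>endo_ring p \<phi>. \<exists>y. x - endo_smult p \<phi> y \<alpha> \<in> frob_order p \<phi>) \<and>
      (\<forall>y. endo_smult p \<phi> y \<alpha> \<in> frob_order p \<phi> \<longleftrightarrow> b dvd y)"
  proof (rule quot_modules_iso_cyclic[OF iso])
    show "0 \<in> frob_order p \<phi>"
      unfolding fo using Phi_eq_0_iff[of 0] by (auto simp: reduce_coeffs_def intro!: exI[of _ 0])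
    show "f + g \<in> frob_order p \<phi>" if fg: "f \<in> frob_order p \<phi>" "g \<in> frob_order p \<phi>" for f g
    proof -
      obtain c e c' e' where *: "bar f = \<Phi> c + \<Phi> e * \<pi>" "bar g = \<Phi> c' + \<Phi> e' * \<pi>"
        using fg unfolding fo by blast
      have "bar (f + g) = \<Phi> (c + c') + \<Phi> (e + e') * \<pi>"
        by (simp add: bar_add * Phi_add distrib_right)
      then show ?thesis using fg unfolding fo reduce_coeffs_add by auto
    qed
    show "- f \<in> frob_order p \<phi>" if f: "f \<in> frob_order p \<phi>" for f
    proof -
      obtain c e where *: "bar f = \<Phi> c + \<Phi> e * \<pi>" using f unfolding fo by blast
      have "bar (- f) = \<Phi> (- c) + \<Phi> (- e) * \<pi>"
        using bar_diff[of 0 f] by (simp add: * Phi_minus)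
      then show ?thesis using f unfolding fo reduce_coeffs_minus by auto
    qed
    show "endo_smult p \<phi> r f \<in> endo_ring p \<phi>" if "f \<in> endo_ring p \<phi>" for r f
      by (rule endo_smult_closed[OF that])
    show "endo_smult p \<phi> 0 f = 0" if "f \<in> endo_ring p \<phi>" for f
    proof -
      have "bar (endo_smult p \<phi> 0 f) = bar 0" using Phi_eq_0_iff[of 0] by (simp add: bar_endo_smult)
      then have "reduce_coeffs p (endo_smult p \<phi> 0 f) = reduce_coeffs p 0" by (simp only: reduce_coeffs_eq_iff)
      then show ?thesis
        using endo_smult_closed[OF that, of 0] by (simp add: endo_ring_iff reduce_coeffs_def)
    qed
  qed
  then obtain \<alpha> where \<alpha>: "\<alpha> \<in> endo_ring p \<phi>"
    and gen: "\<And>x. x \<in> endo_ring p \<phi> \<Longrightarrow> \<exists>y. x - endo_smult p \<phi> y \<alpha> \<in> frob_order p \<phi>"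
    and ord: "\<And>y. endo_smult p \<phi> y \<alpha> \<in> frob_order p \<phi> \<longleftrightarrow> b dvd y" by blast
  have "frobenius_order \<Phi> \<E> \<pi> (bar \<alpha>) a (Polynomial.smult u p) b \<delta>"
  proof
    show "\<exists>y c e. s = \<Phi> y * bar \<alpha> + (\<Phi> c + \<Phi> e * \<pi>)" if s: "s \<in> \<E>" for s
    proof -
      obtain f where f: "bar f = s" "reduce_coeffs p f = f" using E_eq_bar[OF s] by blast
      then have "f \<in> endo_ring p \<phi>" using s by (simp add: endo_ring_iff)
      then obtain y c e where "bar (f - endo_smult p \<phi> y \<alpha>) = \<Phi> c + \<Phi> e * \<pi>"
        using gen[of f] unfolding fo by blast
      then have "s = \<Phi> y * bar \<alpha> + (\<Phi> c + \<Phi> e * \<pi>)"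
        by (simp add: bar_diff bar_endo_smult f(1) algebra_simps)
      then show ?thesis by blast
    qed
    show "(\<exists>c e. \<Phi> y * bar \<alpha> = \<Phi> c + \<Phi> e * \<pi>) \<longleftrightarrow> b dvd y" for y
      using ord[of y] endo_smult_closed[OF \<alpha>, of y] unfolding fo by (simp add: bar_endo_smult endo_ring_iff)
    show "s \<in> range \<Phi>" if "x \<noteq> 0" "\<Phi> x * s = \<Phi> y" for x s y
      by (rule Phi_saturated[OF that])
    show "\<pi> \<notin> range \<Phi>" by (rule pi_notin[OF quad u])
    show "s * \<Phi> x = \<Phi> x * s" if "s \<in> \<E>" for s x
      using that by (simp add: \<E>_def)
  qed (use \<alpha> quad two b disc in
      \<open>auto simp: Phi_add Phi_mult Phi_1 Phi_in_E E_add E_mult pi_in_E endo_ring_iff\<close>)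
  then show ?thesis by blast
qed

section \<open>Consequences of odd characteristic\<close>

lemma two_neq_0_if_odd_card:
  assumes "odd CARD('q::{finite,field})"
  shows "(2 :: 'q) \<noteq> 0"
proof
  assume "(2 :: 'q) = 0"
  obtain k where k: "CARD('q) = 2 * k + 1" using assms by (elim oddE)
  have "of_nat CARD('q) = (0 :: 'q)"
    using of_nat_card_choose_eq_0[of 1, where ?'q = 'q] two_le_card[where ?'q = 'q] by simp
  then have "2 * of_nat k + 1 = (0 :: 'q)" unfolding k by (simp add: add.commute)
  then show False using \<open>(2 :: 'q) = 0\<close> by simp
qed

text \<open>If \<open>p\<close> divided \<open>b\<close>, it would divide \<open>a^2\<close>, hence
  \<open>a\<close>; then \<open>p^2\<close> would divide \<open>4 u p\<close>, although
  \<open>4 u\<close> is a nonzero constant.\<close>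

lemma not_dvd_conductor:
  fixes p a b \<delta> :: "'q::field poly"
  assumes p: "irreducible p" and u: "u \<noteq> 0" and two: "(2 :: 'q) \<noteq> 0"
    and disc: "a\<^sup>2 - 4 * Polynomial.smult u p = b\<^sup>2 * \<delta>"
  shows "\<not> p dvd b"
proof
  assume pb: "p dvd b"
  have p0: "p \<noteq> 0" using p by auto
  have four: "4 * Polynomial.smult u p = Polynomial.smult (4 * u) p" by (simp add: numeral_poly mult.commute)
  have a2: "a\<^sup>2 = b\<^sup>2 * \<delta> + 4 * Polynomial.smult u p" using disc by (simp add: algebra_simps)
  have "p dvd a\<^sup>2"
    unfolding a2 four using pb by (intro dvd_add dvd_smult dvd_refl) (auto simp: power2_eq_square)
  then have "p dvd a" by (rule irreducible_poly_dvd_power[OF p])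
  then have "p * p dvd a\<^sup>2 - b\<^sup>2 * \<delta>"
    using pb unfolding power2_eq_square by (intro dvd_diff dvd_mult2 mult_dvd_mono)
  also have "a\<^sup>2 - b\<^sup>2 * \<delta> = Polynomial.smult (4 * u) p" using a2 four by simp
  finally have "p * p dvd p"
  proof -
    have "(4 :: 'q) = 2 * 2" by simp
    then have "4 * u \<noteq> 0" using u two by (metis mult_eq_0_iff)
    moreover assume "p * p dvd Polynomial.smult (4 * u) p"
    ultimately show ?thesis by (simp add: dvd_smult_iff)
  qed
  then have "is_unit p" using p0 by simp
  then show False using irreducible_not_unit[OF p] by blast
qed

lemma coprime_smult_right:
  fixes m p :: "'q::field poly"
  assumes "coprime m p" "u \<noteq> 0"
  shows "coprime (Polynomial.smult u p) m"
proof (rule coprimeI)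
  fix d assume "d dvd Polynomial.smult u p" "d dvd m"
  then show "is_unit d" using assms coprime_common_divisor by (metis dvd_smult_iff)
qed

lemma dvd_if_dvd_twice:
  fixes m z :: "'q::field poly"
  assumes "(2 :: 'q) \<noteq> 0" "m dvd 2 * z"
  shows "m dvd z"
proof -
  have "2 * z = Polynomial.smult 2 z" by (simp add: numeral_poly)
  then show ?thesis using assms by (simp add: dvd_smult_iff)
qed

lemma twice_smult_half:
  fixes z :: "'q::field poly"
  assumes "(2 :: 'q) \<noteq> 0"
  shows "2 * Polynomial.smult (1/2) z = z"
  using assms by (simp add: numeral_poly)

theorem theorem1p1:
  fixes \<psi> :: "'q::{finite,field} poly \<Rightarrow> 'q ratfun poly"
    and \<phi> :: "'q poly \<Rightarrow> 'q poly poly"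
    and p a b \<delta> m :: "'q poly"
    and u :: 'q
    and \<sigma> :: "'q closure \<Rightarrow> 'q closure"
  assumes "odd CARD('q)"
    and "drinfeld_module 2 \<psi>"
    and "p \<in> good_primes 2 \<psi>"
    and "is_reduction 2 \<psi> p \<phi>"
    and "u \<noteq> 0"
    and "weil_poly 2 \<psi> p [:Polynomial.smult u p, a, 1:]"
    and "lead_coeff b = 1"
    and "quot_modules_iso (endo_smult p \<phi>) (endo_ring p \<phi>) (frob_order p \<phi>)
           (*) UNIV (range ((*) b))"
    and "disc_ideal p \<phi> = range ((*) \<delta>)"
    and "a\<^sup>2 - 4 * Polynomial.smult u p = b\<^sup>2 * \<delta>"
    and "coprime m p"
    and "\<sigma> \<in> frobenius_elements p"
  shows "represents_rho 2 \<psi> m \<sigma>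
    (mat_of_rows_list 2
      [[- Polynomial.smult (1/2) a, Polynomial.smult (1/2) (\<delta> * b)],
       [Polynomial.smult (1/2) b, - Polynomial.smult (1/2) a]])"
proof -
  define v where "v = Polynomial.smult u p"
  have two: "(2 :: 'q) \<noteq> 0" by (rule two_neq_0_if_odd_card[OF assms(1)])
  have irr: "irreducible p" using assms(3) by (simp add: good_primes_def)
  have disc: "a\<^sup>2 - 4 * v = b\<^sup>2 * \<delta>" using assms(10) by (simp only: v_def)
  have pb: "\<not> p dvd b" by (rule not_dvd_conductor[OF irr assms(5) two assms(10)])
  have b0: "b \<noteq> 0" using pb by auto
  have p_unit: "\<not> is_unit p" by (rule irreducible_not_unit[OF irr])
  have m0: "m \<noteq> 0" using assms(11) p_unit by (auto simp: coprime_0_left_iff)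
  have pm: "\<not> p dvd m" using coprime_common_divisor[OF assms(11), of p] p_unit by auto
  interpret P: tw_rep \<psi> by (rule tw_rep_of_drinfeld_module[OF assms(2)])
  obtain c where c: "c \<noteq> 0" "good_model 2 p (drinfeld_twist c \<psi>)"
      and phi: "\<phi> = (\<lambda>a. map_poly (residue p) (drinfeld_twist c \<psi> a))"
    using assms(4) unfolding is_reduction_def by blast
  obtain Q where Q: "primeideal Q (ring_of_type_algebra\<lparr>carrier := integral_closure\<rparr>)"
      "{a. emb a \<in> Q} = {a. p dvd a}" "\<forall>x\<in>integral_closure. \<sigma> x - x ^ (CARD('q) ^ degree p) \<in> Q"
      "\<sigma> \<in> abs_galois"
    using assms(12) unfolding frobenius_elements_def by blast
  have "degree (map_poly to_ac p) > 0"
    using p_unit irr by (auto simp: is_unit_iff_degree degree_map_poly)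
  then obtain \<zeta> where \<zeta>: "poly (map_poly to_ac p) \<zeta> = 0"
    using alg_closed_imp_poly_has_root by blast
  have deg: "degree (drinfeld_twist c \<psi> [:0, 1:]) = 2"
    using assms(2) by (simp add: P.degree_drinfeld_twist[OF c(1)] drinfeld_module_def)
  interpret R: reduction "drinfeld_twist c \<psi>" p \<zeta> Q \<sigma>
    by (intro reduction.intro good_rep.intro good_rep_axioms.intro frobenius_place.intro
        frobenius_place_axioms.intro residue_prime.intro P.tw_rep_drinfeld_twist c irr \<zeta> deg Q)
  have phi: "\<phi> = R.\<phi>" by (simp add: phi fun_eq_iff R.\<phi>_def)
  \<comment> \<open>Multiplication by \<open>C\<close> carries the torsion of the good model onto
    that of \<open>\<psi>\<close>, compatibly with \<open>A\<close> and \<open>\<sigma>\<close>;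
    facts about the reduction are transported along it.\<close>
  define C where "C = (to_ac c :: 'q closure)"
  have C0: "C \<noteq> 0" using c by (simp add: C_def)
  have act_C: "P.act d (C * x) = C * R.act d x" for d x
    using C0 by (simp add: P.tw_eval_drinfeld_twist[OF c(1)] C_def)
  have tors_C: "C * x \<in> P.tors N \<longleftrightarrow> x \<in> R.tors N" for x N
    using C0 by (simp add: P.tors_def R.tors_def act_C)
  have tors_CE: "\<exists>x'. x = C * x' \<and> x' \<in> R.tors N" if "x \<in> P.tors N" for x N
    using that C0 tors_C[of "x / C" N] by (intro exI[of _ "x / C"]) simp
  have sigma_C: "\<sigma> (C * x) = C * \<sigma> x" if "N \<noteq> 0" "x \<in> R.tors N" for x N
    unfolding C_def by (rule R.sigma_scale[OF R.Op_in_sep_closure[OF R.Op_tors[OF that]]])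
  \<comment> \<open>Torsion points of \<open>\<psi>\<close> may fail to be p-integral, so the laws
    of \<open>\<sigma>\<close> on them are inherited from the good model.\<close>
  interpret G: galois_action "\<lambda>a x. tw_eval (\<psi> a) x" \<sigma>
  proof
    fix N x y d assume N: "N \<noteq> 0" and x: "x \<in> P.tors N"
    obtain x' where x': "x = C * x'" "x' \<in> R.tors N" using tors_CE[OF x] by blast
    show "\<sigma> (x + y) = \<sigma> x + \<sigma> y" if y: "y \<in> P.tors N"
    proof -
      obtain y' where y': "y = C * y'" "y' \<in> R.tors N" using tors_CE[OF y] by blast
      have "\<sigma> (x + y) = \<sigma> (C * (x' + y'))" by (simp add: x' y' distrib_left)
      also have "\<dots> = C * (\<sigma> x' + \<sigma> y')"
        using x' y' by (simp add: sigma_C[OF N] R.tors_add R.sigma_add[OF N])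
      finally show ?thesis using x' y' by (simp add: sigma_C[OF N] distrib_left)
    qed
    show "\<sigma> (P.act d x) = P.act d (\<sigma> x)"
      using x' by (simp add: act_C sigma_C[OF N] R.tors_act R.sigma_act[OF N])
  qed
  have twice_C: "G.twice_sigma a (C * x) = C * R.twice_sigma a x" if "N \<noteq> 0" "x \<in> R.tors N" for x N
    by (simp add: G.twice_sigma_def R.twice_sigma_def act_C sigma_C[OF that] distrib_left)
  have tate: "tate_char_poly 2 \<psi> l \<sigma> [:v, a, 1:]"
    if "lead_coeff l = 1" "irreducible l" "l \<noteq> p" for l
    using assms(6,12) that unfolding weil_poly_def v_def by blast
  have struct: "\<exists>w. P.tors_basis 2 N w" "G.satisfies_quadratic a v N" if "\<not> p dvd N" for N
  proof -
    have "N \<noteq> 0" using that by auto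
    from P.torsion_structure[OF G.galois_action_axioms tate irr this that]
    show "\<exists>w. P.tors_basis 2 N w" "G.satisfies_quadratic a v N" by blast+
  qed
  have enough: "R.enough_torsion N" if "\<not> p dvd N" for N
  proof -
    obtain w where "P.tors_basis 2 N w" using struct(1)[OF \<open>\<not> p dvd N\<close>] by blast
    then obtain S where S: "S \<subseteq> P.tors N" "finite S" "card S = CARD('q) ^ (2 * degree N)"
      using P.many_torsion_points by blast
    have "inj_on (\<lambda>x. x / C) S" using C0 by (simp add: inj_on_def)
    then have "card ((\<lambda>x. x / C) ` S) = CARD('q) ^ (2 * degree N)" by (simp add: card_image S)
    moreover have "(\<lambda>x. x / C) ` S \<subseteq> R.tors N"
      using S(1) C0 by (auto simp: tors_C[symmetric])
    ultimately show ?thesis unfolding R.enough_torsion_def using S(2) by blast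
  qed
  have quad_R: "R.satisfies_quadratic a v N" if N: "\<not> p dvd N" for N
    unfolding R.satisfies_quadratic_def
  proof
    fix x assume x: "x \<in> R.tors N"
    have N0: "N \<noteq> 0" using N by auto
    have "\<sigma> (\<sigma> (C * x)) + P.act a (\<sigma> (C * x)) + P.act v (C * x) = 0"
      using struct(2)[OF N] x unfolding G.satisfies_quadratic_def tors_C[symmetric] by blast
    then have "C * (\<sigma> (\<sigma> x) + R.act a (\<sigma> x) + R.act v x) = 0"
      by (simp add: sigma_C[OF N0] x R.sigma_tors[OF N0] act_C distrib_left)
    then show "\<sigma> (\<sigma> x) + R.act a (\<sigma> x) + R.act v x = 0" using C0 by simp
  qed
  \<comment> \<open>The equation for \<open>\<pi>\<close> is derived from the torsion at one
    auxiliary prime; \<open>T\<close> or \<open>T + 1\<close> serves, since \<open>p\<close> cannot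
    divide both.\<close>
  have "\<exists>l. irreducible l \<and> \<not> p dvd l"
  proof (cases "p dvd [:0, 1:]")
    case True
    have "\<not> p dvd [:1, 1:]"
    proof
      assume "p dvd [:1, 1:]"
      then have "p dvd [:1, 1:] - [:0, 1:]" using True by (rule dvd_diff)
      then show False using p_unit by (simp add: one_pCons)
    qed
    then show ?thesis using irreducible_linear_field_poly[of 1 1] by auto
  next
    case False
    then show ?thesis using irreducible_linear_field_poly[of 1 0] by auto
  qed
  then obtain l where l: "irreducible l" "\<not> p dvd l" by blast
  have pl: "\<not> p dvd l ^ n" for n using l(2) irreducible_poly_dvd_power[OF irr] by blast
  have pi_quad: "R.\<pi> * R.\<pi> + R.\<Phi> a * R.\<pi> + R.\<Phi> (Polynomial.smult u p) = 0"
    using R.pi_quad[OF l enough[OF pl] quad_R[OF pl]] by (simp only: v_def)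
  obtain \<alpha> where "frobenius_order R.\<Phi> R.\<E> R.\<pi> \<alpha> a (Polynomial.smult u p) b \<delta>"
    using R.frobenius_order_exists[OF pi_quad assms(5) two b0 assms(10) assms(8)[unfolded phi]] by blast
  then interpret FO: frobenius_order R.\<Phi> R.\<E> R.\<pi> \<alpha> a "Polynomial.smult u p" b \<delta> .
  obtain \<theta> where \<theta>: "\<theta> \<in> R.\<E>" "R.\<Phi> 2 * R.\<pi> + R.\<Phi> a = R.\<Phi> b * \<theta>"
    using FO.exists_divisor by blast
  have kill: "G.twice_sigma a x = 0" if x: "x \<in> P.tors b" for x
  proof -
    obtain x' where x': "x = C * x'" "x' \<in> R.tors b" using tors_CE[OF x] by blast
    then show ?thesis using R.kills_torsion[OF pb \<theta> x'(2)] twice_C[OF b0 x'(2)] by simp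
  qed
  \<comment> \<open>If \<open>\<Theta>\<close> were the scalar \<open>d\<close> on the
    \<open>l\<close>-torsion, then \<open>2 \<sigma> + a = b d\<close> would hold on the torsion of
    \<open>b * l\<close>. Dividing by \<open>b l\<close> in \<open>E\<close> leads to the case
    excluded by \<open>FO.not_scalar\<close>.\<close>
  have nonscalar: "\<exists>y\<in>P.tors (b * l). G.twice_sigma a y \<noteq> P.act (b * d) y"
    if l: "irreducible l" "l dvd m" for l d
  proof (rule ccontr)
    assume "\<not> ?thesis"
    then have scalar: "G.twice_sigma a y = P.act (b * d) y" if "y \<in> P.tors (b * l)" for y using that by blast
    have l0: "l \<noteq> 0" "\<not> is_unit l" using l irreducible_not_unit by auto
    have "\<not> p dvd l" using pm l(2) dvd_trans by blast
    then have pbl: "\<not> p dvd b * l" using pb irreducible_poly_dvd_mult[OF irr] by blast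
    have bl0: "b * l \<noteq> 0" using b0 l0 by simp
    have "degree (b * l) > 0" using b0 l0 by (simp add: degree_mult_eq is_unit_iff_degree)
    moreover have "R.twice_sigma a y = R.act (b * d) y" if y: "y \<in> R.tors (b * l)" for y
      using scalar[of "C * y"] y C0 by (simp add: tors_C twice_C[OF bl0 y] act_C)
    ultimately obtain e where "e \<in> R.\<E>" "R.\<Phi> 2 * R.\<pi> + R.\<Phi> a - R.\<Phi> (b * d) = R.\<Phi> (b * l) * e"
      using R.factor_if_scalar[OF pbl _ enough[OF pbl]] by blast
    then show False using FO.not_scalar[OF l0(2)] by blast
  qed
  have pbbm: "\<not> p dvd b * (b * m)" using pb pm irreducible_poly_dvd_mult[OF irr] by blast
  let ?C = "mat_of_rows_list 2
      [[- Polynomial.smult (1/2) a, Polynomial.smult (1/2) (\<delta> * b)],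
       [Polynomial.smult (1/2) b, - Polynomial.smult (1/2) a]]"
  note half = twice_smult_half[OF two]
  \<comment> \<open>Four times the determinant is \<open>a^2 - b^2 \<delta> = 4 u p\<close>, so the
    determinant is \<open>u p\<close>, which is prime to \<open>m\<close>.\<close>
  have detC: "coprime (?C $$ (0,0) * ?C $$ (1,1) - ?C $$ (0,1) * ?C $$ (1,0)) m"
  proof -
    let ?d = "?C $$ (0,0) * ?C $$ (1,1) - ?C $$ (0,1) * ?C $$ (1,0)"
    have "2 * (2 * ?d) = (2 * Polynomial.smult (1/2) a) * (2 * Polynomial.smult (1/2) a) -
        (2 * Polynomial.smult (1/2) (\<delta> * b)) * (2 * Polynomial.smult (1/2) b)"
      by (simp add: algebra_simps)
    also have "\<dots> = 2 * (2 * v)"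
      unfolding half using disc by (simp add: power2_eq_square algebra_simps)
    finally have "2 * (2 * ?d) = 2 * (2 * v)" .
    moreover have "(2 :: 'q poly) \<noteq> 0" using two by (simp add: numeral_poly)
    ultimately have "?d = v" by (metis mult_left_cancel)
    then show ?thesis unfolding v_def using coprime_smult_right[OF assms(11,5)] by simp
  qed
  have conj: "conj_GL_mod 2 m B ?C" if w: "P.tors_basis 2 m w" and B: "rho_matrix 2 \<psi> w \<sigma> B" for w B
  proof -
    have Bc: "B \<in> carrier_mat 2 2" using B by (simp add: rho_matrix_def)
    have "\<sigma> (w j) = P.act (B $$ (0,j)) (w 0) + P.act (B $$ (1,j)) (w 1)" if "j < 2" for j
      using B that by (simp add: rho_matrix_def numeral_2_eq_2)
    from G.sigma_matrix_conjugate[OF m0 b0 disc P.act_surj[OF b0] kill struct(2)[OF pbbm] w nonscalar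
        this[of 0] this[of 1]]
    obtain x0 x1 y0 y1 where co: "coprime (x0 * y1 - x1 * y0) m"
      and d: "m dvd 2 * (B $$ (0,0) * x0 + B $$ (0,1) * x1) - (b * y0 - a * x0)"
        "m dvd 2 * (B $$ (1,0) * x0 + B $$ (1,1) * x1) - (b * y1 - a * x1)"
        "m dvd 2 * (B $$ (0,0) * y0 + B $$ (0,1) * y1) - (b * \<delta> * x0 - a * y0)"
        "m dvd 2 * (B $$ (1,0) * y0 + B $$ (1,1) * y1) - (b * \<delta> * x1 - a * y1)"
      by auto
    \<comment> \<open>Both orders of the sum occur: the diagonal entry comes first in the first
      column and last in the second.\<close>
    have h: "2 * (z - (- Polynomial.smult (1/2) s * x + Polynomial.smult (1/2) t * y)) = 2 * z - (t * y - s * x)"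
      "2 * (z - (Polynomial.smult (1/2) t * y + - Polynomial.smult (1/2) s * x)) = 2 * z - (t * y - s * x)"
      for z s t x y :: "'q poly"
    proof -
      have "2 * (z - (- s' * x + t' * y)) = 2 * z - ((2 * t') * y - (2 * s') * x)" for s' t' :: "'q poly"
        by (simp add: algebra_simps)
      from this[of "Polynomial.smult (1/2) s" "Polynomial.smult (1/2) t"] show "2 * (z - (- Polynomial.smult (1/2) s * x + Polynomial.smult (1/2) t * y)) = 2 * z - (t * y - s * x)"
        unfolding half .
      then show "2 * (z - (Polynomial.smult (1/2) t * y + - Polynomial.smult (1/2) s * x)) = 2 * z - (t * y - s * x)"
        by (simp only: add.commute)
    qed
    show ?thesis
    proof (rule conj_GL_mod_2I[OF Bc _ co _ _ _ _ detC])
      show "?C \<in> carrier_mat 2 2" by simp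
      show "m dvd (B $$ (0,0) * x0 + B $$ (0,1) * x1) - (?C $$ (0,0) * x0 + ?C $$ (1,0) * y0)"
        using d(1) by - (rule dvd_if_dvd_twice[OF two], simp only: h mat_of_rows_list_2_index One_nat_def)
      show "m dvd (B $$ (1,0) * x0 + B $$ (1,1) * x1) - (?C $$ (0,0) * x1 + ?C $$ (1,0) * y1)"
        using d(2) by - (rule dvd_if_dvd_twice[OF two], simp only: h mat_of_rows_list_2_index One_nat_def)
      show "m dvd (B $$ (0,0) * y0 + B $$ (0,1) * y1) - (?C $$ (0,1) * x0 + ?C $$ (1,1) * y0)"
        using d(3) by - (rule dvd_if_dvd_twice[OF two], simp only: h mat_of_rows_list_2_index One_nat_def mult.commute[of b \<delta>])
      show "m dvd (B $$ (1,0) * y0 + B $$ (1,1) * y1) - (?C $$ (0,1) * x1 + ?C $$ (1,1) * y1)"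
        using d(4) by - (rule dvd_if_dvd_twice[OF two], simp only: h mat_of_rows_list_2_index One_nat_def mult.commute[of b \<delta>])
    qed
  qed
  have matrix: "\<exists>B. rho_matrix 2 \<psi> w \<sigma> B" if w: "P.tors_basis 2 m w" for w
  proof -
    have "\<exists>c. \<sigma> (w j) = (\<Sum>i<2. P.act (c i) (w i))" if "j < 2" for j
      using w that G.sigma_tors[OF m0] unfolding P.tors_basis_def by blast
    then obtain d where "\<And>j. j < 2 \<Longrightarrow> \<sigma> (w j) = (\<Sum>i<2. P.act (d j i) (w i))" by metis
    then have "rho_matrix 2 \<psi> w \<sigma> (mat 2 2 (\<lambda>(i, j). d j i))"
      unfolding rho_matrix_def by (auto intro!: sum.cong)
    then show ?thesis by blast
  qed
  show ?thesis
    unfolding represents_rho_def P.torsion_basis_iff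
    using struct(1)[OF pm] matrix conj by blast
qed

end
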